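(* If $u\in\mathscr S'(\mathbb R^d)$ and $z\in\mathbb R^{2d}$ then $$WF_G(\Pi(z)u)=WF_G(u).$$
   Context: Notation: $\langle z\rangle=(1+|z|^2)^{1/2}$; $(\cdot,\cdot)$ is the action of $\mathscr S'$ (tempered distributions) on the Schwartz space $\mathscr S$, conjugate linear in the second argument and consistent with the $L^2$ inner product. For $z=(x,\xi)\in\mathbb R^{2d}$, $\Pi(z)=M_\xi T_x$ with $T_xf(y)=f(y-x)$, $M_\xi f(y)=e^{i\langle y,\xi\rangle}f(y)$, extended to $\mathscr S'(\mathbb R^d)$ in the usual way. For $\varphi\in\mathscr S(\mathbb R^d)\setminus\{0\}$ and $u\in\mathscr S'(\mathbb R^d)$, the short-time Fourier transform is $V_\varphi u(z)=(u,\Pi(z)\varphi)$, $z\in\mathbb R^{2d}$. A set is conic if it is invariant under multiplication by all positive reals. Gabor wave front set: let $\varphi\in\mathscr S(\mathbb R^d)\setminus\{0\}$ and $\Lambda=\alpha\mathbb Z^d\times\beta\mathbb Z^d$ with $\alpha,\beta>0$ sufficiently small that $\{\Pi(\lambda)\varphi\}_{\lambda\in\Lambda}$ is a Gabor frame for $L^2(\mathbb R^d)$, i.e. there are $A,B>0$ with $A\|f\|_{L^2}^2\le\sum_{\lambda\in\Lambda}|(f,\Pi(\lambda)\varphi)|^2\le B\|f\|_{L^2}^2$ for all $f\in L^2(\mathbb R^d)$. For $u\in\mathscr S'(\mathbb R^d)$, $WF_G(u)\subseteq\mathbb R^{2d}\setminus\{0\}$ is defined by: $z_0\in\mathbb R^{2d}\setminus\{0\}$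 satisfies $z_0\notin WF_G(u)$ if there is an open conic set $\Gamma\subseteq\mathbb R^{2d}\setminus\{0\}$ containing $z_0$ with $\sup_{\lambda\in\Lambda\cap\Gamma}\langle\lambda\rangle^N|V_\varphi u(\lambda)|<\infty$ for all $N\ge0$. (This set does not depend on the choice of such a pair $(\varphi,\Lambda)$.) *)

theory Defs
  imports "HOL-Analysis.Analysis"
begin

definition japanese_bracket :: "'a::real_normed_vector \<Rightarrow> real" where
  "japanese_bracket z = sqrt (1 + (norm z)\<^sup>2)"

(* Lists of coordinate directions play the role of multi-indices: the list [i1, ..., ik] stands
   for the operator D_i1 ... D_ik of order k. Different orderings of a multi-index give the same
   operator on smooth functions, so this only repeats conditions. *)

fun iter_partial :: "'n list \<Rightarrow> (real^'n \<Rightarrow> complex) \<Rightarrow> real^'n::finite \<Rightarrow> complex" where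
  "iter_partial [] f = f"
| "iter_partial (i # is) f =
     (\<lambda>x. frechet_derivative (iter_partial is f) (at x) (axis i 1))"

definition schwartz_space :: "(real^'n::finite \<Rightarrow> complex) set" where
  "schwartz_space = {f.
     (\<forall>is x. iter_partial is f differentiable (at x)) \<and>
     (\<forall>is k. bdd_above (range (\<lambda>x. japanese_bracket x ^ k * cmod (iter_partial is f x))))}"

definition schwartz_seminorm :: "nat \<Rightarrow> (real^'n::finite \<Rightarrow> complex) \<Rightarrow> real" where
  "schwartz_seminorm N f =
     (SUP (is, x) \<in> {is. length is \<le> N} \<times> UNIV. japanese_bracket x ^ N * cmod (iter_partial is f x))"

(* A distribution u is represented by the functional f \<mapsto> (u, f), which is conjugate linear.
   Only its values on the Schwartz space are meaningful. The seminorms above are increasing in N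
   and generate the topology of the Schwartz space, so the last clause is continuity. *)

definition tempered_distributions :: "((real^'n::finite \<Rightarrow> complex) \<Rightarrow> complex) set" where
  "tempered_distributions = {u.
     (\<forall>f\<in>schwartz_space. \<forall>g\<in>schwartz_space. u (\<lambda>y. f y + g y) = u f + u g) \<and>
     (\<forall>c. \<forall>f\<in>schwartz_space. u (\<lambda>y. c * f y) = cnj c * u f) \<and>
     (\<exists>C N. \<forall>f\<in>schwartz_space. cmod (u f) \<le> C * schwartz_seminorm N f)}"

definition translation :: "real^'n::finite \<Rightarrow> (real^'n \<Rightarrow> complex) \<Rightarrow> real^'n \<Rightarrow> complex" where
  "translation x f = (\<lambda>y. f (y - x))"

definition modulation :: "real^'n::finite \<Rightarrow> (real^'n \<Rightarrow> complex) \<Rightarrow> real^'n \<Rightarrow> complex" where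
  "modulation \<xi> f = (\<lambda>y. exp (\<i> * complex_of_real (y \<bullet> \<xi>)) * f y)"

definition tf_shift ::
    "(real^'n::finite) \<times> (real^'n) \<Rightarrow> (real^'n \<Rightarrow> complex) \<Rightarrow> real^'n \<Rightarrow> complex" where
  "tf_shift z f = modulation (snd z) (translation (fst z) f)"

definition L2_inner :: "(real^'n::finite \<Rightarrow> complex) \<Rightarrow> (real^'n \<Rightarrow> complex) \<Rightarrow> complex" where
  "L2_inner f g = (LINT y|lborel. f y * cnj (g y))"

(* The adjoint of M_\<xi> T_x on L^2 is T_{-x} M_{-\<xi>}. *)

lemma L2_inner_tf_shift:
  assumes [measurable]: "f \<in> borel_measurable borel" "g \<in> borel_measurable borel"
  shows "L2_inner (tf_shift (x, \<xi>) f) g = L2_inner f (translation (- x) (modulation (- \<xi>) g))"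
proof -
  have [measurable]: "cnj \<in> borel_measurable borel"
    by (intro borel_measurable_continuous_onI continuous_intros)
  have [measurable]: "tf_shift (x, \<xi>) f \<in> borel_measurable borel"
    unfolding tf_shift_def translation_def modulation_def by measurable
  have "L2_inner (tf_shift (x, \<xi>) f) g =
      (LINT y|distr lborel borel ((+) x). tf_shift (x, \<xi>) f y * cnj (g y))"
    by (simp add: L2_inner_def lborel_distr_plus)
  also have "\<dots> = (LINT y|lborel. tf_shift (x, \<xi>) f (x + y) * cnj (g (x + y)))"
    by (rule integral_distr) measurable
  also have "\<dots> = L2_inner f (translation (- x) (modulation (- \<xi>) g))"
    by (simp add: L2_inner_def tf_shift_def translation_def modulation_def exp_cnj
        add.commute mult_ac)
  finally show ?thesis .
qed

(* The extension to distributions: (\<Pi>(z)u, f) = (u, \<Pi>(z)^* f). *)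

definition tf_shift_dist ::
    "(real^'n::finite) \<times> (real^'n) \<Rightarrow> ((real^'n \<Rightarrow> complex) \<Rightarrow> complex)
       \<Rightarrow> (real^'n \<Rightarrow> complex) \<Rightarrow> complex" where
  "tf_shift_dist z u = (\<lambda>f. u (translation (- fst z) (modulation (- snd z) f)))"

definition stft ::
    "(real^'n::finite \<Rightarrow> complex) \<Rightarrow> ((real^'n \<Rightarrow> complex) \<Rightarrow> complex)
       \<Rightarrow> (real^'n) \<times> (real^'n) \<Rightarrow> complex" where
  "stft \<phi> u z = u (tf_shift z \<phi>)"

definition tf_lattice :: "real \<Rightarrow> real \<Rightarrow> ((real^'n::finite) \<times> (real^'n)) set" where
  "tf_lattice \<alpha> \<beta> =
     {((\<chi> i. \<alpha> * of_int (j i)), (\<chi> i. \<beta> * of_int (k i))) | j k. True}"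

(* Every class in L^2 has a Borel measurable representative, so it suffices to let f range over
   Borel functions. *)

definition square_integrable :: "(real^'n::finite \<Rightarrow> complex) \<Rightarrow> bool" where
  "square_integrable f \<longleftrightarrow>
     f \<in> borel_measurable lborel \<and> integrable lborel (\<lambda>y. (cmod (f y))\<^sup>2)"

definition gabor_frame ::
    "(real^'n::finite \<Rightarrow> complex) \<Rightarrow> ((real^'n) \<times> (real^'n)) set \<Rightarrow> bool" where
  "gabor_frame \<phi> \<Lambda> \<longleftrightarrow> (\<exists>A>0. \<exists>B>0. \<forall>f. square_integrable f \<longrightarrow>
     (\<lambda>l. (cmod (L2_inner f (tf_shift l \<phi>)))\<^sup>2) summable_on \<Lambda> \<and>
     A * (LINT y|lborel. (cmod (f y))\<^sup>2) \<le> (\<Sum>\<^sub>\<infinity>l\<in>\<Lambda>. (cmod (L2_inner f (tf_shift l \<phi>)))\<^sup>2) \<and>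
     (\<Sum>\<^sub>\<infinity>l\<in>\<Lambda>. (cmod (L2_inner f (tf_shift l \<phi>)))\<^sup>2) \<le> B * (LINT y|lborel. (cmod (f y))\<^sup>2))"

(* The library's conic sets are closed under multiplication by 0 as well. *)

definition pos_conic :: "'a::real_vector set \<Rightarrow> bool" where
  "pos_conic S \<longleftrightarrow> (\<forall>x\<in>S. \<forall>t>0. t *\<^sub>R x \<in> S)"

definition gabor_WF ::
    "(real^'n::finite \<Rightarrow> complex) \<Rightarrow> ((real^'n) \<times> (real^'n)) set
       \<Rightarrow> ((real^'n \<Rightarrow> complex) \<Rightarrow> complex) \<Rightarrow> ((real^'n) \<times> (real^'n)) set" where
  "gabor_WF \<phi> \<Lambda> u = {z0. z0 \<noteq> 0 \<and>
     \<not> (\<exists>\<Gamma>. open \<Gamma> \<and> pos_conic \<Gamma> \<and> \<Gamma> \<subseteq> - {0} \<and> z0 \<in> \<Gamma> \<and>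
          (\<forall>N::nat. bdd_above
             ((\<lambda>l. japanese_bracket l ^ N * cmod (stft \<phi> u l)) ` (\<Lambda> \<inter> \<Gamma>))))}"

end

theory Submission
  imports Defs
begin

text \<open>
  Write \<open>\<psi> = \<Pi>(-z)\<phi>\<close>; up to a phase \<open>V\<^sub>\<phi>(\<Pi>(z)u)\<close> is \<open>V\<^sub>\<psi> u\<close>, so the claim is that the windows \<open>\<phi>\<close>
  and \<open>\<psi>\<close> define the same wave front set with respect to \<open>\<Lambda>\<close>. Every Schwartz function has a Gabor expansion
  \<open>g = \<Sum>\<^sub>l c\<^sub>l \<Pi>(l)\<phi>\<close> with rapidly decreasing coefficients, and hence \<open>V\<^sub>g u(m)\<close> is dominated by
  \<open>\<Sum>\<^sub>l |c\<^sub>l| |V\<^sub>\<phi> u(m + l)|\<close>, which transports rapid decay from a cone to any smaller cone. This is applied to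
  \<open>\<Pi>(-z)\<phi>\<close> and, after a shift by \<open>-z\<close>, to \<open>\<Pi>(z)\<phi>\<close>.

  The coefficients come from the frame iteration \<open>f \<mapsto> f - S f / B\<close>, where \<open>S\<close> is the frame operator and
  \<open>A \<le> S \<le> B\<close>: the residuals decay geometrically in \<open>L\<^sup>2\<close>, while polynomially weighted \<open>l\<^sup>2\<close> norms of their
  coefficients grow at most like \<open>(1 + \<delta>)\<^sup>n\<close> for every \<open>\<delta> > 0\<close>, since the Gram matrix decays rapidly off
  the diagonal. Interpolating the two bounds shows that the coefficients of the limit decay rapidly.
\<close>

section \<open>Polynomial weights\<close>

text \<open>Independence of the window would make the claim immediate. It has to be proved here for
  two windows that differ by \<Pi>(z), on one fixed lattice that need not contain z, so reindexing
  the lattice does not help. The usual route uses the canonical dual window and needs that window to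
  be Schwartz, a spectral invariance statement. The iteration replaces it: the Gram operator G
  commutes with the weight (1 + e |l|)^K up to an error O(e), so the weighted norms grow by at most
  1 + \<delta> per step, with \<delta> chosen such that r (1 + \<delta>) < 1 for r = 1 - A / B. For
  fixed e > 0 this weight is comparable with (1 + |l|)^K, so a small e costs only a constant. The
  geometric decay has to be read off on functions. On coefficients the map c - G c / B fixes the
  kernel of synthesis, hence it is only nonexpansive; this is what the weighted estimate perturbs.
  Both inclusions expand in the system generated by \<phi>. Applying \<Pi>(-z) to such an expansion
  turns it into one in the system generated by \<psi>, up to phases.\<close>

definition wt :: "'a::real_normed_vector \<Rightarrow> real" where
  "wt z = 1 + norm z"

lemma wt_ge_1 [simp]: "1 \<le> wt z"
  by (simp add: wt_def)

lemma wt_pos [simp]: "0 < wt z" and wt_nonneg [simp]: "0 \<le> wt z" and wt_nonzero [simp]: "wt z \<noteq> 0"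
  using wt_ge_1[of z] by linarith+

lemma wt_minus [simp]: "wt (- z) = wt z"
  by (simp add: wt_def)

text \<open>The reason for working with \<open>wt\<close>: it is submultiplicative with constant 1,
  so powers of weights can be shifted without collecting constants. \<open>japanese_bracket\<close>
  returns only at the two ends, through the comparison with factor 2.\<close>

lemma wt_add_le: "wt (a + b) \<le> wt a * wt b"
proof -
  have "norm (a + b) \<le> norm a + norm b" by (rule norm_triangle_ineq)
  moreover have "0 \<le> norm a * norm b" by simp
  ultimately show ?thesis unfolding wt_def distrib_left distrib_right by linarith
qed

lemma wt_add_power_le: "wt (a + b) ^ n \<le> wt a ^ n * wt b ^ n"
  by (metis power_mono power_mult_distrib wt_add_le wt_nonneg)

lemma wt_power_ge_1 [simp]: "1 \<le> wt z ^ n"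
  by (simp add: one_le_power)

lemma wt_prod_le: "wt (z :: 'a::real_normed_vector \<times> 'b::real_normed_vector) \<le> wt (fst z) * wt (snd z)"
proof -
  have "norm z \<le> norm (fst z) + norm (snd z)"
    by (metis norm_Pair_le prod.collapse)
  moreover have "0 \<le> norm (fst z) * norm (snd z)" by simp
  ultimately show ?thesis unfolding wt_def distrib_left distrib_right by linarith
qed

lemma wt_fst_le: "wt (fst z) \<le> wt z" and wt_snd_le: "wt (snd z) \<le> wt z"
  using norm_fst_le[of "fst z" "snd z"] norm_snd_le[of "snd z" "fst z"] by (simp_all add: wt_def)

lemma japanese_bracket_le_wt: "japanese_bracket z \<le> wt z"
  unfolding japanese_bracket_def wt_def
  by (rule real_le_lsqrt) (auto simp: power2_eq_square algebra_simps)

lemma wt_le_japanese_bracket: "wt z \<le> 2 * japanese_bracket z"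
proof -
  have "1 \<le> japanese_bracket z" "norm z \<le> japanese_bracket z"
    unfolding japanese_bracket_def by (auto intro: real_le_rsqrt)
  then show ?thesis by (simp add: wt_def)
qed

lemma japanese_bracket_nonneg [simp]: "0 \<le> japanese_bracket z"
  by (simp add: japanese_bracket_def)

lemma continuous_on_wt [continuous_intros]:
  "continuous_on S f \<Longrightarrow> continuous_on S (\<lambda>x. wt (f x))"
  unfolding wt_def by (intro continuous_intros)

text \<open>The function is dominated by a sum of multiples of indicators of concentric balls. The
  ball of radius m + 1 has volume of order (m + 1)^DIM and height (m + 1)^(-K), so the spare
  exponent 2 leaves a convergent series.\<close>

lemma integrable_wt:
  assumes K: "K \<ge> DIM('a::euclidean_space) + 2"
  shows "integrable lborel (\<lambda>y::'a. 1 / wt y ^ K)"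
proof (rule integrableI_bounded)
  have "continuous_on UNIV (\<lambda>y::'a. 1 / wt y ^ K)"
    by (intro continuous_intros) auto
  then show "(\<lambda>y::'a. 1 / wt y ^ K) \<in> borel_measurable lborel"
    by (simp add: borel_measurable_continuous_onI)
  define v where "v = unit_ball_vol (DIM('a))"
  \<comment> \<open>At a point y the single term with m equal to the floor of |y| already dominates
    the integrand.\<close>
  define g where "g = (\<lambda>(m::nat) (y::'a). ennreal (1 / real (m + 1) ^ K) * indicator (cball 0 (real (m + 1))) y)"
  have v0: "0 \<le> v" by (simp add: v_def)
  have [measurable]: "cball (0::'a) t \<in> sets borel" for t by (rule borel_closed) simp
  have "ennreal (norm (1 / wt y ^ K)) \<le> (\<Sum>m. g m y)" for y :: 'a
  proof -
    define m where "m = nat \<lfloor>norm y\<rfloor>"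
    have m: "real m \<le> norm y" "norm y \<le> real (m + 1)"
      unfolding m_def by (auto intro: of_nat_floor simp: algebra_simps) linarith
    have "1 / wt y ^ K \<le> 1 / real (m + 1) ^ K"
      by (intro divide_left_mono power_mono mult_pos_pos) (use m in \<open>auto simp: wt_def\<close>)
    then have "ennreal (norm (1 / wt y ^ K)) \<le> g m y"
      using m by (auto simp: g_def intro!: ennreal_leI)
    also have "\<dots> \<le> (\<Sum>m. g m y)"
      using sum_le_suminf[of "\<lambda>m. g m y" "{m}"] by (auto simp: summableI)
    finally show ?thesis .
  qed
  then have "(\<integral>\<^sup>+y. ennreal (norm (1 / wt y ^ K)) \<partial>(lborel::'a measure)) \<le> (\<integral>\<^sup>+y. (\<Sum>m. g m y) \<partial>lborel)"
    by (intro nn_integral_mono) auto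
  also have "\<dots> = (\<Sum>m. \<integral>\<^sup>+y. g m y \<partial>lborel)"
    unfolding g_def by (intro nn_integral_suminf) measurable
  also have "\<dots> \<le> (\<Sum>m. ennreal (v * (1 / real (m + 1) ^ 2)))"
  proof (intro suminf_le summableI)
    fix m :: nat
    have "(\<integral>\<^sup>+y. g m y \<partial>lborel) = ennreal (1 / real (m + 1) ^ K) * emeasure lborel (cball (0::'a) (real (m + 1)))"
      unfolding g_def by (simp add: nn_integral_cmult_indicator del: of_nat_add)
    also have "\<dots> = ennreal (1 / real (m + 1) ^ K * (v * real (m + 1) ^ DIM('a)))"
      by (subst emeasure_cball) (simp_all add: v_def flip: ennreal_mult)
    also have "\<dots> \<le> ennreal (v * (1 / real (m + 1) ^ 2))"
    proof (rule ennreal_leI)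
      have "real (m + 1) ^ (DIM('a) + 2) \<le> real (m + 1) ^ K"
        by (intro power_increasing) (use K in auto)
      then have "real (m + 1) ^ DIM('a) * real (m + 1) ^ 2 \<le> real (m + 1) ^ K"
        by (simp only: power_add)
      then have "real (m + 1) ^ DIM('a) / real (m + 1) ^ K \<le> 1 / real (m + 1) ^ 2"
        by (simp add: divide_simps del: of_nat_add) 
      then have "v * (real (m + 1) ^ DIM('a) / real (m + 1) ^ K) \<le> v * (1 / real (m + 1) ^ 2)"
        using v0 by (rule mult_left_mono)
      then show "1 / real (m + 1) ^ K * (v * real (m + 1) ^ DIM('a)) \<le> v * (1 / real (m + 1) ^ 2)"
        by (simp add: mult_ac)
    qed
    finally show "(\<integral>\<^sup>+y. g m y \<partial>lborel) \<le> ennreal (v * (1 / real (m + 1) ^ 2))" .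
  qed
  also have "\<dots> = ennreal (\<Sum>m. v * (1 / real (m + 1) ^ 2))"
  proof (rule suminf_ennreal2)
    have "summable (\<lambda>m. 1 / real (Suc m) ^ 2)"
      using inverse_power_summable[of 2, where 'a = real] summable_Suc_iff[of "\<lambda>m. inverse (real m ^ 2)"]
      by (simp add: inverse_eq_divide)
    then show "summable (\<lambda>m. v * (1 / real (m + 1) ^ 2))"
      by (intro summable_mult) (simp add: add.commute)
  qed (simp add: v0)
  also have "\<dots> < \<infinity>" by simp
  finally show "(\<integral>\<^sup>+y. ennreal (norm (1 / wt y ^ K)) \<partial>(lborel::'a measure)) < \<infinity>" .
qed

text \<open>Comparison with the integral: balls of radius r = d / 2 around the points are disjoint,
  and on each of them \<open>wt\<close> changes by a factor of at most 1 + r. The bound is uniform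
  in the finite subset.\<close>

lemma summable_on_wt:
  fixes \<Lambda> :: "'a::euclidean_space set"
  assumes d: "d > 0" and sep: "\<And>a b. a \<in> \<Lambda> \<Longrightarrow> b \<in> \<Lambda> \<Longrightarrow> a \<noteq> b \<Longrightarrow> d \<le> dist a b"
    and K: "K \<ge> DIM('a) + 2"
  shows "(\<lambda>a. 1 / wt a ^ K) summable_on \<Lambda>"
proof -
  define r where "r = d / 2"
  have r: "r > 0" using d by (simp add: r_def)
  have fin: "emeasure lborel (ball a r) < top" for a :: 'a
    using emeasure_lborel_ball_finite[of a r] by simp
  define v where "v = measure lborel (ball (0::'a) r)"
  have v: "measure lborel (ball (a::'a) r) = v" for a
    unfolding v_def using r by (simp add: content_ball)
  have v0: "v > 0" unfolding v_def using r by (simp add: content_ball)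
  have "sum (\<lambda>a. 1 / wt a ^ K) F \<le> ((1 + r) ^ K * (LINT y|lborel. 1 / wt (y::'a) ^ K)) / v" 
    if F: "finite F" "F \<subseteq> \<Lambda>" for F
  proof -
    have "(\<Sum>a\<in>F. 1 / wt a ^ K) * v = (LINT y|lborel. (\<Sum>a\<in>F. 1 / wt a ^ K * indicator (ball a r) y))"
      by (subst Bochner_Integration.integral_sum)
         (auto simp: sum_distrib_right v emeasure_lborel_ball_finite
           intro!: integrable_divide_zero integrable_real_indicator fin)
    also have "\<dots> \<le> (LINT y|lborel. (1 + r) ^ K * (1 / wt (y::'a) ^ K))"
    proof (rule integral_mono)
      show "integrable lborel (\<lambda>y::'a. \<Sum>a\<in>F. 1 / wt a ^ K * indicator (ball a r) y)"
        by (intro Bochner_Integration.integrable_sum integrable_mult_right integrable_real_indicator)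
           (auto simp: fin)
      show "integrable lborel (\<lambda>y::'a. (1 + r) ^ K * (1 / wt y ^ K))"
        by (intro integrable_mult_right integrable_wt K)
      fix y :: 'a
      show "(\<Sum>a\<in>F. 1 / wt a ^ K * indicator (ball a r) y) \<le> (1 + r) ^ K * (1 / wt y ^ K)"
      proof (cases "\<exists>a\<in>F. y \<in> ball a r")
        case True
        then obtain a where a: "a \<in> F" "y \<in> ball a r" by blast
        have "(\<Sum>b\<in>F. 1 / wt b ^ K * indicator (ball b r) y) = (\<Sum>b\<in>{a}. 1 / wt b ^ K * indicator (ball b r) y)"
        proof (rule sum.mono_neutral_right)
          show "\<forall>b\<in>F - {a}. 1 / wt b ^ K * indicator (ball b r) y = 0"
          proof
            fix b assume b: "b \<in> F - {a}"
            have "d \<le> dist a b" using sep[of a b] a b F by auto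
            then have "y \<notin> ball b r"
              using a dist_triangle[of a b y] by (auto simp: r_def dist_commute)
            then show "1 / wt b ^ K * indicator (ball b r) y = 0" by simp
          qed
        qed (use F a in auto)
        also have "\<dots> = 1 / wt a ^ K" using a by simp
        also have "\<dots> \<le> (1 + r) ^ K * (1 / wt y ^ K)"
        proof -
          have "wt y ^ K \<le> wt a ^ K * wt (y - a) ^ K"
            using wt_add_power_le[of a "y - a" K] by simp
          also have "\<dots> \<le> wt a ^ K * (1 + r) ^ K"
            using a by (intro mult_left_mono power_mono) (auto simp: wt_def dist_norm norm_minus_commute)
          finally show ?thesis by (simp add: divide_simps mult.commute)
        qed
        finally show ?thesis .
      next
        case False
        then have "(\<Sum>a\<in>F. 1 / wt a ^ K * indicator (ball a r) y) = 0"
          by (intro sum.neutral) auto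
        then show ?thesis using r by simp
      qed
    qed
    also have "\<dots> = (1 + r) ^ K * (LINT y|lborel. 1 / wt (y::'a) ^ K)"
      by (rule integral_mult_right_zero)
    finally show ?thesis using v0 by (simp add: pos_le_divide_eq)
  qed
  then show ?thesis
    by (intro nonneg_bdd_above_summable_on bdd_aboveI2) auto
qed

section \<open>Schwartz functions\<close>

lemma schwartzD:
  assumes "f \<in> schwartz_space"
  shows "iter_partial is f differentiable (at x)"
    and "\<exists>C\<ge>0. \<forall>x. wt x ^ k * cmod (iter_partial is f x) \<le> C"
proof -
  show "iter_partial is f differentiable (at x)"
    using assms by (simp add: schwartz_space_def)
  obtain C where C: "\<And>x. japanese_bracket x ^ k * cmod (iter_partial is f x) \<le> C"
    using assms by (fastforce simp: schwartz_space_def bdd_above_def)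
  have "wt x ^ k * cmod (iter_partial is f x) \<le> 2 ^ k * \<bar>C\<bar>" for x
  proof -
    have "wt x ^ k \<le> 2 ^ k * japanese_bracket x ^ k"
      by (metis power_mono power_mult_distrib wt_le_japanese_bracket wt_nonneg)
    then have "wt x ^ k * cmod (iter_partial is f x)
        \<le> 2 ^ k * (japanese_bracket x ^ k * cmod (iter_partial is f x))"
      by (metis mult.assoc mult_right_mono norm_ge_zero)
    also have "\<dots> \<le> 2 ^ k * \<bar>C\<bar>"
      using C[of x] by (intro mult_left_mono) auto
    finally show ?thesis .
  qed
  then show "\<exists>C\<ge>0. \<forall>x. wt x ^ k * cmod (iter_partial is f x) \<le> C"
    by (intro exI[of _ "2 ^ k * \<bar>C\<bar>"]) auto
qed

lemma schwartzI:
  assumes "\<And>is x. iter_partial is f differentiable (at x)"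
    and "\<And>is k. \<exists>C. \<forall>x. wt x ^ k * cmod (iter_partial is f x) \<le> C"
  shows "f \<in> schwartz_space"
proof -
  have "bdd_above (range (\<lambda>x. japanese_bracket x ^ k * cmod (iter_partial is f x)))" for "is" k
  proof -
    obtain C where C: "\<And>x. wt x ^ k * cmod (iter_partial is f x) \<le> C"
      using assms(2) by blast
    have "japanese_bracket x ^ k * cmod (iter_partial is f x) \<le> C" for x
      by (rule order_trans[OF _ C[of x]])
        (intro mult_right_mono power_mono japanese_bracket_le_wt; simp)
    then show ?thesis by (rule bdd_aboveI2)
  qed
  then show ?thesis using assms(1) by (simp add: schwartz_space_def)
qed

lemma iter_partial_append: "iter_partial (is @ js) f = iter_partial is (iter_partial js f)"
  by (induction "is") auto

lemma schwartz_iter_partial: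
  assumes "f \<in> schwartz_space"
  shows "iter_partial js f \<in> schwartz_space"
proof (rule schwartzI)
  fix "is" k
  show "iter_partial is (iter_partial js f) differentiable (at x)" for x
    unfolding iter_partial_append[symmetric] by (rule schwartzD[OF assms])
  show "\<exists>C. \<forall>x. wt x ^ k * cmod (iter_partial is (iter_partial js f) x) \<le> C"
    unfolding iter_partial_append[symmetric] using schwartzD(2)[OF assms] by blast
qed

lemma schwartz_has_derivative:
  assumes "f \<in> schwartz_space"
  shows "(iter_partial is f has_derivative frechet_derivative (iter_partial is f) (at x)) (at x)"
  using schwartzD(1)[OF assms] by (simp add: frechet_derivative_works)

text \<open>Converts a known derivative of one iterated partial into a formula for the next one; the
  commutation rules below are inductions over the list with this as the step.\<close>

lemma iter_partial_has_derivativeI: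
  assumes "\<And>x. (iter_partial is f has_derivative D x) (at x)"
  shows "iter_partial (i # is) f = (\<lambda>x. D x (axis i 1))"
  using frechet_derivative_at[OF assms] by auto

section \<open>The Schwartz space as a vector space\<close>

lemma iter_partial_add:
  assumes f: "f \<in> schwartz_space" and g: "g \<in> schwartz_space"
  shows "iter_partial is (\<lambda>y. f y + g y) = (\<lambda>y. iter_partial is f y + iter_partial is g y)"
proof (induction "is")
  case (Cons i "is")
  have "(iter_partial is (\<lambda>y. f y + g y) has_derivative
      (\<lambda>h. frechet_derivative (iter_partial is f) (at x) h + frechet_derivative (iter_partial is g) (at x) h)) (at x)" for x
    unfolding Cons.IH by (intro has_derivative_add schwartz_has_derivative f g)
  from iter_partial_has_derivativeI[OF this] show ?case by simp
qed auto

lemma iter_partial_cmult: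
  assumes f: "f \<in> schwartz_space"
  shows "iter_partial is (\<lambda>y. c * f y) = (\<lambda>y. c * iter_partial is f y)"
proof (induction "is")
  case (Cons i "is")
  have "(iter_partial is (\<lambda>y. c * f y) has_derivative
      (\<lambda>h. c * frechet_derivative (iter_partial is f) (at x) h)) (at x)" for x
    unfolding Cons.IH by (intro has_derivative_mult_right schwartz_has_derivative f)
  from iter_partial_has_derivativeI[OF this] show ?case by simp
qed auto

lemma iter_partial_zero: "iter_partial is (\<lambda>_. 0) = (\<lambda>_. 0)"
  by (induction "is") auto

lemma schwartz_zero: "(\<lambda>_. 0) \<in> schwartz_space"
  by (rule schwartzI) (auto simp: iter_partial_zero)

lemma schwartz_add:
  assumes f: "f \<in> schwartz_space" and g: "g \<in> schwartz_space"
  shows "(\<lambda>y. f y + g y) \<in> schwartz_space"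
proof (rule schwartzI)
  fix "is" k
  show "iter_partial is (\<lambda>y. f y + g y) differentiable (at x)" for x
    unfolding iter_partial_add[OF f g] by (intro differentiable_add schwartzD f g)
  obtain C1 where C1: "\<And>x. wt x ^ k * cmod (iter_partial is f x) \<le> C1"
    using schwartzD(2)[OF f] by meson
  obtain C2 where C2: "\<And>x. wt x ^ k * cmod (iter_partial is g x) \<le> C2"
    using schwartzD(2)[OF g] by meson
  have "wt x ^ k * cmod (iter_partial is (\<lambda>y. f y + g y) x) \<le> C1 + C2" for x
  proof -
    have "wt x ^ k * cmod (iter_partial is (\<lambda>y. f y + g y) x)
        \<le> wt x ^ k * (cmod (iter_partial is f x) + cmod (iter_partial is g x))"
      unfolding iter_partial_add[OF f g] by (intro mult_left_mono norm_triangle_ineq) simp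
    also have "\<dots> \<le> C1 + C2"
      using C1[of x] C2[of x] by (simp add: distrib_left)
    finally show ?thesis .
  qed
  then show "\<exists>C. \<forall>x. wt x ^ k * cmod (iter_partial is (\<lambda>y. f y + g y) x) \<le> C" by blast
qed

lemma schwartz_cmult:
  assumes f: "f \<in> schwartz_space"
  shows "(\<lambda>y. c * f y) \<in> schwartz_space"
proof (rule schwartzI)
  fix "is" k
  show "iter_partial is (\<lambda>y. c * f y) differentiable (at x)" for x
    unfolding iter_partial_cmult[OF f] by (intro differentiable_mult differentiable_const schwartzD f)
  obtain C where C: "\<And>x. wt x ^ k * cmod (iter_partial is f x) \<le> C"
    using schwartzD(2)[OF f] by meson
  have "wt x ^ k * cmod (iter_partial is (\<lambda>y. c * f y) x) \<le> cmod c * C" for x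
    using mult_left_mono[OF C[of x], of "cmod c"]
    by (simp add: iter_partial_cmult[OF f] norm_mult mult_ac)
  then show "\<exists>C. \<forall>x. wt x ^ k * cmod (iter_partial is (\<lambda>y. c * f y) x) \<le> C" by blast
qed

lemma schwartz_sum:
  assumes "\<And>j. j \<in> J \<Longrightarrow> f j \<in> schwartz_space"
  shows "(\<lambda>y. \<Sum>j\<in>J. f j y) \<in> schwartz_space"
  using assms by (induction J rule: infinite_finite_induct) (auto simp: schwartz_zero schwartz_add)

lemma iter_partial_sum:
  assumes "\<And>j. j \<in> J \<Longrightarrow> f j \<in> schwartz_space"
  shows "iter_partial is (\<lambda>y. \<Sum>j\<in>J. f j y) = (\<lambda>y. \<Sum>j\<in>J. iter_partial is (f j) y)"
  using assms
  by (induction J rule: infinite_finite_induct)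
    (auto simp: iter_partial_zero iter_partial_add schwartz_sum)

lemma schwartz_diff:
  assumes f: "f \<in> schwartz_space" and g: "g \<in> schwartz_space"
  shows "(\<lambda>y. f y - g y) \<in> schwartz_space"
  using schwartz_add[OF f schwartz_cmult[OF g, of "-1"]] by simp

lemma iter_partial_diff:
  assumes f: "f \<in> schwartz_space" and g: "g \<in> schwartz_space"
  shows "iter_partial is (\<lambda>y. f y - g y) = (\<lambda>y. iter_partial is f y - iter_partial is g y)"
  using iter_partial_add[OF f schwartz_cmult[OF g, of "-1"], of "is"] iter_partial_cmult[OF g, of "is" "-1"] by simp

section \<open>Translations, modulations and time-frequency shifts of Schwartz functions\<close>

lemma iter_partial_translation:
  assumes f: "f \<in> schwartz_space"
  shows "iter_partial is (translation a f) = translation a (iter_partial is f)"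
proof (induction "is")
  case (Cons i "is")
  have "(iter_partial is (translation a f) has_derivative
      (\<lambda>h. frechet_derivative (iter_partial is f) (at (x - a)) h)) (at x)" for x
  proof -
    have "((\<lambda>y. iter_partial is f (y - a)) has_derivative
        (\<lambda>h. frechet_derivative (iter_partial is f) (at (x - a)) h)) (at x)"
      by (rule has_derivative_compose[where f = "\<lambda>y. y - a" and f' = "\<lambda>h. h"])
        (auto intro!: derivative_eq_intros schwartz_has_derivative f)
    then show ?thesis unfolding Cons.IH by (simp add: translation_def)
  qed
  from iter_partial_has_derivativeI[OF this] show ?case by (simp add: translation_def)
qed auto

lemma schwartz_translation:
  assumes f: "f \<in> schwartz_space"
  shows "translation a f \<in> schwartz_space"
proof (rule schwartzI)
  fix "is" k
  show "iter_partial is (translation a f) differentiable (at x)" for x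
  proof -
    have "((\<lambda>y. iter_partial is f (y - a)) has_derivative
        (\<lambda>h. frechet_derivative (iter_partial is f) (at (x - a)) h)) (at x)"
      by (rule has_derivative_compose[where f = "\<lambda>y. y - a" and f' = "\<lambda>h. h"])
        (auto intro!: derivative_eq_intros schwartz_has_derivative f)
    then have "translation a (iter_partial is f) differentiable (at x)"
      unfolding translation_def differentiable_def by blast
    then show ?thesis
      by (simp only: iter_partial_translation[OF f])
  qed
  obtain C where C: "\<And>x. wt x ^ k * cmod (iter_partial is f x) \<le> C"
    using schwartzD(2)[OF f] by meson
  have "wt x ^ k * cmod (iter_partial is (translation a f) x) \<le> wt a ^ k * C" for x
  proof -
    have "wt x ^ k * cmod (iter_partial is (translation a f) x)
        \<le> (wt a ^ k * wt (x - a) ^ k) * cmod (iter_partial is f (x - a))"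
      unfolding iter_partial_translation[OF f] 
      unfolding translation_def
      using wt_add_power_le[of a "x - a" k] by (intro mult_right_mono) auto
    also have "\<dots> \<le> wt a ^ k * C"
      using mult_left_mono[OF C[of "x - a"], of "wt a ^ k"] by (simp add: mult_ac)
    finally show ?thesis .
  qed
  then show "\<exists>C. \<forall>x. wt x ^ k * cmod (iter_partial is (translation a f) x) \<le> C" by blast
qed

text \<open>Conjugating \<open>iter_partial\<close> with \<open>modulation \<xi>\<close> replaces each \<open>\<partial>\<^sub>i\<close> by \<open>\<partial>\<^sub>i + \<i> \<xi>\<^sub>i\<close>.\<close>

fun mod_partial :: "real^'n \<Rightarrow> 'n list \<Rightarrow> (real^'n \<Rightarrow> complex) \<Rightarrow> real^'n::finite \<Rightarrow> complex" where
  "mod_partial \<xi> [] f = f"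
| "mod_partial \<xi> (i # is) f =
     (\<lambda>y. iter_partial [i] (mod_partial \<xi> is f) y + \<i> * \<xi> $ i * mod_partial \<xi> is f y)"

lemma schwartz_mod_partial:
  assumes "f \<in> schwartz_space"
  shows "mod_partial \<xi> is f \<in> schwartz_space"
proof (induction "is")
  case (Cons i "is")
  show ?case
    unfolding mod_partial.simps
    by (intro schwartz_add schwartz_cmult schwartz_iter_partial Cons.IH)
qed (use assms in auto)

lemma modulation_has_derivative:
  assumes "(f has_derivative D) (at x)"
  shows "(modulation \<xi> f has_derivative
    (\<lambda>h. exp (\<i> * (x \<bullet> \<xi>)) * (D h + \<i> * (h \<bullet> \<xi>) * f x))) (at x)"
proof -
  have 1: "((\<lambda>y. \<i> * complex_of_real (y \<bullet> \<xi>)) has_derivative (\<lambda>h. \<i> * complex_of_real (h \<bullet> \<xi>))) (at x)"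
    by (auto intro!: derivative_eq_intros)
  have 2: "((\<lambda>y. exp (\<i> * complex_of_real (y \<bullet> \<xi>))) has_derivative
      (\<lambda>h. exp (\<i> * complex_of_real (x \<bullet> \<xi>)) * (\<i> * complex_of_real (h \<bullet> \<xi>)))) (at x)"
    by (rule has_derivative_compose[OF 1]) (use DERIV_exp in \<open>auto simp: has_field_derivative_def\<close>)
  show ?thesis unfolding modulation_def
    by (rule has_derivative_eq_rhs[OF has_derivative_mult[OF 2 assms]]) (auto simp: algebra_simps)
qed

lemma iter_partial_modulation:
  assumes f: "f \<in> schwartz_space"
  shows "iter_partial is (modulation \<xi> f) = modulation \<xi> (mod_partial \<xi> is f)"
proof (induction "is")
  case (Cons i "is")
  have "(iter_partial is (modulation \<xi> f) has_derivative
      (\<lambda>h. exp (\<i> * (x \<bullet> \<xi>)) * (frechet_derivative (mod_partial \<xi> is f) (at x) h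
          + \<i> * (h \<bullet> \<xi>) * mod_partial \<xi> is f x))) (at x)" for x
    unfolding Cons.IH
    using schwartz_has_derivative[OF schwartz_mod_partial[OF f], of "[]"]
    by (intro modulation_has_derivative) simp
  from iter_partial_has_derivativeI[OF this] show ?case
    by (simp add: modulation_def inner_axis')
qed auto

lemma cmod_modulation [simp]: "cmod (modulation \<xi> f y) = cmod (f y)"
  by (simp add: modulation_def norm_mult)

lemma schwartz_modulation:
  assumes f: "f \<in> schwartz_space"
  shows "modulation \<xi> f \<in> schwartz_space"
proof (rule schwartzI)
  fix "is" k x
  note S = schwartz_mod_partial[OF f, of \<xi> "is"]
  show "iter_partial is (modulation \<xi> f) differentiable (at x)"
    unfolding iter_partial_modulation[OF f] differentiable_def
    using modulation_has_derivative schwartz_has_derivative[OF S, of "[]"] by fastforce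
  show "\<exists>C. \<forall>x. wt x ^ k * cmod (iter_partial is (modulation \<xi> f) x) \<le> C"
    using schwartzD(2)[OF S, of k "[]"] by (auto simp: iter_partial_modulation[OF f])
qed

lemma schwartz_tf_shift: "f \<in> schwartz_space \<Longrightarrow> tf_shift z f \<in> schwartz_space"
  unfolding tf_shift_def by (intro schwartz_modulation schwartz_translation)

lemma mod_partial_translation:
  assumes f: "f \<in> schwartz_space"
  shows "mod_partial \<xi> is (translation a f) = translation a (mod_partial \<xi> is f)"
proof (induction "is")
  case (Cons i "is")
  show ?case
    unfolding mod_partial.simps Cons.IH iter_partial_translation[OF schwartz_mod_partial[OF f]]
    by (simp add: translation_def)
qed auto

text \<open>Each operator \<partial> + \<i> \<xi> costs at most one power of
  \<open>wt \<xi>\<close>. The outer list \<open>js\<close> is arbitrary because the induction step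
  moves one derivative from the inner operator into it.\<close>

lemma mod_partial_bound:
  assumes f: "f \<in> schwartz_space"
  shows "\<exists>C\<ge>0. \<forall>\<xi> x. wt x ^ k * cmod (iter_partial js (mod_partial \<xi> is f) x) \<le> C * wt \<xi> ^ length is"
proof (induction "is" arbitrary: js)
  case Nil
  then show ?case using schwartzD(2)[OF f] by auto
next
  case (Cons i "is")
  obtain C1 where C1: "C1 \<ge> 0" "\<And>\<xi> x. wt x ^ k * cmod (iter_partial (js @ [i]) (mod_partial \<xi> is f) x) \<le> C1 * wt \<xi> ^ length is"
    using Cons.IH by meson
  obtain C2 where C2: "C2 \<ge> 0" "\<And>\<xi> x. wt x ^ k * cmod (iter_partial js (mod_partial \<xi> is f) x) \<le> C2 * wt \<xi> ^ length is"
    using Cons.IH by meson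
  have "wt x ^ k * cmod (iter_partial js (mod_partial \<xi> (i # is) f) x) \<le> (C1 + C2) * wt \<xi> ^ length (i # is)" for \<xi> x
  proof -
    note S = schwartz_mod_partial[OF f, of \<xi> "is"]
    have eq: "iter_partial js (mod_partial \<xi> (i # is) f) x =
      iter_partial (js @ [i]) (mod_partial \<xi> is f) x + \<i> * \<xi> $ i * iter_partial js (mod_partial \<xi> is f) x"
      unfolding mod_partial.simps iter_partial_append
      by (simp only: iter_partial_add[OF schwartz_iter_partial[OF S] schwartz_cmult[OF S]] iter_partial_cmult[OF S])
    have xi: "\<bar>\<xi> $ i\<bar> \<le> wt \<xi>"
      using component_le_norm_cart[of \<xi> i] by (simp add: wt_def)
    have "wt x ^ k * cmod (iter_partial js (mod_partial \<xi> (i # is) f) x)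
      \<le> wt x ^ k * (cmod (iter_partial (js @ [i]) (mod_partial \<xi> is f) x) + \<bar>\<xi> $ i\<bar> * cmod (iter_partial js (mod_partial \<xi> is f) x))"
      unfolding eq by (intro mult_left_mono order_trans[OF norm_triangle_ineq]) (auto simp: norm_mult)
    also have "\<dots> = wt x ^ k * cmod (iter_partial (js @ [i]) (mod_partial \<xi> is f) x) + \<bar>\<xi> $ i\<bar> * (wt x ^ k * cmod (iter_partial js (mod_partial \<xi> is f) x))"
      by (simp add: algebra_simps)
    also have "\<dots> \<le> C1 * wt \<xi> ^ length is + wt \<xi> * (C2 * wt \<xi> ^ length is)"
      by (intro add_mono mult_mono C1 C2 xi) auto
    also have "\<dots> \<le> C1 * wt \<xi> ^ length (i # is) + C2 * wt \<xi> ^ length (i # is)"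
      by (intro add_mono mult_left_mono power_increasing) (use C1 in auto)
    finally show ?thesis by (simp add: algebra_simps)
  qed
  then show ?case using C1(1) C2(1) by (intro exI[of _ "C1 + C2"]) auto
qed

text \<open>Schwartz seminorms of \<Pi>(z)f grow polynomially in z: moving the weight back by the
  position costs k powers, the derivatives of the modulation cost one power each. Gabor series with
  rapidly decreasing coefficients therefore converge in every seminorm.\<close>

lemma tf_shift_bound:
  assumes f: "f \<in> schwartz_space"
  shows "\<exists>C\<ge>0. \<forall>z y. wt y ^ k * cmod (iter_partial is (tf_shift z f) y) \<le> C * wt z ^ (k + length is)"
proof -
  obtain C where C: "C \<ge> 0" "\<And>\<xi> x. wt x ^ k * cmod (mod_partial \<xi> is f x) \<le> C * wt \<xi> ^ length is"
    using mod_partial_bound[OF f, of k "[]" "is"] by auto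
  have "wt y ^ k * cmod (iter_partial is (tf_shift z f) y) \<le> C * wt z ^ (k + length is)" for y z
  proof -
    have "wt y ^ k * cmod (iter_partial is (tf_shift z f) y)
      = wt y ^ k * cmod (mod_partial (snd z) is f (y - fst z))"
      by (simp only: tf_shift_def iter_partial_modulation[OF schwartz_translation[OF f]] cmod_modulation
        mod_partial_translation[OF f]) (simp add: translation_def)
    also have "\<dots> \<le> (wt (fst z) ^ k * wt (y - fst z) ^ k) * cmod (mod_partial (snd z) is f (y - fst z))"
      using wt_add_power_le[of "fst z" "y - fst z" k] by (intro mult_right_mono) auto
    also have "\<dots> \<le> wt (fst z) ^ k * (C * wt (snd z) ^ length is)"
      using mult_left_mono[OF C(2)[of "y - fst z" "snd z"], of "wt (fst z) ^ k"] by (simp add: mult_ac)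
    also have "\<dots> \<le> wt z ^ k * (C * wt z ^ length is)"
      using C(1) by (intro mult_mono power_mono wt_fst_le wt_snd_le mult_left_mono) auto
    finally show ?thesis by (simp add: power_add mult_ac)
  qed
  then show ?thesis using C(1) by blast
qed

text \<open>Time-frequency shifts compose only up to a phase. The phase has modulus one, so it
  disappears from every estimate, but it has to be carried along in the expansions.\<close>

lemma tf_shift_tf_shift:
  "tf_shift z (tf_shift w f) = (\<lambda>y. exp (- (\<i> * (fst z \<bullet> snd w))) * tf_shift (z + w) f y)"
  by (rule ext) (simp add: tf_shift_def modulation_def translation_def inner_diff_left
      inner_add_right algebra_simps flip: exp_add)

lemma adjoint_tf_shift:
  "translation (- fst z) (modulation (- snd z) f) = (\<lambda>y. exp (- (\<i> * (fst z \<bullet> snd z))) * tf_shift (- z) f y)"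
  by (rule ext) (simp add: tf_shift_def modulation_def translation_def
      inner_add_left algebra_simps flip: exp_add)

lemma tf_shift_0 [simp]: "tf_shift 0 f = f"
  by (simp add: tf_shift_def modulation_def translation_def)

section \<open>Decay of the short-time Fourier transform\<close>

lemma cnj_borel_measurable [measurable]: "cnj \<in> borel_measurable borel"
  by (intro borel_measurable_continuous_onI continuous_intros)

lemma integrable_bounded_by_wt:
  fixes g :: "'a::euclidean_space \<Rightarrow> 'b::{banach, second_countable_topology}"
  assumes "g \<in> borel_measurable borel" and "\<And>y. norm (g y) \<le> C / wt y ^ (DIM('a) + 2)"
  shows "integrable lborel g"
proof (rule Bochner_Integration.integrable_bound)
  show "integrable lborel (\<lambda>y::'a. C * (1 / wt y ^ (DIM('a) + 2)))"
    by (intro integrable_mult_right integrable_wt order_refl)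
  show "AE y in lborel. norm (g y) \<le> norm (C * (1 / wt y ^ (DIM('a) + 2)))"
    using order_trans[OF assms(2) abs_ge_self] by simp
qed (use assms in simp)

text \<open>Difference quotients \<open>s m\<close> in direction e have integral zero by translation
  invariance of Lebesgue measure; dominated convergence carries this over to the derivative. No
  boundary terms or iterated integrals occur.\<close>

lemma integral_directional_derivative:
  fixes F :: "'a::euclidean_space \<Rightarrow> complex"
  assumes F: "\<And>x. (F has_derivative D x) (at x)"
    and int: "integrable lborel F" and e: "norm e = 1"
    and bnd: "\<And>x. cmod (D x e) \<le> C / wt x ^ (DIM('a) + 2)"
  shows "(LINT x|lborel. D x e) = 0"
proof -
  define K where "K = DIM('a) + 2"
  define s where "s m x = of_nat (Suc m) * (F (x + (1 / real (Suc m)) *\<^sub>R e) - F x)" for m x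
  have contF: "continuous_on UNIV F"
    using F has_derivative_continuous continuous_at_imp_continuous_on by blast
  have shift: "integrable lborel (\<lambda>x. F (x + a)) \<and> (LINT x|lborel. F (x + a)) = (LINT x|lborel. F x)" for a
  proof -
    have [measurable]: "F \<in> borel_measurable borel"
      using contF by (rule borel_measurable_continuous_onI)
    have "integrable (distr lborel borel ((+) a)) F" "(LINT x|distr lborel borel ((+) a). F x) = (LINT x|lborel. F x)"
      using int by (simp_all add: lborel_distr_plus)
    then show ?thesis
      by (simp add: integrable_distr_eq integral_distr add.commute)
  qed
  have s0: "(LINT x|lborel. s m x) = 0" for m
  proof -
    have "(LINT x|lborel. s m x) = of_nat (Suc m) * (LINT x|lborel. (F (x + (1 / real (Suc m)) *\<^sub>R e) - F x))"
      unfolding s_def by (rule integral_mult_right_zero)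
    also have "(LINT x|lborel. (F (x + (1 / real (Suc m)) *\<^sub>R e) - F x)) = 0"
      using shift int by (subst Bochner_Integration.integral_diff) auto
    finally show ?thesis by simp
  qed
  have lim: "(\<lambda>m. s m x) \<longlonglongrightarrow> D x e" for x
  proof -
    have bl: "bounded_linear (D x)" and
      l: "(\<lambda>h. norm (F (x + h) - F x - D x h) / norm h) \<midarrow>0\<rightarrow> 0"
      using F[of x] by (auto simp: has_derivative_at)
    have "filterlim (\<lambda>m. (1 / real (Suc m)) *\<^sub>R e) (at 0) sequentially"
    proof (rule filterlim_atI)
      have "(\<lambda>m. (1 / real (Suc m)) *\<^sub>R e) \<longlonglongrightarrow> 0 *\<^sub>R e"
        by (intro tendsto_scaleR tendsto_const) (rule LIMSEQ_Suc[OF lim_1_over_n])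
      then show "(\<lambda>m. (1 / real (Suc m)) *\<^sub>R e) \<longlonglongrightarrow> 0" by simp
      show "\<forall>\<^sub>F m in sequentially. (1 / real (Suc m)) *\<^sub>R e \<noteq> 0"
        using e by (intro always_eventually) auto
    qed
    from filterlim_compose[OF l this]
    have "(\<lambda>m. norm (F (x + (1 / real (Suc m)) *\<^sub>R e) - F x - D x ((1 / real (Suc m)) *\<^sub>R e))
        / norm ((1 / real (Suc m)) *\<^sub>R e)) \<longlonglongrightarrow> 0" .
    also have "(\<lambda>m. norm (F (x + (1 / real (Suc m)) *\<^sub>R e) - F x - D x ((1 / real (Suc m)) *\<^sub>R e))
        / norm ((1 / real (Suc m)) *\<^sub>R e)) = (\<lambda>m. norm (s m x - D x e))"
    proof
      fix m
      let ?t = "1 / real (Suc m)"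
      have "s m x - D x e = of_nat (Suc m) * (F (x + ?t *\<^sub>R e) - F x - D x (?t *\<^sub>R e))"
        by (simp add: s_def linear_cmul[OF bounded_linear.linear[OF bl]] scaleR_conv_of_real
            algebra_simps add_divide_distrib del: of_nat_Suc)
      then have "norm (s m x - D x e) = real (Suc m) * norm (F (x + ?t *\<^sub>R e) - F x - D x (?t *\<^sub>R e))"
        by (simp only: norm_mult norm_of_nat)
      then show "norm (F (x + ?t *\<^sub>R e) - F x - D x (?t *\<^sub>R e)) / norm (?t *\<^sub>R e) = norm (s m x - D x e)"
        using e by simp
    qed
    finally show ?thesis by (simp add: tendsto_norm_zero_iff LIM_zero_iff)
  qed
  \<comment> \<open>By the mean value inequality the quotient is bounded by the derivative at an
    intermediate point at distance r < 1 from x. Returning from there to x costs a factor 2 for each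
    of the K powers.\<close>
  have dom: "cmod (s m x) \<le> 2 ^ K * \<bar>C\<bar> * (1 / wt x ^ K)" for m x
  proof -
    let ?t = "1 / real (Suc m)"
    have t: "0 < ?t" "?t \<le> 1" by auto
    have der: "((\<lambda>r. F (x + r *\<^sub>R e)) has_derivative (\<lambda>h. D (x + r *\<^sub>R e) (h *\<^sub>R e))) (at r)" for r
      by (rule has_derivative_compose[where f = "\<lambda>r. x + r *\<^sub>R e" and f' = "\<lambda>h. h *\<^sub>R e"])
        (auto intro!: derivative_eq_intros F)
    have "\<exists>r\<in>{0<..<?t}. norm (F (x + ?t *\<^sub>R e) - F (x + 0 *\<^sub>R e)) \<le> norm (D (x + r *\<^sub>R e) ((?t - 0) *\<^sub>R e))"
      by (rule mvt_general[OF t(1)])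
        (auto intro!: der continuous_at_imp_continuous_on has_derivative_continuous[OF der])
    then obtain r where r: "0 < r" "r < ?t"
      and le: "norm (F (x + ?t *\<^sub>R e) - F x) \<le> norm (D (x + r *\<^sub>R e) (?t *\<^sub>R e))" by auto
    have r1: "r \<le> 1" using r t by linarith
    have "D (x + r *\<^sub>R e) (?t *\<^sub>R e) = ?t *\<^sub>R D (x + r *\<^sub>R e) e"
      using F[of "x + r *\<^sub>R e"] by (intro linear_cmul bounded_linear.linear) (rule has_derivative_bounded_linear)
    then have "norm (F (x + ?t *\<^sub>R e) - F x) \<le> ?t * cmod (D (x + r *\<^sub>R e) e)"
      using le by simp
    then have "real (Suc m) * norm (F (x + ?t *\<^sub>R e) - F x) \<le> cmod (D (x + r *\<^sub>R e) e)"
      by (simp add: field_simps del: of_nat_Suc)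
    then have "cmod (s m x) \<le> cmod (D (x + r *\<^sub>R e) e)"
      by (simp only: s_def norm_mult norm_of_nat)
    also have "\<dots> \<le> C / wt (x + r *\<^sub>R e) ^ K" unfolding K_def by (rule bnd)
    also have "\<dots> \<le> \<bar>C\<bar> / wt (x + r *\<^sub>R e) ^ K" by (intro divide_right_mono) auto
    also have "\<dots> \<le> \<bar>C\<bar> * (2 ^ K * (1 / wt x ^ K))"
    proof -
      have "wt x ^ K \<le> wt (x + r *\<^sub>R e) ^ K * wt (- (r *\<^sub>R e)) ^ K"
        using wt_add_power_le[of "x + r *\<^sub>R e" "- (r *\<^sub>R e)" K] by simp
      also have "\<dots> \<le> wt (x + r *\<^sub>R e) ^ K * 2 ^ K"
        using r r1 e by (intro mult_left_mono power_mono) (auto simp: wt_def)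
      finally have "1 / wt (x + r *\<^sub>R e) ^ K \<le> 2 ^ K * (1 / wt x ^ K)"
        by (simp add: divide_simps mult.commute)
      from mult_left_mono[OF this, of "\<bar>C\<bar>"] show ?thesis by simp
    qed
    finally show ?thesis by (simp add: mult_ac)
  qed
  have "(\<lambda>m. LINT x|lborel. s m x) \<longlonglongrightarrow> (LINT x|lborel. D x e)"
  proof (rule integral_dominated_convergence)
    show meas: "s m \<in> borel_measurable lborel" for m
    proof -
      have "continuous_on UNIV (s m)"
        unfolding s_def
        by (intro continuous_intros continuous_on_compose2[OF contF]) auto
      then show ?thesis by (simp add: borel_measurable_continuous_onI)
    qed
    show "(\<lambda>x. D x e) \<in> borel_measurable lborel"
      by (rule borel_measurable_LIMSEQ_metric[OF meas lim])
    show "integrable lborel (\<lambda>x::'a. 2 ^ K * \<bar>C\<bar> * (1 / wt x ^ K))"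
      by (intro integrable_mult_right integrable_wt) (simp add: K_def)
  qed (use lim dom in auto)
  then show ?thesis by (simp add: s0 LIMSEQ_const_iff)
qed

text \<open>The class in which the frame iteration runs: it contains Schwartz functions and sums of
  Gabor series with rapidly decreasing coefficients, it lies in L^2 and has absolutely convergent
  pairings. Continuity makes a function of L^2 norm zero vanish everywhere.\<close>

definition tame :: "('a::euclidean_space \<Rightarrow> complex) \<Rightarrow> bool" where
  "tame f \<longleftrightarrow> continuous_on UNIV f \<and> (\<exists>C. \<forall>y. cmod (f y) \<le> C) \<and> integrable lborel f"

lemma tameD:
  assumes "tame f"
  shows "continuous_on UNIV f" "\<exists>C\<ge>0. \<forall>y. cmod (f y) \<le> C" "integrable lborel f"
    "f \<in> borel_measurable borel"
proof -
  show "continuous_on UNIV f" "integrable lborel f" using assms by (auto simp: tame_def)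
  then show "f \<in> borel_measurable borel" by (auto intro: borel_measurable_continuous_onI)
  obtain C where "\<And>y. cmod (f y) \<le> C" using assms by (auto simp: tame_def)
  then show "\<exists>C\<ge>0. \<forall>y. cmod (f y) \<le> C" by (meson norm_ge_zero order_trans)
qed

lemma tame_add:
  assumes "tame f" "tame g" shows "tame (\<lambda>y. f y + g y)"
proof -
  obtain C1 C2 where C: "\<And>y. cmod (f y) \<le> C1" "\<And>y. cmod (g y) \<le> C2"
    using tameD(2)[OF assms(1)] tameD(2)[OF assms(2)] by blast
  have "cmod (f y + g y) \<le> C1 + C2" for y
    using norm_triangle_ineq[of "f y" "g y"] C[of y] by linarith
  then show ?thesis
    unfolding tame_def using tameD[OF assms(1)] tameD[OF assms(2)] by (auto intro!: continuous_intros)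
qed

lemma tame_cmult:
  assumes "tame f" shows "tame (\<lambda>y. c * f y)"
proof -
  obtain C where C: "\<And>y. cmod (f y) \<le> C"
    using tameD(2)[OF assms(1)] by blast
  have "cmod (c * f y) \<le> cmod c * C" for y
    using C[of y] by (simp add: norm_mult mult_left_mono)
  then show ?thesis
    unfolding tame_def using tameD[OF assms(1)] by (auto intro!: continuous_intros)
qed

lemma tame_diff:
  assumes "tame f" "tame g" shows "tame (\<lambda>y. f y - g y)"
  using tame_add[OF assms(1) tame_cmult[OF assms(2), of "-1"]] by simp

lemma tame_mult_cnj_integrable:
  assumes "tame f" "tame g" shows "integrable lborel (\<lambda>y. f y * cnj (g y))"
proof -
  obtain C where C: "C \<ge> 0" "\<And>y. cmod (g y) \<le> C"
    using tameD(2)[OF assms(2)] by blast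
  note [measurable] = tameD(4)[OF assms(1)] tameD(4)[OF assms(2)]
  show ?thesis
  proof (rule Bochner_Integration.integrable_bound)
    show "integrable lborel (\<lambda>y. of_real C * f y)"
      by (intro integrable_mult_right tameD assms)
    have "norm (f y * cnj (g y)) \<le> norm (of_real C * f y)" for y
      using mult_left_mono[OF C(2)[of y], of "cmod (f y)"] C(1) by (simp add: norm_mult mult.commute)
    then show "AE y in lborel. norm (f y * cnj (g y)) \<le> norm (of_real C * f y)" by simp
  qed simp
qed

lemma L2_inner_add_left: "tame f \<Longrightarrow> tame g \<Longrightarrow> tame h \<Longrightarrow> L2_inner (\<lambda>y. f y + g y) h = L2_inner f h + L2_inner g h"
  unfolding L2_inner_def distrib_right by (intro Bochner_Integration.integral_add tame_mult_cnj_integrable)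

lemma L2_inner_diff_left: "tame f \<Longrightarrow> tame g \<Longrightarrow> tame h \<Longrightarrow> L2_inner (\<lambda>y. f y - g y) h = L2_inner f h - L2_inner g h"
  unfolding L2_inner_def left_diff_distrib by (intro Bochner_Integration.integral_diff tame_mult_cnj_integrable)

lemma L2_inner_cmult_left: "L2_inner (\<lambda>y. c * f y) g = c * L2_inner f g"
  unfolding L2_inner_def mult.assoc by (rule integral_mult_right_zero)

lemma L2_inner_cnj: "cnj (L2_inner f g) = L2_inner g f"
  using Bochner_Integration.integral_cnj[of lborel "\<lambda>y. f y * cnj (g y)"] by (simp add: L2_inner_def mult.commute)

lemma L2_inner_add_right: "tame f \<Longrightarrow> tame g \<Longrightarrow> tame h \<Longrightarrow> L2_inner h (\<lambda>y. f y + g y) = L2_inner h f + L2_inner h g"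
  using L2_inner_add_left[of f g h] by (metis L2_inner_cnj complex_cnj_add)

lemma L2_inner_cmult_right: "L2_inner f (\<lambda>y. c * g y) = cnj c * L2_inner f g"
  using L2_inner_cmult_left[of c g f] by (metis L2_inner_cnj complex_cnj_mult)

lemma schwartz_continuous:
  assumes "f \<in> schwartz_space" shows "continuous_on UNIV f"
  using schwartzD(1)[OF assms, of "[]"] differentiable_imp_continuous_within
  by (auto simp: continuous_on_eq_continuous_within)

lemma schwartz_integrable_wt:
  fixes f :: "real^'n::finite \<Rightarrow> complex"
  assumes f: "f \<in> schwartz_space"
  shows "integrable lborel (\<lambda>y. wt y ^ k * cmod (f y))"
proof -
  let ?K = "DIM(real^'n) + 2"
  obtain C where C: "\<And>x. wt x ^ (k + ?K) * cmod (f x) \<le> C"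
    using schwartzD(2)[OF f, of "k + ?K" "[]"] by auto
  show ?thesis
  proof (rule integrable_bounded_by_wt)
    show "(\<lambda>y. wt y ^ k * cmod (f y)) \<in> borel_measurable borel"
      by (intro borel_measurable_continuous_onI continuous_intros schwartz_continuous f)
    show "norm (wt y ^ k * cmod (f y)) \<le> C / wt y ^ ?K" for y
      using C[of y] by (simp add: pos_le_divide_eq power_add mult_ac)
  qed
qed

lemma schwartz_tame:
  assumes f: "f \<in> schwartz_space" shows "tame f"
proof -
  have "integrable lborel f"
    using schwartz_integrable_wt[OF f, of 0] schwartz_continuous[OF f]
    by (simp add: integrable_norm_iff borel_measurable_continuous_onI)
  moreover obtain C where "\<And>x. cmod (f x) \<le> C"
    using schwartzD(2)[OF f, of 0 "[]"] by auto
  ultimately show ?thesis unfolding tame_def using schwartz_continuous[OF f] by blast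
qed

section \<open>Integration by parts and decay of inner products of shifted Schwartz
  functions\<close>

lemma L2_inner_partial:
  fixes f g :: "real^'n::finite \<Rightarrow> complex"
  assumes f: "f \<in> schwartz_space" and g: "g \<in> schwartz_space"
  shows "L2_inner f (iter_partial [i] g) = - L2_inner (iter_partial [i] f) g"
proof -
  let ?K = "DIM(real^'n) + 2"
  define D where "D y h = f y * cnj (frechet_derivative g (at y) h) + frechet_derivative f (at y) h * cnj (g y)" for y h
  have D: "((\<lambda>y. f y * cnj (g y)) has_derivative D y) (at y)" for y
    unfolding D_def
    using schwartz_has_derivative[OF f, of "[]"] schwartz_has_derivative[OF g, of "[]"]
    by (intro has_derivative_mult bounded_linear.has_derivative[OF bounded_linear_cnj]) auto
  have De: "D y (axis i 1) = f y * cnj (iter_partial [i] g y) + iter_partial [i] f y * cnj (g y)" for y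
    by (simp add: D_def)
  have t: "tame f" "tame g" "tame (iter_partial [i] f)" "tame (iter_partial [i] g)"
    by (intro schwartz_tame schwartz_iter_partial f g)+
  obtain C1 where C1: "C1 \<ge> 0" "\<And>x. wt x ^ ?K * cmod (f x) \<le> C1"
    using schwartzD(2)[OF f, of "?K" "[]"] by auto
  obtain C2 where C2: "C2 \<ge> 0" "\<And>x. wt x ^ ?K * cmod (g x) \<le> C2"
    using schwartzD(2)[OF g, of "?K" "[]"] by auto
  obtain C3 where C3: "C3 \<ge> 0" "\<And>x. cmod (iter_partial [i] f x) \<le> C3"
    using tameD(2)[OF t(3)] by blast
  obtain C4 where C4: "C4 \<ge> 0" "\<And>x. cmod (iter_partial [i] g x) \<le> C4"
    using tameD(2)[OF t(4)] by blast
  have bnd: "cmod (D y (axis i 1)) \<le> (C1 * C4 + C2 * C3) / wt y ^ ?K" for y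
  proof -
    have "wt y ^ ?K * cmod (D y (axis i 1)) \<le> wt y ^ ?K * (cmod (f y) * cmod (iter_partial [i] g y)
        + cmod (iter_partial [i] f y) * cmod (g y))"
      unfolding De by (intro mult_left_mono order_trans[OF norm_triangle_ineq]) (auto simp: norm_mult)
    also have "\<dots> = (wt y ^ ?K * cmod (f y)) * cmod (iter_partial [i] g y) + (wt y ^ ?K * cmod (g y)) * cmod (iter_partial [i] f y)"
      by (simp add: algebra_simps)
    also have "\<dots> \<le> C1 * C4 + C2 * C3"
      by (intro add_mono mult_mono C1 C2 C3 C4) auto
    finally show ?thesis by (simp add: pos_le_divide_eq mult.commute)
  qed
  have "(LINT y|lborel. D y (axis i 1)) = 0"
    by (rule integral_directional_derivative[OF D tame_mult_cnj_integrable[OF t(1,2)] _ bnd]) simp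
  moreover have "(LINT y|lborel. D y (axis i 1)) = L2_inner f (iter_partial [i] g) + L2_inner (iter_partial [i] f) g"
    unfolding De L2_inner_def by (intro Bochner_Integration.integral_add tame_mult_cnj_integrable t)
  ultimately show ?thesis by (simp only: add_eq_0_iff2)
qed

lemma L2_inner_tf_shift_partial:
  fixes f g :: "real^'n::finite \<Rightarrow> complex"
  assumes f: "f \<in> schwartz_space" and g: "g \<in> schwartz_space"
  shows "\<bar>snd z $ i\<bar> * cmod (L2_inner f (tf_shift z g))
    \<le> cmod (L2_inner f (tf_shift z (iter_partial [i] g))) + cmod (L2_inner (iter_partial [i] f) (tf_shift z g))"
proof -
  have eq: "iter_partial [i] (tf_shift z g) = (\<lambda>y. tf_shift z (iter_partial [i] g) y + (\<i> * snd z $ i) * tf_shift z g y)"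
    unfolding tf_shift_def iter_partial_modulation[OF schwartz_translation[OF g]] mod_partial.simps
      iter_partial_translation[OF g]
    by (simp add: modulation_def algebra_simps)
  have t: "tame f" "tame (tf_shift z g)" "tame (tf_shift z (iter_partial [i] g))"
    by (intro schwartz_tame schwartz_iter_partial schwartz_tf_shift f g)+
  have "L2_inner f (iter_partial [i] (tf_shift z g)) = - L2_inner (iter_partial [i] f) (tf_shift z g)"
    by (intro L2_inner_partial schwartz_tf_shift f g)
  then have "L2_inner f (tf_shift z (iter_partial [i] g)) + cnj (\<i> * snd z $ i) * L2_inner f (tf_shift z g)
      = - L2_inner (iter_partial [i] f) (tf_shift z g)"
    unfolding eq by (simp only: L2_inner_add_right[OF t(3) tame_cmult[OF t(2)] t(1)] L2_inner_cmult_right)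
  then have "cnj (\<i> * snd z $ i) * L2_inner f (tf_shift z g)
      = - L2_inner f (tf_shift z (iter_partial [i] g)) - L2_inner (iter_partial [i] f) (tf_shift z g)"
    by (simp add: algebra_simps add_eq_0_iff)
  then have "cmod (cnj (\<i> * snd z $ i) * L2_inner f (tf_shift z g))
      \<le> cmod (- L2_inner f (tf_shift z (iter_partial [i] g))) + cmod (L2_inner (iter_partial [i] f) (tf_shift z g))"
    by (metis norm_triangle_ineq4)
  then show ?thesis by (simp add: norm_mult)
qed

text \<open>Induction on the power of the frequency, with f and g arbitrary because each step
  replaces one of them by a partial derivative. Decay in the position is the base case:
  \<open>wt x\<close> is at most \<open>wt y * wt (y - x)\<close>, and the two factors are absorbed
  by f and by the translate of g.\<close>

lemma L2_inner_tf_shift_decay_aux: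
  fixes f g :: "real^'n::finite \<Rightarrow> complex"
  assumes "f \<in> schwartz_space" and "g \<in> schwartz_space"
  shows "\<exists>C\<ge>0. \<forall>z. wt (fst z) ^ N * wt (snd z) ^ K * cmod (L2_inner f (tf_shift z g)) \<le> C"
  using assms
proof (induction K arbitrary: f g)
  case 0
  note f = 0(1) and g = 0(2)
  obtain C where C: "C \<ge> 0" "\<And>x. wt x ^ N * cmod (g x) \<le> C"
    using schwartzD(2)[OF g, of N "[]"] by auto
  define I where "I = (LINT y|lborel. wt y ^ N * cmod (f y))"
  have "wt (fst z) ^ N * cmod (L2_inner f (tf_shift z g)) \<le> C * I" for z
  proof -
    have t: "integrable lborel (\<lambda>y. f y * cnj (tf_shift z g y))"
      by (intro tame_mult_cnj_integrable schwartz_tame schwartz_tf_shift f g)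
    have "cmod (L2_inner f (tf_shift z g)) \<le> (LINT y|lborel. cmod (f y * cnj (tf_shift z g y)))"
      unfolding L2_inner_def by (rule integral_norm_bound)
    then have "wt (fst z) ^ N * cmod (L2_inner f (tf_shift z g)) \<le> wt (fst z) ^ N * (LINT y|lborel. cmod (f y * cnj (tf_shift z g y)))"
      by (intro mult_left_mono) auto
    also have "\<dots> = (LINT y|lborel. wt (fst z) ^ N * cmod (f y * cnj (tf_shift z g y)))"
      by (rule integral_mult_right_zero[symmetric])
    also have "\<dots> \<le> (LINT y|lborel. C * (wt y ^ N * cmod (f y)))"
    proof (rule integral_mono)
      show "integrable lborel (\<lambda>y. wt (fst z) ^ N * cmod (f y * cnj (tf_shift z g y)))"
        using t by (intro integrable_mult_right integrable_norm)
      show "integrable lborel (\<lambda>y. C * (wt y ^ N * cmod (f y)))"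
        by (intro integrable_mult_right schwartz_integrable_wt f)
      fix y
      have "wt (fst z) ^ N \<le> wt y ^ N * wt (y - fst z) ^ N"
        using wt_add_power_le[of y "- (y - fst z)" N] by (simp only: wt_minus) simp
      then have "wt (fst z) ^ N * (cmod (f y) * cmod (g (y - fst z))) \<le> wt y ^ N * wt (y - fst z) ^ N * (cmod (f y) * cmod (g (y - fst z)))"
        by (intro mult_right_mono) auto
      also have "\<dots> = (wt (y - fst z) ^ N * cmod (g (y - fst z))) * (wt y ^ N * cmod (f y))"
        by (simp add: mult_ac)
      also have "\<dots> \<le> C * (wt y ^ N * cmod (f y))"
        by (intro mult_right_mono C) auto
      finally show "wt (fst z) ^ N * cmod (f y * cnj (tf_shift z g y)) \<le> C * (wt y ^ N * cmod (f y))"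
        by (simp add: norm_mult tf_shift_def translation_def)
    qed
    also have "\<dots> = C * I" unfolding I_def by (rule integral_mult_right_zero)
    finally show ?thesis .
  qed
  moreover have "0 \<le> C * I" using C(1) by (simp add: I_def integral_nonneg)
  ultimately show ?case by auto
next
  case (Suc K)
  note f = Suc.prems(1) and g = Suc.prems(2)
  define V where "V f g z = wt (fst z) ^ N * wt (snd z) ^ K * cmod (L2_inner f (tf_shift z g))"
    for f g :: "real^'n \<Rightarrow> complex" and z
  obtain C0 where C0: "C0 \<ge> 0" "\<And>z. V f g z \<le> C0"
    using Suc.IH[OF f g] unfolding V_def by blast
  have "\<forall>i. \<exists>C\<ge>0. \<forall>z. V f (iter_partial [i] g) z \<le> C"
    using Suc.IH[OF f schwartz_iter_partial[OF g]] unfolding V_def by blast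
  then obtain C1 where C1: "\<And>i. C1 i \<ge> 0" "\<And>i z. V f (iter_partial [i] g) z \<le> C1 i" by metis
  have "\<forall>i. \<exists>C\<ge>0. \<forall>z. V (iter_partial [i] f) g z \<le> C"
    using Suc.IH[OF schwartz_iter_partial[OF f] g] unfolding V_def by blast
  then obtain C2 where C2: "\<And>i. C2 i \<ge> 0" "\<And>i z. V (iter_partial [i] f) g z \<le> C2 i" by metis
  have "wt (fst z) ^ N * wt (snd z) ^ Suc K * cmod (L2_inner f (tf_shift z g)) \<le> C0 + (\<Sum>i\<in>UNIV. C1 i + C2 i)" for z
  proof -
    let ?w = "wt (fst z) ^ N * wt (snd z) ^ K"
    have "wt (fst z) ^ N * wt (snd z) ^ Suc K * cmod (L2_inner f (tf_shift z g)) = wt (snd z) * V f g z"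
      by (simp add: V_def)
    also have "\<dots> \<le> (1 + (\<Sum>i\<in>UNIV. \<bar>snd z $ i\<bar>)) * V f g z"
      by (intro mult_right_mono) (auto simp: wt_def V_def norm_le_l1_cart)
    also have "\<dots> = V f g z + (\<Sum>i\<in>UNIV. \<bar>snd z $ i\<bar> * V f g z)"
      by (simp add: distrib_right sum_distrib_right)
    also have "\<dots> \<le> C0 + (\<Sum>i\<in>UNIV. C1 i + C2 i)"
    proof (intro add_mono C0 sum_mono)
      fix i :: 'n
      have "\<bar>snd z $ i\<bar> * V f g z = ?w * (\<bar>snd z $ i\<bar> * cmod (L2_inner f (tf_shift z g)))"
        by (simp add: V_def mult_ac)
      also have "\<dots> \<le> ?w * (cmod (L2_inner f (tf_shift z (iter_partial [i] g))) + cmod (L2_inner (iter_partial [i] f) (tf_shift z g)))"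
        by (intro mult_left_mono L2_inner_tf_shift_partial f g) auto
      also have "\<dots> = V f (iter_partial [i] g) z + V (iter_partial [i] f) g z"
        by (simp only: V_def distrib_left)
      also have "\<dots> \<le> C1 i + C2 i" by (intro add_mono C1 C2)
      finally show "\<bar>snd z $ i\<bar> * V f g z \<le> C1 i + C2 i" .
    qed
    finally show ?thesis .
  qed
  moreover have "0 \<le> C0 + (\<Sum>i\<in>UNIV. C1 i + C2 i)"
    using C0(1) C1(1) C2(1) by (intro add_nonneg_nonneg sum_nonneg) auto
  ultimately show ?case by blast
qed

text \<open>Moving \<Pi>(w) to the other side leaves \<Pi>(z - w) up to a phase, so the decay
  depends on z - w only. With f = g = \<phi> this is the rapid off-diagonal decay of the Gram
  matrix.\<close>

lemma L2_inner_tf_shift_decay: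
  fixes f g :: "real^'n::finite \<Rightarrow> complex"
  assumes f: "f \<in> schwartz_space" and g: "g \<in> schwartz_space"
  shows "\<exists>C\<ge>0. \<forall>w z. wt (z - w) ^ K * cmod (L2_inner (tf_shift w f) (tf_shift z g)) \<le> C"
proof -
  obtain C where C: "C \<ge> 0" "\<And>z. wt (fst z) ^ K * wt (snd z) ^ K * cmod (L2_inner f (tf_shift z g)) \<le> C"
    using L2_inner_tf_shift_decay_aux[OF f g] by blast
  have "wt (z - w) ^ K * cmod (L2_inner (tf_shift w f) (tf_shift z g)) \<le> C" for w z
  proof -
    have m: "f \<in> borel_measurable borel" "tf_shift z g \<in> borel_measurable borel"
      using tameD(4) schwartz_tame schwartz_tf_shift f g by blast+
    have "L2_inner (tf_shift w f) (tf_shift z g)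
        = L2_inner f (translation (- fst w) (modulation (- snd w) (tf_shift z g)))"
      using L2_inner_tf_shift[OF m, of "fst w" "snd w"] by simp
    then have "cmod (L2_inner (tf_shift w f) (tf_shift z g)) = cmod (L2_inner f (tf_shift (z - w) g))"
      by (simp add: adjoint_tf_shift tf_shift_tf_shift L2_inner_cmult_right norm_mult)
    moreover have "wt (z - w) ^ K \<le> wt (fst (z - w)) ^ K * wt (snd (z - w)) ^ K"
      by (metis power_mono power_mult_distrib wt_nonneg wt_prod_le)
    ultimately show ?thesis
      by (smt (verit) C(2) mult_right_mono norm_ge_zero)
  qed
  then show ?thesis using C(1) by blast
qed

section \<open>Series in the Schwartz space\<close>

lemma norm_suminf_minus_le:
  fixes a :: "nat \<Rightarrow> 'a::banach"
  assumes M: "summable M" and a: "\<And>j. norm (a j) \<le> M j"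
  shows "summable a" "norm (suminf a - sum a {..<n}) \<le> (\<Sum>j. M (j + n))"
proof -
  show s: "summable a" by (rule summable_comparison_test'[OF M]) (use a in auto)
  have "norm (\<Sum>j. a (j + n)) \<le> (\<Sum>j. M (j + n))"
    using summable_ignore_initial_segment[OF M, of n] by (intro norm_suminf_le) (use a in auto)
  then show "norm (suminf a - sum a {..<n}) \<le> (\<Sum>j. M (j + n))"
    by (simp add: suminf_minus_initial_segment[OF s])
qed

lemma suminf_tail_tendsto_0:
  fixes M :: "nat \<Rightarrow> 'a::banach"
  assumes "summable M" shows "(\<lambda>n. \<Sum>j. M (j + n)) \<longlonglongrightarrow> 0"
proof -
  have "(\<lambda>n. suminf M - sum M {..<n}) \<longlonglongrightarrow> suminf M - suminf M"
    by (intro tendsto_intros summable_LIMSEQ assms)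
  then show ?thesis by (simp add: suminf_minus_initial_segment[OF assms])
qed

lemma iter_partial_line_derivative:
  assumes f: "f \<in> schwartz_space"
  shows "((\<lambda>t. iter_partial is f (x + t *\<^sub>R axis i 1)) has_derivative
    (\<lambda>s. s *\<^sub>R iter_partial (i # is) f (x + t *\<^sub>R axis i 1))) (at t)"
proof -
  let ?D = "frechet_derivative (iter_partial is f) (at (x + t *\<^sub>R axis i 1))"
  note D = schwartz_has_derivative[OF f, of "is" "x + t *\<^sub>R axis i 1"]
  have "((\<lambda>t. iter_partial is f (x + t *\<^sub>R axis i 1)) has_derivative (\<lambda>s. ?D (s *\<^sub>R axis i 1))) (at t)"
    by (rule has_derivative_compose[where f = "\<lambda>t. x + t *\<^sub>R axis i 1" and f' = "\<lambda>s. s *\<^sub>R axis i 1"])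
      (auto intro!: derivative_eq_intros D)
  moreover have "?D (s *\<^sub>R axis i 1) = s *\<^sub>R iter_partial (i # is) f (x + t *\<^sub>R axis i 1)" for s
    by (simp add: linear_cmul[OF has_derivative_linear[OF D]])
  ultimately show ?thesis by simp
qed

text \<open>Since the sum \<open>h\<close> is already known to be smooth, differentiating along coordinate lines suffices.\<close>

lemma iter_partial_series:
  fixes F :: "nat \<Rightarrow> real^'n::finite \<Rightarrow> complex"
  assumes F: "\<And>j. F j \<in> schwartz_space" and h: "h \<in> schwartz_space"
    and sums: "\<And>y. (\<lambda>j. F j y) sums h y"
    and M: "\<And>is. summable (M is)" "\<And>is j y. cmod (iter_partial is (F j) y) \<le> M is j"
  shows "(\<lambda>j. iter_partial is (F j) y) sums iter_partial is h y"
proof (induction "is" arbitrary: y)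
  case Nil
  then show ?case using sums by simp
next
  case (Cons i "is")
  let ?a = "\<lambda>j t. iter_partial (i # is) (F j) (y + t *\<^sub>R axis i 1)"
  have tail: "norm ((\<Sum>j. ?a j t) - (\<Sum>j<n. ?a j t)) \<le> (\<Sum>j. M (i # is) (j + n))" for t n
    by (rule norm_suminf_minus_le(2)[OF M(1)]) (rule M(2))
  \<comment> \<open>The differentiated series converges uniformly along the line, with the tails of
    M as modulus, so it may be differentiated term by term in the real variable t. Uniqueness of
    sums then identifies g with the restriction of the derivative of h to the line.\<close>
  have "\<exists>g. \<forall>t\<in>UNIV. (\<lambda>j. iter_partial is (F j) (y + t *\<^sub>R axis i 1)) sums g t \<and>
      (g has_derivative (\<lambda>s. s *\<^sub>R (\<Sum>j. ?a j t))) (at t within UNIV)"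
  proof (rule has_derivative_series)
    show "((\<lambda>t. iter_partial is (F j) (y + t *\<^sub>R axis i 1)) has_derivative (\<lambda>s. s *\<^sub>R ?a j t)) (at t within UNIV)" for j t
      using iter_partial_line_derivative[OF F] by simp
    show "(\<lambda>j. iter_partial is (F j) (y + 0 *\<^sub>R axis i 1)) sums iter_partial is h y"
      using Cons.IH[of y] by simp
    fix e :: real assume e: "e > 0"
    have "\<forall>\<^sub>F n in sequentially. (\<Sum>j. M (i # is) (j + n)) < e"
      using suminf_tail_tendsto_0[OF M(1)] e by (rule order_tendstoD(2))
    then show "\<forall>\<^sub>F n in sequentially. \<forall>t\<in>UNIV. \<forall>s. norm ((\<Sum>j<n. s *\<^sub>R ?a j t) - s *\<^sub>R (\<Sum>j. ?a j t)) \<le> e * norm s"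
    proof eventually_elim
      case (elim n)
      have "norm ((\<Sum>j<n. s *\<^sub>R ?a j t) - s *\<^sub>R (\<Sum>j. ?a j t)) \<le> e * norm s" for s t
      proof -
        have "norm ((\<Sum>j<n. s *\<^sub>R ?a j t) - s *\<^sub>R (\<Sum>j. ?a j t)) = \<bar>s\<bar> * norm ((\<Sum>j. ?a j t) - (\<Sum>j<n. ?a j t))"
          by (simp only: norm_minus_commute scaleR_sum_right[symmetric] scaleR_diff_right[symmetric] norm_scaleR)
        also have "\<dots> \<le> \<bar>s\<bar> * e"
          using tail[of t n] elim by (intro mult_left_mono) auto
        finally show ?thesis by (simp add: mult.commute)
      qed
      then show ?case by blast
    qed
  qed auto
  then obtain g where g: "\<And>t. (\<lambda>j. iter_partial is (F j) (y + t *\<^sub>R axis i 1)) sums g t"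
    and der: "\<And>t. (g has_derivative (\<lambda>s. s *\<^sub>R (\<Sum>j. ?a j t))) (at t)" by auto
  have "g = (\<lambda>t. iter_partial is h (y + t *\<^sub>R axis i 1))"
    using sums_unique2[OF g Cons.IH] by blast
  then have "(\<lambda>s. s *\<^sub>R (\<Sum>j. ?a j 0)) = (\<lambda>s. s *\<^sub>R iter_partial (i # is) h (y + 0 *\<^sub>R axis i 1))"
    using der[of 0] iter_partial_line_derivative[OF h, of "is" y i 0] has_derivative_unique by blast
  from fun_cong[OF this, of 1] have "(\<Sum>j. iter_partial (i # is) (F j) y) = iter_partial (i # is) h y"
    by simp
  moreover have "summable (\<lambda>j. iter_partial (i # is) (F j) y)"
    by (rule norm_suminf_minus_le(1)[OF M(1)]) (rule M(2))
  ultimately show ?case by (metis summable_sums)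
qed

section \<open>Tempered distributions applied to Gabor series\<close>

lemma distribution_bound:
  assumes "u \<in> tempered_distributions"
  obtains C N where "C \<ge> 0"
    and "\<And>f B. f \<in> schwartz_space \<Longrightarrow>
      (\<And>is x. length is \<le> N \<Longrightarrow> wt x ^ N * cmod (iter_partial is f x) \<le> B) \<Longrightarrow> cmod (u f) \<le> C * B"
proof -
  obtain C N where C: "\<And>f. f \<in> schwartz_space \<Longrightarrow> cmod (u f) \<le> C * schwartz_seminorm N f"
    using assms unfolding tempered_distributions_def by blast
  have "cmod (u f) \<le> \<bar>C\<bar> * B" if f: "f \<in> schwartz_space"
    and B: "\<And>is x. length is \<le> N \<Longrightarrow> wt x ^ N * cmod (iter_partial is f x) \<le> B" for f B
  proof -
    have le: "japanese_bracket x ^ N * cmod (iter_partial is f x) \<le> B" if "length is \<le> N" for "is" x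
      by (rule order_trans[OF _ B[OF that, of x]])
        (intro mult_right_mono power_mono japanese_bracket_le_wt; simp)
    have "schwartz_seminorm N f \<le> B"
      unfolding schwartz_seminorm_def by (rule cSUP_least) (auto intro: le exI[of _ "[]"])
    moreover have "0 \<le> schwartz_seminorm N f"
      unfolding schwartz_seminorm_def
      by (rule cSUP_upper2[where x = "([], 0)"])
        (auto intro!: bdd_aboveI2[where M = B] mult_nonneg_nonneg le)
    ultimately have "C * schwartz_seminorm N f \<le> \<bar>C\<bar> * B"
      by (intro mult_mono) auto
    then show ?thesis using C[OF f] by linarith
  qed
  then show ?thesis using that[of "\<bar>C\<bar>" N] by auto
qed

lemma distribution_cmult:
  "u \<in> tempered_distributions \<Longrightarrow> f \<in> schwartz_space \<Longrightarrow> u (\<lambda>y. c * f y) = cnj c * u f"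
  by (simp add: tempered_distributions_def)

lemma distribution_add:
  "u \<in> tempered_distributions \<Longrightarrow> f \<in> schwartz_space \<Longrightarrow> g \<in> schwartz_space \<Longrightarrow>
    u (\<lambda>y. f y + g y) = u f + u g"
  by (simp add: tempered_distributions_def)

lemma distribution_diff:
  "u \<in> tempered_distributions \<Longrightarrow> f \<in> schwartz_space \<Longrightarrow> g \<in> schwartz_space \<Longrightarrow>
    u (\<lambda>y. f y - g y) = u f - u g"
  using distribution_add[of u f "\<lambda>y. (-1) * g y"] distribution_cmult[of u g "-1"] schwartz_cmult[of g "-1"]
  by simp

lemma distribution_sum:
  assumes u: "u \<in> tempered_distributions" and "\<And>j. j \<in> J \<Longrightarrow> f j \<in> schwartz_space"
  shows "u (\<lambda>y. \<Sum>j\<in>J. f j y) = (\<Sum>j\<in>J. u (f j))"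
  using assms(2) distribution_cmult[OF u schwartz_zero, of 0]
  by (induction J rule: infinite_finite_induct) (auto simp: distribution_add[OF u] schwartz_sum)

text \<open>This crude bound is what is available outside the cone of rapid decay when two windows
  are compared.\<close>

lemma stft_polynomial_growth:
  fixes g :: "real^'n::finite \<Rightarrow> complex"
  assumes u: "u \<in> tempered_distributions" and g: "g \<in> schwartz_space"
  shows "\<exists>C\<ge>0. \<exists>K. \<forall>z. cmod (stft g u z) \<le> C * wt z ^ K"
proof -
  obtain C N where C: "C \<ge> 0" and
    bnd: "\<And>f B. f \<in> schwartz_space \<Longrightarrow>
      (\<And>is x. length is \<le> N \<Longrightarrow> wt x ^ N * cmod (iter_partial is f x) \<le> B) \<Longrightarrow> cmod (u f) \<le> C * B"
    using distribution_bound[OF u] by metis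
  define L where "L = {is :: 'n list. length is \<le> N}"
  have L: "finite L" unfolding L_def using finite_lists_length_le[of "UNIV :: 'n set" N] by simp
  obtain D where D: "\<And>is. D is \<ge> 0"
    "\<And>is z y. wt y ^ N * cmod (iter_partial is (tf_shift z g) y) \<le> D is * wt z ^ (N + length is)"
    using tf_shift_bound[OF g] by metis
  have "cmod (stft g u z) \<le> C * (sum D L * wt z ^ (N + N))" for z
    unfolding stft_def
  proof (rule bnd)
    fix "is" :: "'n list" and x :: "real^'n" assume l: "length is \<le> N"
    have "wt x ^ N * cmod (iter_partial is (tf_shift z g) x) \<le> D is * wt z ^ (N + length is)" by (rule D)
    also have "\<dots> \<le> sum D L * wt z ^ (N + N)"
    proof (intro mult_mono power_increasing)
      show "D is \<le> sum D L"
        using L l D(1) by (intro member_le_sum) (auto simp: L_def)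
    qed (use l D(1) in \<open>auto intro: sum_nonneg\<close>)
    finally show "wt x ^ N * cmod (iter_partial is (tf_shift z g) x) \<le> sum D L * wt z ^ (N + N)" .
  qed (intro schwartz_tf_shift g)
  moreover have "0 \<le> C * sum D L" using C D(1) by (intro mult_nonneg_nonneg sum_nonneg) auto
  ultimately show ?thesis by (metis mult.assoc)
qed

text \<open>Pointwise convergence to a Schwartz function improves to convergence in the Schwartz
  topology: the seminorms of the remainders are bounded by tails of the weighted coefficient series.
  Continuity of u then allows it to be applied termwise; the conjugates come from conjugate
  linearity.\<close>

lemma distribution_series:
  fixes g :: "real^'n::finite \<Rightarrow> complex"
  assumes u: "u \<in> tempered_distributions" and g: "g \<in> schwartz_space" and h: "h \<in> schwartz_space"
    and c: "\<And>k. summable (\<lambda>j. cmod (c j) * wt (p j) ^ k)"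
    and sums: "\<And>y. (\<lambda>j. c j * tf_shift (p j) g y) sums h y"
  shows "(\<lambda>j. cnj (c j) * stft g u (p j)) sums u h"
proof -
  obtain C N where C: "C \<ge> 0" and
    bnd: "\<And>f B. f \<in> schwartz_space \<Longrightarrow>
      (\<And>is x. length is \<le> N \<Longrightarrow> wt x ^ N * cmod (iter_partial is f x) \<le> B) \<Longrightarrow> cmod (u f) \<le> C * B"
    using distribution_bound[OF u] by metis
  define L where "L = {is :: 'n list. length is \<le> N}"
  have L: "finite L" unfolding L_def using finite_lists_length_le[of "UNIV :: 'n set" N] by simp
  define F where "F j = (\<lambda>y. c j * tf_shift (p j) g y)" for j
  have F: "F j \<in> schwartz_space" for j
    unfolding F_def by (intro schwartz_cmult schwartz_tf_shift g)
  obtain D where D: "\<And>k is. D k is \<ge> 0"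
    "\<And>k is z y. wt y ^ k * cmod (iter_partial is (tf_shift z g) y) \<le> D k is * wt z ^ (k + length is)"
    using tf_shift_bound[OF g] by metis
  have bF: "wt y ^ k * cmod (iter_partial is (F j) y) \<le> D k is * (cmod (c j) * wt (p j) ^ (k + length is))" for k "is" j y
    using mult_left_mono[OF D(2)[of y k "is" "p j"], of "cmod (c j)"]
    by (simp add: F_def iter_partial_cmult schwartz_tf_shift g norm_mult mult_ac)
  have ser: "(\<lambda>j. iter_partial is (F j) y) sums iter_partial is h y" for "is" y
  proof (rule iter_partial_series[OF F h, where M = "\<lambda>is j. D 0 is * (cmod (c j) * wt (p j) ^ (0 + length is))"])
    show "(\<lambda>j. F j y) sums h y" for y using sums by (simp add: F_def)
  next
    show "summable (\<lambda>j. D 0 is * (cmod (c j) * wt (p j) ^ (0 + length is)))" for "is"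
      by (intro summable_mult c)
  next
    show "cmod (iter_partial is (F j) y) \<le> D 0 is * (cmod (c j) * wt (p j) ^ (0 + length is))" for "is" j y
      using bF[of y 0] by simp
  qed
  define R where "R m = (\<lambda>y. h y - (\<Sum>j<m. F j y))" for m
  have R: "R m \<in> schwartz_space" for m
    unfolding R_def by (intro schwartz_diff schwartz_sum F h)
  \<comment> \<open>Of the exponent, one N pays for the weight in x and the other for the at most N
    derivatives.\<close>
  define T where "T m = (\<Sum>j. cmod (c (j + m)) * wt (p (j + m)) ^ (N + N))" for m
  have "cmod (u (R m)) \<le> C * (sum (D N) L * T m)" for m
  proof (rule bnd[OF R])
    fix "is" :: "'n list" and x :: "real^'n" assume l: "length is \<le> N"
    have Dle: "D N is \<le> sum (D N) L"
      using L l D(1) by (intro member_le_sum) (auto simp: L_def)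
    let ?M = "\<lambda>j. sum (D N) L * (cmod (c j) * wt (p j) ^ (N + N))"
    let ?a = "\<lambda>j. of_real (wt x ^ N) * iter_partial is (F j) x"
    have M: "summable ?M" by (intro summable_mult c)
    have a: "cmod (?a j) \<le> ?M j" for j
    proof -
      have "cmod (?a j) \<le> D N is * (cmod (c j) * wt (p j) ^ (N + length is))"
        using bF[of x N "is" j] by (simp add: norm_mult norm_power)
      also have "\<dots> \<le> ?M j"
        using Dle l D(1) by (intro mult_mono power_increasing) (auto intro: sum_nonneg)
      finally show ?thesis .
    qed
    have "wt x ^ N * cmod (iter_partial is (R m) x) = cmod (suminf ?a - sum ?a {..<m})"
    proof -
      have "iter_partial is (R m) x = iter_partial is h x - (\<Sum>j<m. iter_partial is (F j) x)"
        unfolding R_def by (subst iter_partial_diff[OF h schwartz_sum[OF F]]) (simp add: iter_partial_sum[OF F])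
      moreover have "suminf ?a = of_real (wt x ^ N) * iter_partial is h x"
        by (rule sums_unique[symmetric]) (intro sums_mult ser)
      ultimately have "of_real (wt x ^ N) * iter_partial is (R m) x = suminf ?a - sum ?a {..<m}"
        by (simp only: right_diff_distrib sum_distrib_left)
      then show ?thesis by (metis abs_of_nonneg norm_mult norm_of_real wt_nonneg zero_le_power)
    qed
    also have "\<dots> \<le> (\<Sum>j. ?M (j + m))"
      by (rule norm_suminf_minus_le(2)[OF M a])
    also have "\<dots> = sum (D N) L * T m"
      unfolding T_def by (rule suminf_mult) (rule summable_ignore_initial_segment[OF c])
    finally show "wt x ^ N * cmod (iter_partial is (R m) x) \<le> sum (D N) L * T m" .
  qed
  moreover have "(\<lambda>m. C * (sum (D N) L * T m)) \<longlonglongrightarrow> C * (sum (D N) L * 0)"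
    unfolding T_def by (intro tendsto_intros suminf_tail_tendsto_0[where M = "\<lambda>j. cmod (c j) * wt (p j) ^ (N + N)"] c)
  ultimately have "(\<lambda>m. u (R m)) \<longlonglongrightarrow> 0"
    by (intro Lim_null_comparison[of "\<lambda>m. u (R m)"]) auto
  moreover have "u (R m) = u h - (\<Sum>j<m. cnj (c j) * stft g u (p j))" for m
  proof -
    have "u (R m) = u h - (\<Sum>j<m. u (F j))"
      unfolding R_def by (subst distribution_diff[OF u h schwartz_sum[OF F]]) (simp add: distribution_sum[OF u F])
    then show ?thesis by (simp add: F_def stft_def distribution_cmult[OF u schwartz_tf_shift[OF g]])
  qed
  ultimately have "(\<lambda>m. u h - (\<Sum>j<m. cnj (c j) * stft g u (p j))) \<longlonglongrightarrow> 0" by simp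
  from tendsto_diff[OF tendsto_const[of "u h"] this] show ?thesis
    by (simp add: sums_def)
qed

section \<open>Analysis and synthesis operators\<close>

text \<open>The single majorant serves twice: its supremum over y gives uniform convergence and
  hence continuity, its integral over y gives the exchange of sum and integral.\<close>

lemma tame_series:
  fixes F :: "nat \<Rightarrow> real^'n::finite \<Rightarrow> complex"
  assumes cont: "\<And>j. continuous_on UNIV (F j)"
    and M: "summable M" and bnd: "\<And>j y. cmod (F j y) \<le> M j / wt y ^ (DIM(real^'n) + 2)"
  shows "tame (\<lambda>y. \<Sum>j. F j y)"
    and "tame g \<Longrightarrow> L2_inner (\<lambda>y. \<Sum>j. F j y) g = (\<Sum>j. L2_inner (F j) g)"
proof -
  let ?K = "DIM(real^'n) + 2"
  have M0: "0 \<le> M j" for j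
    using order_trans[OF norm_ge_zero bnd[of j 0]] by (simp add: wt_def)
  have FM: "cmod (F j y) \<le> M j" for j y
    using order_trans[OF bnd divide_left_mono[OF wt_power_ge_1 M0]] by simp
  have meas [measurable]: "F j \<in> borel_measurable borel" for j
    using cont by (rule borel_measurable_continuous_onI)
  have int: "integrable lborel (F j)" for j
    by (rule integrable_bounded_by_wt[OF meas bnd])
  have sumn: "summable (\<lambda>j. cmod (F j y))" for y
    by (rule summable_comparison_test'[OF M]) (use FM in auto)
  have intM: "summable (\<lambda>j. LINT y|lborel. cmod (F j y))"
  proof (rule summable_comparison_test')
    show "summable (\<lambda>j. M j * (LINT y|lborel. 1 / wt (y::real^'n) ^ ?K))"
      by (intro summable_mult2 M)
    fix j
    have "(LINT y|lborel. cmod (F j y)) \<le> (LINT y|lborel. M j * (1 / wt (y::real^'n) ^ ?K))"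
    proof (rule integral_mono)
      show "integrable lborel (\<lambda>y. cmod (F j y))" by (intro integrable_norm int)
      show "integrable lborel (\<lambda>y::real^'n. M j * (1 / wt y ^ ?K))"
        by (intro integrable_mult_right integrable_wt order_refl)
    qed (use bnd in simp)
    also have "\<dots> = M j * (LINT y|lborel. 1 / wt (y::real^'n) ^ ?K)" by (rule integral_mult_right_zero)
    finally show "norm (LINT y|lborel. cmod (F j y)) \<le> M j * (LINT y|lborel. 1 / wt (y::real^'n) ^ ?K)"
      by (simp add: integral_nonneg)
  qed
  have "continuous_on UNIV (\<lambda>y. \<Sum>j. F j y)"
  proof (rule uniform_limit_theorem)
    show "uniform_limit UNIV (\<lambda>n y. \<Sum>j<n. F j y) (\<lambda>y. \<Sum>j. F j y) sequentially"
      by (rule Weierstrass_m_test[OF _ M]) (rule FM)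
  qed (auto intro!: continuous_intros continuous_on_subset[OF cont] always_eventually)
  moreover have "cmod (\<Sum>j. F j y) \<le> suminf M" for y
    by (rule norm_suminf_le[OF FM M])
  moreover have "integrable lborel (\<lambda>y. \<Sum>j. F j y)"
    by (rule integrable_suminf[OF int _ intM]) (use sumn in auto)
  ultimately show tame: "tame (\<lambda>y. \<Sum>j. F j y)" by (auto simp: tame_def)
  assume g: "tame g"
  obtain D where D: "D \<ge> 0" "\<And>y. cmod (g y) \<le> D" using tameD(2)[OF g] by blast
  have tF: "tame (F j)" for j unfolding tame_def using cont int FM by blast
  have "L2_inner (\<lambda>y. \<Sum>j. F j y) g = (LINT y|lborel. (\<Sum>j. F j y * cnj (g y)))"
    unfolding L2_inner_def using sumn by (simp add: suminf_mult2 summable_norm_cancel)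
  also have "\<dots> = (\<Sum>j. LINT y|lborel. F j y * cnj (g y))"
  proof (rule integral_suminf)
    show "integrable lborel (\<lambda>y. F j y * cnj (g y))" for j
      by (intro tame_mult_cnj_integrable tF g)
    show "AE y in lborel. summable (\<lambda>j. norm (F j y * cnj (g y)))"
      using sumn by (simp add: norm_mult summable_mult2)
    show "summable (\<lambda>j. LINT y|lborel. norm (F j y * cnj (g y)))"
    proof (rule summable_comparison_test')
      show "summable (\<lambda>j. (LINT y|lborel. cmod (F j y)) * D)" by (intro summable_mult2 intM)
      fix j
      have "(LINT y|lborel. norm (F j y * cnj (g y))) \<le> (LINT y|lborel. cmod (F j y) * D)"
        by (intro integral_mono integrable_norm tame_mult_cnj_integrable tF g integrable_mult_left int)
           (use D in \<open>auto simp: norm_mult intro!: mult_left_mono\<close>)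
      then show "norm (LINT y|lborel. norm (F j y * cnj (g y))) \<le> (LINT y|lborel. cmod (F j y)) * D"
        by (simp add: integral_nonneg)
    qed
  qed
  finally show "L2_inner (\<lambda>y. \<Sum>j. F j y) g = (\<Sum>j. L2_inner (F j) g)"
    by (simp add: L2_inner_def)
qed

section \<open>The squared L^2 norm on tame functions\<close>

definition sq_norm :: "(real^'n::finite \<Rightarrow> complex) \<Rightarrow> real" where
  "sq_norm f = (LINT y|lborel. (cmod (f y))\<^sup>2)"

lemma L2_inner_self: "L2_inner f f = of_real (sq_norm f)"
proof -
  have "L2_inner f f = (LINT y|lborel. of_real ((cmod (f y))\<^sup>2))"
    unfolding L2_inner_def by (intro Bochner_Integration.integral_cong refl) (simp only: complex_norm_square)
  then show ?thesis unfolding sq_norm_def by (simp only: integral_complex_of_real)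
qed

lemma tame_sq_integrable:
  fixes f :: "real^'n::finite \<Rightarrow> complex"
  assumes "tame f" shows "integrable lborel (\<lambda>y. (cmod (f y))\<^sup>2)"
proof -
  have "integrable lborel (\<lambda>y. norm (f y * cnj (f y)))"
    by (intro integrable_norm tame_mult_cnj_integrable assms)
  then show ?thesis by (simp add: norm_mult power2_eq_square)
qed

lemma sq_norm_nonneg: "0 \<le> sq_norm f"
  by (simp add: sq_norm_def integral_nonneg)

lemma sq_norm_diff:
  assumes "tame f" "tame g"
  shows "sq_norm (\<lambda>y. f y - g y) = sq_norm f - 2 * Re (L2_inner g f) + sq_norm g"
proof -
  have "integrable lborel (\<lambda>y. g y * cnj (f y))" by (intro tame_mult_cnj_integrable assms)
  then have i: "integrable lborel (\<lambda>y. Re (g y * cnj (f y)))"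
    and Re: "(LINT y|lborel. Re (g y * cnj (f y))) = Re (L2_inner g f)"
    unfolding L2_inner_def by (rule integrable_Re, rule integral_Re)
  have "sq_norm (\<lambda>y. f y - g y) = (LINT y|lborel. (cmod (f y))\<^sup>2 - 2 * Re (g y * cnj (f y)) + (cmod (g y))\<^sup>2)"
    unfolding sq_norm_def
    by (intro Bochner_Integration.integral_cong refl, unfold cmod_power2) (simp add: algebra_simps power2_eq_square)
  also have "\<dots> = (LINT y|lborel. (cmod (f y))\<^sup>2 - 2 * Re (g y * cnj (f y))) + sq_norm g"
    unfolding sq_norm_def
    by (intro Bochner_Integration.integral_add Bochner_Integration.integrable_diff
        integrable_mult_right tame_sq_integrable i assms)
  also have "(LINT y|lborel. (cmod (f y))\<^sup>2 - 2 * Re (g y * cnj (f y))) = sq_norm f - (LINT y|lborel. 2 * Re (g y * cnj (f y)))"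
    unfolding sq_norm_def
    by (intro Bochner_Integration.integral_diff integrable_mult_right tame_sq_integrable i assms)
  also have "(LINT y|lborel. 2 * Re (g y * cnj (f y))) = 2 * Re (L2_inner g f)"
    unfolding Re[symmetric] by (rule integral_mult_right_zero)
  finally show ?thesis .
qed

lemma sq_norm_add_le:
  assumes "tame f" "tame g"
  shows "sq_norm (\<lambda>y. f y + g y) \<le> 2 * sq_norm f + 2 * sq_norm g"
proof -
  have "sq_norm (\<lambda>y. f y + g y) \<le> (LINT y|lborel. 2 * (cmod (f y))\<^sup>2 + 2 * (cmod (g y))\<^sup>2)"
    unfolding sq_norm_def
  proof (intro integral_mono)
    fix y
    have "cmod (f y + g y) ^ 2 \<le> (cmod (f y) + cmod (g y)) ^ 2"
      by (intro power_mono norm_triangle_ineq) auto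
    also have "\<dots> \<le> 2 * (cmod (f y))\<^sup>2 + 2 * (cmod (g y))\<^sup>2"
      using sum_squares_bound[of "cmod (f y)" "cmod (g y)"] by (simp add: power2_sum)
    finally show "cmod (f y + g y) ^ 2 \<le> 2 * (cmod (f y))\<^sup>2 + 2 * (cmod (g y))\<^sup>2" .
  qed (intro tame_sq_integrable tame_add Bochner_Integration.integrable_add integrable_mult_right assms)+
  also have "\<dots> = (LINT y|lborel. 2 * (cmod (f y))\<^sup>2) + (LINT y|lborel. 2 * (cmod (g y))\<^sup>2)"
    by (intro Bochner_Integration.integral_add tame_sq_integrable integrable_mult_right assms)
  also have "\<dots> = 2 * sq_norm f + 2 * sq_norm g"
    unfolding sq_norm_def by (simp only: integral_mult_right_zero)
  finally show ?thesis .
qed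

text \<open>The set where f does not vanish is open by continuity and a null set, hence
  empty.\<close>

lemma sq_norm_eq_0_imp:
  fixes f :: "real^'n::finite \<Rightarrow> complex"
  assumes f: "tame f" and 0: "sq_norm f = 0"
  shows "f y = 0"
proof -
  have "AE y in lborel. (cmod (f y))\<^sup>2 = 0"
    using integral_nonneg_eq_0_iff_AE[OF tame_sq_integrable[OF f]] 0 by (simp add: sq_norm_def)
  then have ae: "AE y in lebesgue. f y = 0"
    by (auto simp: AE_completion)
  have "closed {y. f y = 0}"
    by (intro closed_Collect_eq tameD(1) f continuous_on_const)
  then have "open {y. f y \<noteq> 0}"
    by (simp add: Collect_neg_eq open_Compl)
  moreover have "negligible {y. f y \<noteq> 0}"
    using ae by (auto simp: eventually_ae_filter simp flip: negligible_iff_null_sets intro: negligible_subset)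
  ultimately show ?thesis using open_not_negligible by blast
qed

text \<open>Keeps from the lattice what the iteration uses: difference closure, for reindexing sums
  by l - m; infinitude, for an enumeration by the naturals; and an exponent \<open>K\<^sub>0\<close>
  making the weights summable. The frame inequalities are stated for tame functions, and A \<le> B
  makes 1 - A / B nonnegative.\<close>

locale gabor_system =
  fixes \<phi> :: "real^'n::finite \<Rightarrow> complex" and \<Lambda> :: "((real^'n) \<times> (real^'n)) set" and K\<^sub>0 :: nat and A B :: real
  assumes \<phi>: "\<phi> \<in> schwartz_space"
    and infinite: "infinite \<Lambda>"
    and diff_closed: "\<And>a b. a \<in> \<Lambda> \<Longrightarrow> b \<in> \<Lambda> \<Longrightarrow> a - b \<in> \<Lambda>"
    and summable_wt: "(\<lambda>l. 1 / wt l ^ K\<^sub>0) summable_on \<Lambda>"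
    and AB: "0 < A" "A \<le> B"
    and frame_summable: "\<And>f. tame f \<Longrightarrow> (\<lambda>l. (cmod (L2_inner f (tf_shift l \<phi>)))\<^sup>2) summable_on \<Lambda>"
    and frame_lower: "\<And>f. tame f \<Longrightarrow> A * sq_norm f \<le> (\<Sum>\<^sub>\<infinity>l\<in>\<Lambda>. (cmod (L2_inner f (tf_shift l \<phi>)))\<^sup>2)"
    and frame_upper: "\<And>f. tame f \<Longrightarrow> (\<Sum>\<^sub>\<infinity>l\<in>\<Lambda>. (cmod (L2_inner f (tf_shift l \<phi>)))\<^sup>2) \<le> B * sq_norm f"
begin

lemma B_pos: "0 < B" using AB by linarith

definition analysis :: "(real^'n \<Rightarrow> complex) \<Rightarrow> (real^'n) \<times> (real^'n) \<Rightarrow> complex" where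
  "analysis f l = L2_inner f (tf_shift l \<phi>)"

definition synthesis :: "((real^'n) \<times> (real^'n) \<Rightarrow> complex) \<Rightarrow> real^'n \<Rightarrow> complex" where
  "synthesis c y = (\<Sum>\<^sub>\<infinity>l\<in>\<Lambda>. c l * tf_shift l \<phi> y)"

definition rapid :: "((real^'n) \<times> (real^'n) \<Rightarrow> complex) \<Rightarrow> bool" where
  "rapid c \<longleftrightarrow> (\<forall>K. \<exists>C\<ge>0. \<forall>l\<in>\<Lambda>. wt l ^ K * cmod (c l) \<le> C)"

lemma rapid_summable:
  assumes "rapid c" shows "(\<lambda>l. wt l ^ k * cmod (c l)) summable_on \<Lambda>"
proof -
  obtain C where C: "\<And>l. l \<in> \<Lambda> \<Longrightarrow> wt l ^ (k + K\<^sub>0) * cmod (c l) \<le> C"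
    using assms unfolding rapid_def by meson
  show ?thesis
  proof (rule summable_on_comparison_test)
    show "(\<lambda>l. C * (1 / wt l ^ K\<^sub>0)) summable_on \<Lambda>"
      by (intro summable_on_cmult_right summable_wt)
    show "wt l ^ k * cmod (c l) \<le> C * (1 / wt l ^ K\<^sub>0)" if "l \<in> \<Lambda>" for l
      using C[OF that] by (simp add: pos_le_divide_eq power_add mult_ac)
  qed simp
qed

lemma rapid_abs_summable: "rapid c \<Longrightarrow> (\<lambda>l. cmod (c l)) summable_on \<Lambda>"
  using rapid_summable[of c 0] by simp

lemma rapid_mono:
  assumes "rapid c" and "\<And>l. l \<in> \<Lambda> \<Longrightarrow> cmod (d l) \<le> D * wt l ^ k * cmod (c l)" and D: "0 \<le> D"
  shows "rapid d"
  unfolding rapid_def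
proof
  fix K
  obtain C where C: "C \<ge> 0" "\<And>l. l \<in> \<Lambda> \<Longrightarrow> wt l ^ (K + k) * cmod (c l) \<le> C"
    using assms(1) unfolding rapid_def by meson
  have "wt l ^ K * cmod (d l) \<le> D * C" if l: "l \<in> \<Lambda>" for l
  proof -
    have "wt l ^ K * cmod (d l) \<le> wt l ^ K * (D * wt l ^ k * cmod (c l))"
      by (intro mult_left_mono assms(2) l) simp
    also have "\<dots> = D * (wt l ^ (K + k) * cmod (c l))" by (simp add: power_add mult_ac)
    also have "\<dots> \<le> D * C" by (intro mult_left_mono C l D)
    finally show ?thesis .
  qed
  then show "\<exists>C\<ge>0. \<forall>l\<in>\<Lambda>. wt l ^ K * cmod (d l) \<le> C"
    using C(1) D by (intro exI[of _ "D * C"]) auto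
qed

lemma rapid_cmult: "rapid c \<Longrightarrow> rapid (\<lambda>l. a * c l)"
  by (erule rapid_mono[where D = "cmod a" and k = 0]) (auto simp: norm_mult)

lemma rapid_add:
  assumes "rapid c" "rapid d" shows "rapid (\<lambda>l. c l + d l)"
  unfolding rapid_def
proof
  fix K
  obtain C where C: "C \<ge> 0" "\<And>l. l \<in> \<Lambda> \<Longrightarrow> wt l ^ K * cmod (c l) \<le> C"
    using assms(1) unfolding rapid_def by meson
  obtain D where D: "D \<ge> 0" "\<And>l. l \<in> \<Lambda> \<Longrightarrow> wt l ^ K * cmod (d l) \<le> D"
    using assms(2) unfolding rapid_def by meson
  have "wt l ^ K * cmod (c l + d l) \<le> C + D" if l: "l \<in> \<Lambda>" for l
  proof -
    have "wt l ^ K * cmod (c l + d l) \<le> wt l ^ K * (cmod (c l) + cmod (d l))"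
      by (intro mult_left_mono norm_triangle_ineq) simp
    also have "\<dots> \<le> C + D" using C(2)[OF l] D(2)[OF l] by (simp add: distrib_left)
    finally show ?thesis .
  qed
  then show "\<exists>C\<ge>0. \<forall>l\<in>\<Lambda>. wt l ^ K * cmod (c l + d l) \<le> C"
    using C(1) D(1) by (intro exI[of _ "C + D"]) auto
qed

lemma rapid_diff: "rapid c \<Longrightarrow> rapid d \<Longrightarrow> rapid (\<lambda>l. c l - d l)"
  using rapid_add[of c "\<lambda>l. (-1) * d l"] rapid_cmult[of d "-1"] by simp

lemma rapid_zero: "rapid (\<lambda>_. 0)"
  by (auto simp: rapid_def)

lemma countable: "countable \<Lambda>"
  using abs_summable_countable[of "\<lambda>l. 1 / wt l ^ K\<^sub>0" \<Lambda>] summable_wt by simp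

text \<open>Turns unordered sums over the lattice into ordinary series, to which dominated
  convergence and termwise differentiation apply.\<close>

definition enum :: "nat \<Rightarrow> (real^'n) \<times> (real^'n)" where
  "enum = from_nat_into \<Lambda>"

lemma bij_enum: "bij_betw enum UNIV \<Lambda>"
  unfolding enum_def by (rule bij_betw_from_nat_into[OF countable infinite])

lemma enum_in: "enum j \<in> \<Lambda>"
  using bij_enum by (auto simp: bij_betw_def)

lemma infsum_enum:
  fixes f :: "(real^'n) \<times> (real^'n) \<Rightarrow> 'b::banach"
  assumes "(\<lambda>l. norm (f l)) summable_on \<Lambda>"
  shows "summable (\<lambda>j. norm (f (enum j)))" "(\<lambda>j. f (enum j)) sums (\<Sum>\<^sub>\<infinity>l\<in>\<Lambda>. f l)"
proof -
  have "(\<lambda>j. norm (f (enum j))) summable_on UNIV"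
    using assms summable_on_reindex_bij_betw[OF bij_enum, of "\<lambda>l. norm (f l)"] by simp
  then show "summable (\<lambda>j. norm (f (enum j)))" by (rule summable_on_imp_summable)
  have "(f has_sum (\<Sum>\<^sub>\<infinity>l\<in>\<Lambda>. f l)) \<Lambda>"
    using assms by (simp add: abs_summable_summable)
  then have "((\<lambda>j. f (enum j)) has_sum (\<Sum>\<^sub>\<infinity>l\<in>\<Lambda>. f l)) UNIV"
    using has_sum_reindex_bij_betw[OF bij_enum] by blast
  then show "(\<lambda>j. f (enum j)) sums (\<Sum>\<^sub>\<infinity>l\<in>\<Lambda>. f l)" by (rule has_sum_imp_sums)
qed

lemma tame_tf_shift: "tame (tf_shift l \<phi>)"
  by (intro schwartz_tame schwartz_tf_shift \<phi>)

lemma synthesis_summable: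
  assumes "rapid c" shows "(\<lambda>l. cmod (c l * tf_shift l \<phi> y)) summable_on \<Lambda>"
proof -
  obtain C where C: "C \<ge> 0" "\<And>z y. cmod (tf_shift z \<phi> y) \<le> C"
    using tf_shift_bound[OF \<phi>, of 0 "[]"] by auto
  show ?thesis
  proof (rule Infinite_Sum.abs_summable_on_comparison_test')
    show "(\<lambda>l. C * (wt l ^ 0 * cmod (c l))) summable_on \<Lambda>"
      by (intro summable_on_cmult_right rapid_summable assms)
    show "norm (c l * tf_shift l \<phi> y) \<le> C * (wt l ^ 0 * cmod (c l))" for l
      using mult_right_mono[OF C(2)[of l y], of "cmod (c l)"] by (simp add: norm_mult mult_ac)
  qed
qed

lemma synthesis_props:
  assumes c: "rapid c"
  shows "tame (synthesis c)"
    and "tame g \<Longrightarrow> (\<lambda>l. cmod (c l * L2_inner (tf_shift l \<phi>) g)) summable_on \<Lambda>"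
    and "tame g \<Longrightarrow> L2_inner (synthesis c) g = (\<Sum>\<^sub>\<infinity>l\<in>\<Lambda>. c l * L2_inner (tf_shift l \<phi>) g)"
proof -
  let ?K = "DIM(real^'n) + 2"
  obtain C where C: "C \<ge> 0" "\<And>z y. wt y ^ ?K * cmod (tf_shift z \<phi> y) \<le> C * wt z ^ ?K"
    using tf_shift_bound[OF \<phi>, of ?K "[]"] by auto
  define F where "F j y = c (enum j) * tf_shift (enum j) \<phi> y" for j y
  define M where "M j = C * (wt (enum j) ^ ?K * cmod (c (enum j)))" for j
  have M: "summable M"
    unfolding M_def using infsum_enum(1)[of "\<lambda>l. wt l ^ ?K * cmod (c l)"] rapid_summable[OF c, of ?K]
    by (intro summable_mult) (simp add: norm_mult norm_power)
  have bnd: "cmod (F j y) \<le> M j / wt y ^ ?K" for j y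
    using mult_left_mono[OF C(2)[of y "enum j"], of "cmod (c (enum j))"]
    by (simp add: F_def M_def pos_le_divide_eq norm_mult mult_ac)
  have cont: "continuous_on UNIV (F j)" for j
    unfolding F_def by (intro continuous_intros schwartz_continuous schwartz_tf_shift \<phi>)
  have eq: "synthesis c = (\<lambda>y. \<Sum>j. F j y)"
    unfolding synthesis_def F_def using infsum_enum(2)[OF synthesis_summable[OF c]] sums_unique by blast
  show "tame (synthesis c)" unfolding eq by (rule tame_series[OF cont M bnd])
  assume g: "tame g"
  obtain D where D: "D \<ge> 0" "\<And>y. cmod (g y) \<le> D" using tameD(2)[OF g] by blast
  let ?J = "LINT y|lborel. 1 / wt (y::real^'n) ^ ?K"
  have ip: "cmod (L2_inner (tf_shift l \<phi>) g) \<le> (C * D * ?J) * wt l ^ ?K" for l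
  proof -
    have "cmod (L2_inner (tf_shift l \<phi>) g) \<le> (LINT y|lborel. cmod (tf_shift l \<phi> y * cnj (g y)))"
      unfolding L2_inner_def by (rule integral_norm_bound)
    also have "\<dots> \<le> (LINT y|lborel. (C * wt l ^ ?K * D) * (1 / wt (y::real^'n) ^ ?K))"
    proof (intro integral_mono integrable_norm tame_mult_cnj_integrable tame_tf_shift g
        integrable_mult_right integrable_wt order_refl)
      fix y
      have "cmod (tf_shift l \<phi> y) \<le> C * wt l ^ ?K / wt y ^ ?K"
        using C(2)[of y l] by (simp add: pos_le_divide_eq mult_ac)
      then have "cmod (tf_shift l \<phi> y) * cmod (g y) \<le> (C * wt l ^ ?K / wt y ^ ?K) * D"
        using C D by (intro mult_mono) auto
      then show "cmod (tf_shift l \<phi> y * cnj (g y)) \<le> (C * wt l ^ ?K * D) * (1 / wt y ^ ?K)"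
        by (simp add: norm_mult)
    qed
    also have "\<dots> = (C * wt l ^ ?K * D) * ?J" by (rule integral_mult_right_zero)
    finally show ?thesis by (simp add: mult_ac)
  qed
  show s: "(\<lambda>l. cmod (c l * L2_inner (tf_shift l \<phi>) g)) summable_on \<Lambda>"
  proof (rule Infinite_Sum.abs_summable_on_comparison_test')
    show "(\<lambda>l. (C * D * ?J) * (wt l ^ ?K * cmod (c l))) summable_on \<Lambda>"
      by (intro summable_on_cmult_right rapid_summable c)
    show "norm (c l * L2_inner (tf_shift l \<phi>) g) \<le> (C * D * ?J) * (wt l ^ ?K * cmod (c l))" for l
      using mult_left_mono[OF ip[of l], of "cmod (c l)"] by (simp add: norm_mult mult_ac)
  qed
  have "L2_inner (synthesis c) g = (\<Sum>j. L2_inner (F j) g)"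
    unfolding eq by (rule tame_series(2)[OF cont M bnd g])
  also have "\<dots> = (\<Sum>\<^sub>\<infinity>l\<in>\<Lambda>. c l * L2_inner (tf_shift l \<phi>) g)"
    unfolding F_def L2_inner_cmult_left using infsum_enum(2)[OF s] by (simp add: sums_iff)
  finally show "L2_inner (synthesis c) g = (\<Sum>\<^sub>\<infinity>l\<in>\<Lambda>. c l * L2_inner (tf_shift l \<phi>) g)" .
qed

lemma synthesis_inner_has_sum:
  assumes "rapid c" "tame f"
  shows "((\<lambda>l. c l * cnj (analysis f l)) has_sum L2_inner (synthesis c) f) \<Lambda>"
  using synthesis_props(2,3)[OF assms] 
  by (simp add: analysis_def L2_inner_cnj abs_summable_summable)

lemma analysis_synthesis:
  assumes "rapid c"
  shows "((\<lambda>m. c m * L2_inner (tf_shift m \<phi>) (tf_shift l \<phi>)) has_sum analysis (synthesis c) l) \<Lambda>"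
  using synthesis_props(2,3)[OF assms tame_tf_shift[of l]]
  by (simp add: analysis_def abs_summable_summable)

lemma rapid_sq_summable:
  assumes "rapid c" shows "(\<lambda>l. (wt l ^ k * cmod (c l))\<^sup>2) summable_on \<Lambda>"
proof -
  obtain C where C: "C \<ge> 0" "\<And>l. l \<in> \<Lambda> \<Longrightarrow> wt l ^ k * cmod (c l) \<le> C"
    using assms unfolding rapid_def by meson
  show ?thesis
  proof (rule summable_on_comparison_test)
    show "(\<lambda>l. C * (wt l ^ k * cmod (c l))) summable_on \<Lambda>"
      by (intro summable_on_cmult_right rapid_summable assms)
    show "(wt l ^ k * cmod (c l))\<^sup>2 \<le> C * (wt l ^ k * cmod (c l))" if "l \<in> \<Lambda>" for l
      unfolding power2_eq_square by (intro mult_right_mono C that) simp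
  qed simp
qed

lemma rapid_analysis:
  assumes f: "f \<in> schwartz_space" shows "rapid (analysis f)"
  unfolding rapid_def
proof
  fix K
  obtain C where C: "C \<ge> 0" "\<And>w z. wt (z - w) ^ K * cmod (L2_inner (tf_shift w f) (tf_shift z \<phi>)) \<le> C"
    using L2_inner_tf_shift_decay[OF f \<phi>, of K] by auto
  then show "\<exists>C\<ge>0. \<forall>l\<in>\<Lambda>. wt l ^ K * cmod (analysis f l) \<le> C"
    using C(2)[of _ 0] by (auto simp: analysis_def)
qed

text \<open>The Gram matrix preserves rapid decay: \<open>wt l\<close> is at most
  \<open>wt m * wt (l - m)\<close>, the second factor is absorbed by the off-diagonal decay and the
  first by the coefficients.\<close>

lemma rapid_analysis_synthesis:
  assumes c: "rapid c" shows "rapid (analysis (synthesis c))"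
  unfolding rapid_def
proof
  fix K
  obtain C where C: "C \<ge> 0" "\<And>w z. wt (z - w) ^ K * cmod (L2_inner (tf_shift w \<phi>) (tf_shift z \<phi>)) \<le> C"
    using L2_inner_tf_shift_decay[OF \<phi> \<phi>, of K] by auto
  have "wt l ^ K * cmod (analysis (synthesis c) l) \<le> C * (\<Sum>\<^sub>\<infinity>m\<in>\<Lambda>. wt m ^ K * cmod (c m))" for l
  proof -
    have s: "(\<lambda>m. C * (wt m ^ K * cmod (c m))) summable_on \<Lambda>"
      by (intro summable_on_cmult_right rapid_summable c)
    have "((\<lambda>m. of_real (wt l ^ K) * (c m * L2_inner (tf_shift m \<phi>) (tf_shift l \<phi>)))
        has_sum (of_real (wt l ^ K) * analysis (synthesis c) l)) \<Lambda>"
      by (intro has_sum_cmult_right analysis_synthesis c)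
    then have "cmod (of_real (wt l ^ K) * analysis (synthesis c) l) \<le> (\<Sum>\<^sub>\<infinity>m\<in>\<Lambda>. C * (wt m ^ K * cmod (c m)))"
    proof (rule norm_infsum_le)
      show "((\<lambda>m. C * (wt m ^ K * cmod (c m))) has_sum (\<Sum>\<^sub>\<infinity>m\<in>\<Lambda>. C * (wt m ^ K * cmod (c m)))) \<Lambda>"
        using s by simp
      fix m
      have "wt l ^ K \<le> wt m ^ K * wt (l - m) ^ K"
        using wt_add_power_le[of m "l - m" K] by simp
      then have "cmod (of_real (wt l ^ K) * (c m * L2_inner (tf_shift m \<phi>) (tf_shift l \<phi>)))
        \<le> (wt m ^ K * wt (l - m) ^ K) * (cmod (c m) * cmod (L2_inner (tf_shift m \<phi>) (tf_shift l \<phi>)))"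
        by (simp only: norm_mult norm_of_real abs_of_nonneg[OF zero_le_power[OF wt_nonneg]])
          (intro mult_right_mono mult_nonneg_nonneg norm_ge_zero)
      also have "\<dots> = (wt (l - m) ^ K * cmod (L2_inner (tf_shift m \<phi>) (tf_shift l \<phi>))) * (wt m ^ K * cmod (c m))"
        by (simp add: mult_ac)
      also have "\<dots> \<le> C * (wt m ^ K * cmod (c m))"
        by (intro mult_right_mono C) auto
      finally show "cmod (of_real (wt l ^ K) * (c m * L2_inner (tf_shift m \<phi>) (tf_shift l \<phi>))) \<le> C * (wt m ^ K * cmod (c m))" .
    qed
    then show ?thesis by (simp add: norm_mult norm_power infsum_cmult_right')
  qed
  moreover have "0 \<le> C * (\<Sum>\<^sub>\<infinity>m\<in>\<Lambda>. wt m ^ K * cmod (c m))"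
    using C(1) by (intro mult_nonneg_nonneg infsum_nonneg) auto
  ultimately show "\<exists>C\<ge>0. \<forall>l\<in>\<Lambda>. wt l ^ K * cmod (analysis (synthesis c) l) \<le> C" by blast
qed

section \<open>Frame bounds for synthesis and for one step of the iteration\<close>

definition l2 :: "((real^'n) \<times> (real^'n) \<Rightarrow> complex) \<Rightarrow> real" where
  "l2 c = (\<Sum>\<^sub>\<infinity>l\<in>\<Lambda>. (cmod (c l))\<^sup>2)"

lemma l2_has_sum: "rapid c \<Longrightarrow> ((\<lambda>l. (cmod (c l))\<^sup>2) has_sum l2 c) \<Lambda>"
  using rapid_sq_summable[of c 0] by (simp add: l2_def)

lemma l2_analysis_has_sum: "tame f \<Longrightarrow> ((\<lambda>l. (cmod (analysis f l))\<^sup>2) has_sum l2 (analysis f)) \<Lambda>"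
  using frame_summable[of f] by (simp add: l2_def analysis_def)

lemma l2_nonneg: "0 \<le> l2 c"
  unfolding l2_def by (intro infsum_nonneg) simp

lemma l2_analysis_bounds:
  assumes "tame f" shows "A * sq_norm f \<le> l2 (analysis f)" "l2 (analysis f) \<le> B * sq_norm f"
  using frame_lower[OF assms] frame_upper[OF assms] by (simp_all add: l2_def analysis_def)

text \<open>Duality: the squared norm of the synthesis pairs c with the coefficients of the
  synthesis. Splitting each product with weights B / 2 and 1 / (2 B) makes the upper frame bound
  return half of the left side, which is absorbed.\<close>

lemma sq_norm_synthesis_le:
  assumes c: "rapid c" shows "sq_norm (synthesis c) \<le> B * l2 c"
proof -
  note t = synthesis_props(1)[OF c]
  let ?v = "analysis (synthesis c)"
  have "((\<lambda>l. Re (c l * cnj (?v l))) has_sum sq_norm (synthesis c)) \<Lambda>"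
    using has_sum_Re[OF synthesis_inner_has_sum[OF c t]] by (simp add: L2_inner_self)
  moreover have "((\<lambda>l. B / 2 * (cmod (c l))\<^sup>2 + 1 / (2 * B) * (cmod (?v l))\<^sup>2) has_sum
      (B / 2 * l2 c + 1 / (2 * B) * l2 ?v)) \<Lambda>"
    by (intro has_sum_add has_sum_cmult_right l2_has_sum l2_analysis_has_sum c t)
  ultimately have "sq_norm (synthesis c) \<le> B / 2 * l2 c + 1 / (2 * B) * l2 ?v"
  proof (rule has_sum_mono)
    fix l
    let ?a = "cmod (c l)" and ?b = "cmod (?v l)"
    have "Re (c l * cnj (?v l)) \<le> ?a * ?b"
      using complex_Re_le_cmod[of "c l * cnj (?v l)"] by (simp only: norm_mult complex_mod_cnj)
    also have "\<dots> \<le> B / 2 * ?a\<^sup>2 + 1 / (2 * B) * ?b\<^sup>2"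
    proof -
      have "0 \<le> (B * ?a - ?b)\<^sup>2" by simp
      then have "2 * B * (?a * ?b) \<le> B\<^sup>2 * ?a\<^sup>2 + ?b\<^sup>2" by (simp add: power2_diff power_mult_distrib)
      then show ?thesis using B_pos by (simp add: field_simps power2_eq_square)
    qed
    finally show "Re (c l * cnj (?v l)) \<le> B / 2 * ?a\<^sup>2 + 1 / (2 * B) * ?b\<^sup>2" .
  qed
  also have "\<dots> \<le> B / 2 * l2 c + 1 / (2 * B) * (B * sq_norm (synthesis c))"
    using B_pos by (intro add_left_mono mult_left_mono l2_analysis_bounds t) auto
  finally show ?thesis using B_pos by simp
qed

text \<open>The frame iteration seen on coefficients, I - G / B with the Gram operator G. This form
  can be conjugated by weights on the lattice.\<close>

definition step :: "((real^'n) \<times> (real^'n) \<Rightarrow> complex) \<Rightarrow> (real^'n) \<times> (real^'n) \<Rightarrow> complex" where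
  "step c l = c l - of_real (1 / B) * analysis (synthesis c) l"

lemma rapid_step: "rapid c \<Longrightarrow> rapid (step c)"
  unfolding step_def by (intro rapid_diff rapid_cmult rapid_analysis_synthesis)

text \<open>Expanding the square gives a cross term -2 / B times the squared norm of the synthesis
  and a quadratic term of at most 1 / B times it. Strict contraction would fail on the kernel of
  synthesis.\<close>

lemma l2_step_le:
  assumes c: "rapid c" shows "l2 (step c) \<le> l2 c"
proof -
  note t = synthesis_props(1)[OF c]
  let ?v = "analysis (synthesis c)"
  have "((\<lambda>l. Re (c l * cnj (?v l))) has_sum sq_norm (synthesis c)) \<Lambda>"
    using has_sum_Re[OF synthesis_inner_has_sum[OF c t]] by (simp add: L2_inner_self)
  then have "((\<lambda>l. (cmod (c l))\<^sup>2 + (- 2 / B) * Re (c l * cnj (?v l)) + (1 / B)\<^sup>2 * (cmod (?v l))\<^sup>2) has_sum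
      (l2 c + (- 2 / B) * sq_norm (synthesis c) + (1 / B)\<^sup>2 * l2 ?v)) \<Lambda>"
    by (intro has_sum_add has_sum_cmult_right l2_has_sum l2_analysis_has_sum c t)
  moreover have "(cmod (step c l))\<^sup>2 = (cmod (c l))\<^sup>2 + (- 2 / B) * Re (c l * cnj (?v l)) + (1 / B)\<^sup>2 * (cmod (?v l))\<^sup>2" for l
    by (unfold step_def cmod_power2) (simp add: power2_eq_square algebra_simps add_divide_distrib)
  ultimately have "l2 (step c) = l2 c + (- 2 / B) * sq_norm (synthesis c) + (1 / B)\<^sup>2 * l2 ?v"
    by (simp add: l2_def infsumI)
  also have "\<dots> \<le> l2 c + (- 2 / B) * sq_norm (synthesis c) + (1 / B)\<^sup>2 * (B * sq_norm (synthesis c))"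
    by (intro add_left_mono mult_left_mono l2_analysis_bounds t) auto
  also have "\<dots> = l2 c - sq_norm (synthesis c) / B"
    using B_pos by (simp add: power2_eq_square field_simps)
  also have "\<dots> \<le> l2 c" using B_pos sq_norm_nonneg[of "synthesis c"] by simp
  finally show ?thesis .
qed

text \<open>Here the lower frame bound enters. The cross term is the l^2 norm of the coefficients
  with factor -2 / B, the quadratic term returns at most 1 / B of it, and the remaining -1 / B
  dominates -A / B times the squared norm of f.\<close>

lemma sq_norm_step_le:
  assumes f: "tame f" and r: "rapid (analysis f)"
  shows "sq_norm (\<lambda>y. f y - of_real (1 / B) * synthesis (analysis f) y) \<le> (1 - A / B) * sq_norm f"
proof -
  let ?c = "analysis f" and ?E = "synthesis (analysis f)"
  note t = synthesis_props(1)[OF r]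
  have "((\<lambda>l. ?c l * cnj (?c l)) has_sum L2_inner ?E f) \<Lambda>"
    by (rule synthesis_inner_has_sum[OF r f])
  from has_sum_Re[OF this] have "((\<lambda>l. (cmod (?c l))\<^sup>2) has_sum Re (L2_inner ?E f)) \<Lambda>"
    by (simp add: complex_mult_cnj cmod_power2)
  then have Re: "Re (L2_inner ?E f) = l2 ?c" by (simp add: l2_def infsumI)
  have sc: "sq_norm (\<lambda>y. of_real (1 / B) * ?E y) = (1 / B)\<^sup>2 * sq_norm ?E"
    unfolding sq_norm_def norm_mult power_mult_distrib norm_of_real power2_abs by (rule integral_mult_right_zero)
  have "sq_norm (\<lambda>y. f y - of_real (1 / B) * ?E y)
      = sq_norm f - 2 * Re (L2_inner (\<lambda>y. of_real (1 / B) * ?E y) f) + sq_norm (\<lambda>y. of_real (1 / B) * ?E y)"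
    by (rule sq_norm_diff[OF f tame_cmult[OF t]])
  also have "\<dots> = sq_norm f - 2 / B * l2 ?c + (1 / B)\<^sup>2 * sq_norm ?E"
    unfolding sc L2_inner_cmult_left by (simp add: Re)
  also have "\<dots> \<le> sq_norm f - 2 / B * l2 ?c + (1 / B)\<^sup>2 * (B * l2 ?c)"
    by (intro add_left_mono mult_left_mono sq_norm_synthesis_le r) auto
  also have "\<dots> = sq_norm f - l2 ?c / B"
    using B_pos by (simp add: power2_eq_square field_simps)
  also have "\<dots> \<le> sq_norm f - A * sq_norm f / B"
    using B_pos l2_analysis_bounds(1)[OF f] by (intro diff_left_mono divide_right_mono) auto
  finally show ?thesis by (simp add: algebra_simps)
qed

end

section \<open>Rapidly decreasing Gabor expansions\<close>

text \<open>What matters is the factor e: the relative change of the weight between two points is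
  small with e, up to a power of their distance. In that power K comes from comparing the two
  weights themselves and 1 from the difference of their bases.\<close>

lemma weight_power_diff:
  fixes l m :: "'a::real_normed_vector"
  assumes e: "0 \<le> e" "e \<le> 1"
  shows "\<bar>(1 + e * norm m) ^ K - (1 + e * norm l) ^ K\<bar> \<le> real K * e * wt (l - m) ^ (K + 1) * (1 + e * norm m) ^ K"
proof (induction K)
  case (Suc K)
  define a where "a = 1 + e * norm m"
  define b where "b = 1 + e * norm l"
  define v where "v = wt (l - m)"
  have a: "1 \<le> a" and b: "0 \<le> b" and v: "1 \<le> v"
    using e by (auto simp: a_def b_def v_def)
  have "\<bar>norm m - norm l\<bar> \<le> norm (l - m)" by (metis norm_triangle_ineq3 norm_minus_commute)
  also have "\<dots> \<le> v" by (simp add: v_def wt_def)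
  finally have nv: "\<bar>norm m - norm l\<bar> \<le> v" .
  have "\<bar>a - b\<bar> = e * \<bar>norm m - norm l\<bar>"
    using e by (simp add: a_def b_def abs_mult flip: right_diff_distrib)
  also have "\<dots> \<le> e * v" by (intro mult_left_mono nv e)
  finally have ab: "\<bar>a - b\<bar> \<le> e * v" .
  have "norm l \<le> norm m + norm (l - m)" using norm_triangle_sub[of l m] by simp
  then have "b \<le> 1 + (e * norm m + e * norm (l - m))"
    unfolding b_def distrib_left[symmetric] by (intro add_left_mono mult_left_mono e)
  also have "\<dots> \<le> 1 + e * norm m + norm (l - m)"
    using mult_right_mono[OF e(2), of "norm (l - m)"] by simp
  also have "\<dots> \<le> a * v"
  proof -
    have "0 \<le> e * norm m * norm (l - m)" using e by simp
    then show ?thesis by (simp add: a_def v_def wt_def algebra_simps)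
  qed
  finally have bav: "b \<le> a * v" .
  \<comment> \<open>Telescoping: the first summand is left to the induction hypothesis, the second
    carries the new factor e through \<open>ab\<close> while \<open>bav\<close> expresses b through
    a.\<close>
  have "\<bar>a ^ Suc K - b ^ Suc K\<bar> = \<bar>a * (a ^ K - b ^ K) + (a - b) * b ^ K\<bar>"
    by (simp add: algebra_simps)
  also have "\<dots> \<le> \<bar>a * (a ^ K - b ^ K)\<bar> + \<bar>(a - b) * b ^ K\<bar>" by (rule abs_triangle_ineq)
  also have "\<dots> = a * \<bar>a ^ K - b ^ K\<bar> + \<bar>a - b\<bar> * b ^ K"
    using a b by (simp add: abs_mult)
  also have "\<dots> \<le> a * (real K * e * v ^ (K + 1) * a ^ K) + (e * v) * (a * v) ^ K"
    using Suc.IH a b v e by (intro add_mono mult_mono power_mono ab bav) (auto simp: a_def b_def v_def)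
  also have "\<dots> = (real K * e * a ^ Suc K) * v ^ (K + 1) + e * (a ^ K * v ^ (K + 1))"
    by (simp add: power_mult_distrib mult_ac)
  also have "\<dots> \<le> (real K * e * a ^ Suc K) * v ^ (Suc K + 1) + e * (a ^ Suc K * v ^ (Suc K + 1))"
    using a v e by (intro add_mono mult_left_mono mult_mono power_increasing) auto
  also have "\<dots> = real (Suc K) * e * v ^ (Suc K + 1) * a ^ Suc K"
    by (simp add: algebra_simps)
  finally show ?case by (simp only: a_def b_def v_def)
qed simp

context gabor_system
begin

section \<open>The Schur test and weighted norms along the iteration\<close>

lemma zero_mem: "0 \<in> \<Lambda>"
proof -
  obtain l where "l \<in> \<Lambda>" using infinite_imp_nonempty[OF infinite] by blast
  then show ?thesis using diff_closed[of l l] by simp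
qed

definition wt_sum :: real where
  "wt_sum = (\<Sum>\<^sub>\<infinity>l\<in>\<Lambda>. 1 / wt l ^ K\<^sub>0)"

lemma wt_sum_pos: "0 < wt_sum"
proof -
  have "sum (\<lambda>l::(real^'n) \<times> (real^'n). 1 / wt l ^ K\<^sub>0) {0} \<le> wt_sum"
    unfolding wt_sum_def by (rule finite_sum_le_infsum[OF summable_wt]) (use zero_mem in auto)
  then show ?thesis by (simp add: wt_def)
qed

text \<open>The map m to l - m permutes the lattice, so all rows of the convolution kernel have the
  same sum. This common value is the constant of the Schur test.\<close>

lemma wt_diff_has_sum:
  assumes "l \<in> \<Lambda>" shows "((\<lambda>m. 1 / wt (l - m) ^ K\<^sub>0) has_sum wt_sum) \<Lambda>"
proof -
  have bij: "bij_betw (\<lambda>m. l - m) \<Lambda> \<Lambda>"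
    by (rule bij_betw_byWitness[where f' = "\<lambda>m. l - m"]) (simp_all add: image_subset_iff diff_closed assms)
  have "((\<lambda>m. 1 / wt m ^ K\<^sub>0) has_sum wt_sum) \<Lambda>"
    unfolding wt_sum_def using summable_wt by simp
  then show ?thesis
    using has_sum_reindex_bij_betw[OF bij, of "\<lambda>m. 1 / wt m ^ K\<^sub>0" wt_sum] by simp
qed

text \<open>Schur test for a symmetric convolution kernel: Cauchy-Schwarz within each row, then
  summation over the rows in the other order. Row and column sums both equal \<open>wt_sum\<close>,
  whence the square.\<close>

lemma schur_bound:
  assumes a0: "\<And>m. 0 \<le> a m" and a1: "a summable_on \<Lambda>" and a2: "(\<lambda>m. (a m)\<^sup>2) summable_on \<Lambda>"
  shows "(\<lambda>l. (\<Sum>\<^sub>\<infinity>m\<in>\<Lambda>. 1 / wt (l - m) ^ K\<^sub>0 * a m)\<^sup>2) summable_on \<Lambda>"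
    and "(\<Sum>\<^sub>\<infinity>l\<in>\<Lambda>. (\<Sum>\<^sub>\<infinity>m\<in>\<Lambda>. 1 / wt (l - m) ^ K\<^sub>0 * a m)\<^sup>2) \<le> wt_sum\<^sup>2 * (\<Sum>\<^sub>\<infinity>m\<in>\<Lambda>. (a m)\<^sup>2)"
proof -
  define H where "H l m = 1 / wt (l - m) ^ K\<^sub>0" for l m :: "(real^'n) \<times> (real^'n)"
  have H0: "0 \<le> H l m" for l m by (simp add: H_def)
  have H1: "H l m \<le> 1" for l m by (simp add: H_def)
  have Hsym: "H l m = H m l" for l m
    using wt_minus[of "l - m"] by (simp add: H_def)
  have Hs: "(H l has_sum wt_sum) \<Lambda>" if "l \<in> \<Lambda>" for l
    using wt_diff_has_sum[OF that] unfolding H_def .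
  have s1: "(\<lambda>m. H l m * a m) summable_on \<Lambda>" for l
    using a1 by (rule summable_on_comparison_test) (use a0 H0 H1 in \<open>auto simp: mult_left_le_one_le\<close>)
  have s2: "(\<lambda>m. H l m * (a m)\<^sup>2) summable_on \<Lambda>" for l
    using a2 by (rule summable_on_comparison_test) (use H0 H1 in \<open>auto simp: mult_left_le_one_le\<close>)
  have CS: "(\<Sum>\<^sub>\<infinity>m\<in>\<Lambda>. H l m * a m)\<^sup>2 \<le> wt_sum * (\<Sum>\<^sub>\<infinity>m\<in>\<Lambda>. H l m * (a m)\<^sup>2)" if l: "l \<in> \<Lambda>" for l
  proof -
    \<comment> \<open>The mean of a with respect to the weights \<open>H l\<close>, whose total is
      \<open>wt_sum\<close>. Nonnegativity of the weighted variance around it is the Cauchy-Schwarz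
      inequality.\<close>
    define t where "t = (\<Sum>\<^sub>\<infinity>m\<in>\<Lambda>. H l m * a m) / wt_sum"
    have "((\<lambda>m. H l m * (a m)\<^sup>2 + (- 2 * t) * (H l m * a m) + t\<^sup>2 * H l m) has_sum
       ((\<Sum>\<^sub>\<infinity>m\<in>\<Lambda>. H l m * (a m)\<^sup>2) + (- 2 * t) * (\<Sum>\<^sub>\<infinity>m\<in>\<Lambda>. H l m * a m) + t\<^sup>2 * wt_sum)) \<Lambda>"
      by (intro has_sum_add has_sum_cmult_right has_sum_infsum s1 s2 Hs l)
    moreover have "0 \<le> H l m * (a m)\<^sup>2 + (- 2 * t) * (H l m * a m) + t\<^sup>2 * H l m" for m
    proof -
      have "H l m * (a m)\<^sup>2 + (- 2 * t) * (H l m * a m) + t\<^sup>2 * H l m = H l m * (a m - t)\<^sup>2"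
        by (simp add: power2_diff algebra_simps)
      then show ?thesis using H0 by simp
    qed
    ultimately have "0 \<le> (\<Sum>\<^sub>\<infinity>m\<in>\<Lambda>. H l m * (a m)\<^sup>2) + (- 2 * t) * (\<Sum>\<^sub>\<infinity>m\<in>\<Lambda>. H l m * a m) + t\<^sup>2 * wt_sum"
      by (rule has_sum_nonneg)
    also have "\<dots> = (\<Sum>\<^sub>\<infinity>m\<in>\<Lambda>. H l m * (a m)\<^sup>2) - (\<Sum>\<^sub>\<infinity>m\<in>\<Lambda>. H l m * a m)\<^sup>2 / wt_sum"
      using wt_sum_pos by (simp add: t_def power2_eq_square field_simps)
    finally show ?thesis using wt_sum_pos by (simp add: field_simps)
  qed
  \<comment> \<open>Summing over l first gives \<open>wt_sum * (a m)\<^sup>2\<close>, which is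
    summable; since all terms are nonnegative, the order may be exchanged.\<close>
  have prod: "(\<lambda>(m, l). H l m * (a m)\<^sup>2) summable_on \<Lambda> \<times> \<Lambda>"
  proof (rule summable_on_SigmaI)
    fix m assume m: "m \<in> \<Lambda>"
    have "((\<lambda>l. H l m) has_sum wt_sum) \<Lambda>" using Hs[OF m] by (subst Hsym)
    then show "((\<lambda>l. case (m, l) of (m, l) \<Rightarrow> H l m * (a m)\<^sup>2) has_sum wt_sum * (a m)\<^sup>2) \<Lambda>"
      unfolding prod.case by (rule has_sum_cmult_left)
  next
    show "(\<lambda>m. wt_sum * (a m)\<^sup>2) summable_on \<Lambda>" by (intro summable_on_cmult_right a2)
  qed (use H0 in auto)
  then have prod': "(\<lambda>(l, m). H l m * (a m)\<^sup>2) summable_on \<Lambda> \<times> \<Lambda>"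
    by (subst (asm) summable_on_swap) simp
  have sm: "(\<lambda>l. \<Sum>\<^sub>\<infinity>m\<in>\<Lambda>. H l m * (a m)\<^sup>2) summable_on \<Lambda>"
    using summable_on_SigmaD[OF prod'] s2 by simp
  have eq: "(\<Sum>\<^sub>\<infinity>l\<in>\<Lambda>. \<Sum>\<^sub>\<infinity>m\<in>\<Lambda>. H l m * (a m)\<^sup>2) = wt_sum * (\<Sum>\<^sub>\<infinity>m\<in>\<Lambda>. (a m)\<^sup>2)"
  proof -
    have "(\<Sum>\<^sub>\<infinity>l\<in>\<Lambda>. \<Sum>\<^sub>\<infinity>m\<in>\<Lambda>. H l m * (a m)\<^sup>2) = (\<Sum>\<^sub>\<infinity>m\<in>\<Lambda>. \<Sum>\<^sub>\<infinity>l\<in>\<Lambda>. H l m * (a m)\<^sup>2)"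
      by (rule infsum_swap_banach[OF prod'])
    also have "\<dots> = (\<Sum>\<^sub>\<infinity>m\<in>\<Lambda>. wt_sum * (a m)\<^sup>2)"
    proof (rule infsum_cong)
      fix m assume m: "m \<in> \<Lambda>"
      have "((\<lambda>l. H l m) has_sum wt_sum) \<Lambda>" using Hs[OF m] by (subst Hsym)
      then show "(\<Sum>\<^sub>\<infinity>l\<in>\<Lambda>. H l m * (a m)\<^sup>2) = wt_sum * (a m)\<^sup>2"
        by (intro infsumI has_sum_cmult_left)
    qed
    finally show ?thesis by (simp add: infsum_cmult_right')
  qed
  show s: "(\<lambda>l. (\<Sum>\<^sub>\<infinity>m\<in>\<Lambda>. 1 / wt (l - m) ^ K\<^sub>0 * a m)\<^sup>2) summable_on \<Lambda>"
    using summable_on_cmult_right[OF sm, of wt_sum]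
    by (rule summable_on_comparison_test) (use CS in \<open>auto simp: H_def\<close>)
  have "(\<Sum>\<^sub>\<infinity>l\<in>\<Lambda>. (\<Sum>\<^sub>\<infinity>m\<in>\<Lambda>. 1 / wt (l - m) ^ K\<^sub>0 * a m)\<^sup>2) \<le> (\<Sum>\<^sub>\<infinity>l\<in>\<Lambda>. wt_sum * (\<Sum>\<^sub>\<infinity>m\<in>\<Lambda>. H l m * (a m)\<^sup>2))"
    by (rule infsum_mono[OF s summable_on_cmult_right[OF sm]]) (use CS in \<open>auto simp: H_def\<close>)
  also have "\<dots> = wt_sum\<^sup>2 * (\<Sum>\<^sub>\<infinity>m\<in>\<Lambda>. (a m)\<^sup>2)"
    unfolding infsum_cmult_right' eq by (simp add: power2_eq_square)
  finally show "(\<Sum>\<^sub>\<infinity>l\<in>\<Lambda>. (\<Sum>\<^sub>\<infinity>m\<in>\<Lambda>. 1 / wt (l - m) ^ K\<^sub>0 * a m)\<^sup>2) \<le> wt_sum\<^sup>2 * (\<Sum>\<^sub>\<infinity>m\<in>\<Lambda>. (a m)\<^sup>2)" .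
qed

text \<open>Young's inequality with a free parameter: the main term keeps a factor close to 1 and
  the cost falls on the small perturbation.\<close>

lemma l2_add_le:
  assumes c: "rapid c" and d: "rapid d" and t: "t > 0"
  shows "l2 (\<lambda>l. c l + d l) \<le> (1 + t) * l2 c + (1 + 1 / t) * l2 d"
proof (rule has_sum_mono)
  show "((\<lambda>l. (cmod (c l + d l))\<^sup>2) has_sum l2 (\<lambda>l. c l + d l)) \<Lambda>"
    by (intro l2_has_sum rapid_add c d)
  show "((\<lambda>l. (1 + t) * (cmod (c l))\<^sup>2 + (1 + 1 / t) * (cmod (d l))\<^sup>2) has_sum
      ((1 + t) * l2 c + (1 + 1 / t) * l2 d)) \<Lambda>"
    by (intro has_sum_add has_sum_cmult_right l2_has_sum c d)
  fix l
  let ?a = "cmod (c l)" and ?b = "cmod (d l)"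
  have "(cmod (c l + d l))\<^sup>2 \<le> (?a + ?b)\<^sup>2"
    by (intro power_mono norm_triangle_ineq) auto
  also have "\<dots> \<le> (1 + t) * ?a\<^sup>2 + (1 + 1 / t) * ?b\<^sup>2"
  proof -
    have "0 \<le> (t * ?a - ?b)\<^sup>2 / t" using t by simp
    also have "(t * ?a - ?b)\<^sup>2 / t = t * ?a\<^sup>2 + 1 / t * ?b\<^sup>2 - 2 * ?a * ?b"
      using t by (simp add: power2_diff power2_eq_square field_simps)
    finally show ?thesis by (simp add: power2_sum algebra_simps)
  qed
  finally show "(cmod (c l + d l))\<^sup>2 \<le> (1 + t) * ?a\<^sup>2 + (1 + 1 / t) * ?b\<^sup>2" .
qed

text \<open>Conjugating \<open>step\<close> by the slowly varying weight \<open>(1 + e |l|)^K\<close> changes it by an operator of norm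
  \<open>O(e)\<close>, because the Gram matrix of the system decays rapidly off the diagonal.\<close>

lemma weighted_step:
  assumes \<delta>: "\<delta> > 0"
  shows "\<exists>e. 0 < e \<and> e \<le> 1 \<and> (\<forall>c. rapid c \<longrightarrow>
    l2 (\<lambda>l. of_real ((1 + e * norm l) ^ K) * step c l) \<le> (1 + \<delta>) * l2 (\<lambda>l. of_real ((1 + e * norm l) ^ K) * c l))"
proof -
  \<comment> \<open>The exponent K + 1 cancels the loss in \<open>weight_power_diff\<close>; the
    remaining \<open>K\<^sub>0\<close> is the kernel of the Schur test.\<close>
  obtain C where C: "C \<ge> 0"
    "\<And>w z. wt (z - w) ^ (K + 1 + K\<^sub>0) * cmod (L2_inner (tf_shift w \<phi>) (tf_shift z \<phi>)) \<le> C"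
    using L2_inner_tf_shift_decay[OF \<phi> \<phi>, of "K + 1 + K\<^sub>0"] by auto
  define P where "P = (real K * C / B)\<^sup>2 * wt_sum\<^sup>2"
  have P0: "0 \<le> P" by (simp add: P_def)
  \<comment> \<open>The factor of the perturbation in \<open>l2_add_le\<close> for the parameter
    \<delta> / 2. The perturbation has squared norm at most e^2 P times the main one, so e is chosen
    to make e^2 Q at most \<delta> / 2; adding 1 to Q only avoids a division by zero.\<close>
  define Q where "Q = (1 + 1 / (\<delta> / 2)) * P"
  have Q0: "0 \<le> Q" using P0 \<delta> by (simp add: Q_def)
  define e where "e = min 1 (\<delta> / 2 / (Q + 1))"
  have e: "0 < e" "e \<le> 1" using \<delta> Q0 by (auto simp: e_def)
  have eQ: "e\<^sup>2 * Q \<le> \<delta> / 2"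
  proof -
    have "e\<^sup>2 * Q \<le> e * Q"
      using e Q0 by (intro mult_right_mono) (auto simp: power2_eq_square mult_left_le)
    also have "\<dots> \<le> \<delta> / 2 / (Q + 1) * Q" using Q0 by (intro mult_right_mono) (auto simp: e_def)
    also have "\<dots> \<le> \<delta> / 2" using Q0 \<delta> by (simp add: field_simps)
    finally show ?thesis .
  qed
  define w where "w l = (1 + e * norm l) ^ K" for l :: "(real^'n) \<times> (real^'n)"
  have w0: "0 \<le> w l" for l using e by (simp add: w_def)
  have wle: "w l \<le> wt l ^ K" for l
    unfolding w_def wt_def using e by (intro power_mono) (auto simp: mult_left_le_one_le)
  have "l2 (\<lambda>l. of_real (w l) * step c l) \<le> (1 + \<delta>) * l2 (\<lambda>l. of_real (w l) * c l)" if c: "rapid c" for c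
  proof -
    have rw: "rapid (\<lambda>l. of_real (w l) * c' l)" if "rapid c'" for c'
      using that by (rule rapid_mono[where D = 1 and k = K])
        (use wle w0 in \<open>auto simp: norm_mult intro!: mult_right_mono\<close>)
    define d where "d l = of_real (w l) * c l" for l
    have d: "rapid d" unfolding d_def by (intro rw c)
    \<comment> \<open>The commutator of the Gram operator with the weight, divided by B. Its kernel
      is the Gram matrix times the differences \<open>w m - w l\<close>.\<close>
    define q where "q l = of_real (1 / B) * (analysis (synthesis d) l - of_real (w l) * analysis (synthesis c) l)" for l
    have q: "rapid q" unfolding q_def
      by (intro rapid_cmult rapid_diff rapid_analysis_synthesis rw c d)
    have dec: "(\<lambda>l. of_real (w l) * step c l) = (\<lambda>l. step d l + q l)"
      by (rule ext) (simp add: step_def q_def d_def algebra_simps)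
    let ?G = "\<lambda>m l. L2_inner (tf_shift m \<phi>) (tf_shift l \<phi>)"
    let ?k = "real K * e * C / B"
    have k0: "0 \<le> ?k" using e C(1) B_pos by simp
    have d1: "(\<lambda>m. cmod (d m)) summable_on \<Lambda>" by (rule rapid_abs_summable[OF d])
    have d2: "(\<lambda>m. (cmod (d m))\<^sup>2) summable_on \<Lambda>" using rapid_sq_summable[OF d, of 0] by simp
    have ql: "cmod (q l) \<le> ?k * (\<Sum>\<^sub>\<infinity>m\<in>\<Lambda>. 1 / wt (l - m) ^ K\<^sub>0 * cmod (d m))" for l
    proof -
      have "((\<lambda>m. of_real (1 / B) * (d m * ?G m l - of_real (w l) * (c m * ?G m l))) has_sum q l) \<Lambda>"
        unfolding q_def diff_conv_add_uminus
        by (intro has_sum_cmult_right has_sum_add has_sum_uminusI analysis_synthesis c d)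
      moreover have s: "(\<lambda>m. 1 / wt (l - m) ^ K\<^sub>0 * cmod (d m)) summable_on \<Lambda>"
        using d1 by (rule summable_on_comparison_test) (auto simp: divide_le_eq mult_le_cancel_left1)
      then have "((\<lambda>m. ?k * (1 / wt (l - m) ^ K\<^sub>0 * cmod (d m))) has_sum
          (?k * (\<Sum>\<^sub>\<infinity>m\<in>\<Lambda>. 1 / wt (l - m) ^ K\<^sub>0 * cmod (d m)))) \<Lambda>"
        by (intro has_sum_cmult_right) simp
      ultimately show ?thesis
      proof (rule norm_infsum_le)
        fix m
        let ?v = "wt (l - m)"
        have "of_real (1 / B) * (d m * ?G m l - of_real (w l) * (c m * ?G m l))
          = of_real ((w m - w l) / B) * (c m * ?G m l)"
          by (simp add: d_def algebra_simps diff_divide_distrib)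
        then have "cmod (of_real (1 / B) * (d m * ?G m l - of_real (w l) * (c m * ?G m l)))
          = \<bar>w m - w l\<bar> / B * (cmod (c m) * cmod (?G m l))"
          using B_pos by (simp only: norm_mult norm_of_real abs_divide abs_of_pos)
        also have "\<dots> \<le> (real K * e * ?v ^ (K + 1) * w m) / B * (cmod (c m) * (C / ?v ^ (K + 1 + K\<^sub>0)))"
        proof (intro mult_mono divide_right_mono mult_left_mono)
          show "\<bar>w m - w l\<bar> \<le> real K * e * ?v ^ (K + 1) * w m"
            unfolding w_def by (rule weight_power_diff) (use e in auto)
          show "cmod (?G m l) \<le> C / ?v ^ (K + 1 + K\<^sub>0)"
            using C(2)[of l m] by (simp add: pos_le_divide_eq mult.commute)
        qed (use B_pos e w0 in auto)
        also have "\<dots> = ?k * (1 / ?v ^ K\<^sub>0 * cmod (d m))"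
          using w0[of m] by (simp add: d_def norm_mult power_add field_simps)
        finally show "cmod (of_real (1 / B) * (d m * ?G m l - of_real (w l) * (c m * ?G m l)))
          \<le> ?k * (1 / ?v ^ K\<^sub>0 * cmod (d m))" .
      qed
    qed
    note sb = schur_bound[OF norm_ge_zero d1 d2]
    have "l2 q \<le> (\<Sum>\<^sub>\<infinity>l\<in>\<Lambda>. ?k\<^sup>2 * (\<Sum>\<^sub>\<infinity>m\<in>\<Lambda>. 1 / wt (l - m) ^ K\<^sub>0 * cmod (d m))\<^sup>2)"
      unfolding l2_def
    proof (rule infsum_mono)
      show "(\<lambda>l. (cmod (q l))\<^sup>2) summable_on \<Lambda>" using rapid_sq_summable[OF q, of 0] by simp
      show "(\<lambda>l. ?k\<^sup>2 * (\<Sum>\<^sub>\<infinity>m\<in>\<Lambda>. 1 / wt (l - m) ^ K\<^sub>0 * cmod (d m))\<^sup>2) summable_on \<Lambda>"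
        by (intro summable_on_cmult_right sb)
      show "(cmod (q l))\<^sup>2 \<le> ?k\<^sup>2 * (\<Sum>\<^sub>\<infinity>m\<in>\<Lambda>. 1 / wt (l - m) ^ K\<^sub>0 * cmod (d m))\<^sup>2" for l
        unfolding power_mult_distrib[symmetric] by (intro power_mono ql) simp
    qed
    also have "\<dots> \<le> ?k\<^sup>2 * (wt_sum\<^sup>2 * l2 d)"
      unfolding infsum_cmult_right' l2_def by (intro mult_left_mono sb) simp
    also have "\<dots> = e\<^sup>2 * P * l2 d"
      by (simp add: P_def power2_eq_square)
    finally have lq: "l2 q \<le> e\<^sup>2 * P * l2 d" .
    have "l2 (\<lambda>l. step d l + q l) \<le> (1 + \<delta> / 2) * l2 (step d) + (1 + 1 / (\<delta> / 2)) * l2 q"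
      using \<delta> by (intro l2_add_le rapid_step d q) auto
    also have "\<dots> \<le> (1 + \<delta> / 2) * l2 d + (1 + 1 / (\<delta> / 2)) * (e\<^sup>2 * P * l2 d)"
      using \<delta> by (intro add_mono mult_left_mono l2_step_le d lq) auto
    also have "\<dots> = (1 + \<delta> / 2) * l2 d + (e\<^sup>2 * Q) * l2 d"
      by (simp add: Q_def mult_ac)
    also have "\<dots> \<le> (1 + \<delta> / 2) * l2 d + \<delta> / 2 * l2 d"
      by (intro add_left_mono mult_right_mono eQ l2_nonneg)
    also have "\<dots> = (1 + \<delta>) * l2 d" by (simp add: algebra_simps)
    finally show ?thesis unfolding dec d_def .
  qed
  then show ?thesis using e unfolding w_def by blast
qed

section \<open>Residuals of the frame iteration and the rapid decay of their coefficients\<close>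

primrec residual :: "(real^'n \<Rightarrow> complex) \<Rightarrow> nat \<Rightarrow> real^'n \<Rightarrow> complex" where
  "residual g 0 = g"
| "residual g (Suc n) = (\<lambda>y. residual g n y - of_real (1 / B) * synthesis (analysis (residual g n)) y)"

lemma residual_props:
  assumes g: "g \<in> schwartz_space"
  shows "tame (residual g n)" "rapid (analysis (residual g n))"
    "analysis (residual g (Suc n)) = step (analysis (residual g n))"
    "sq_norm (residual g n) \<le> (1 - A / B) ^ n * sq_norm g"
proof -
  have *: "tame (residual g n) \<and> rapid (analysis (residual g n))" for n
  proof (induction n)
    case 0
    then show ?case using g by (simp add: schwartz_tame rapid_analysis)
  next
    case (Suc n)
    then have t: "tame (residual g n)" and r: "rapid (analysis (residual g n))" by auto
    note ts = tame_cmult[OF synthesis_props(1)[OF r]]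
    have "analysis (residual g (Suc n)) = step (analysis (residual g n))"
      by (rule ext) (simp only: residual.simps analysis_def[of _ l for l] step_def
          L2_inner_diff_left[OF t ts tame_tf_shift] L2_inner_cmult_left)
    moreover have "tame (residual g (Suc n))" unfolding residual.simps by (intro tame_diff t ts)
    ultimately show ?case using rapid_step[OF r] by simp
  qed
  show t: "tame (residual g n)" and r: "rapid (analysis (residual g n))" for n using * by auto
  show "analysis (residual g (Suc n)) = step (analysis (residual g n))"
    by (rule ext) (simp only: residual.simps analysis_def[of _ l for l] step_def
        L2_inner_diff_left[OF t tame_cmult[OF synthesis_props(1)[OF r]] tame_tf_shift] L2_inner_cmult_left)
  show "sq_norm (residual g n) \<le> (1 - A / B) ^ n * sq_norm g"
  proof (induction n)
    case (Suc n)
    have "sq_norm (residual g (Suc n)) \<le> (1 - A / B) * sq_norm (residual g n)"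
      unfolding residual.simps by (rule sq_norm_step_le[OF t r])
    also have "\<dots> \<le> (1 - A / B) * ((1 - A / B) ^ n * sq_norm g)"
      using AB by (intro mult_left_mono Suc.IH) (auto simp: field_simps)
    finally show ?case by simp
  qed simp
qed

text \<open>Interpolation between geometric decay in l^2 and slow growth in weighted l^2. One \<rho>
  serves all K because \<delta> depends only on A / B; the dependence of e on K affects the constant
  alone.\<close>

lemma residual_decay:
  assumes g: "g \<in> schwartz_space"
  shows "\<exists>\<rho>. 0 < \<rho> \<and> \<rho> < 1 \<and>
    (\<forall>K. \<exists>C\<ge>0. \<forall>n. \<forall>l\<in>\<Lambda>. wt l ^ K * cmod (analysis (residual g n) l) \<le> C * \<rho> ^ n)"
proof -
  define r where "r = 1 - A / B"
  have r: "0 \<le> r" "r < 1" using AB by (auto simp: r_def field_simps)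
  define s where "s = (1 + r) / 2"
  have s: "0 < s" "s < 1" using r by (auto simp: s_def)
  \<comment> \<open>With this value r (1 + \<delta>) is at most r + \<delta> = (1 + r) / 2 = s,
    still below 1.\<close>
  define \<delta> where "\<delta> = (1 - r) / 2"
  have \<delta>: "0 < \<delta>" using r by (simp add: \<delta>_def)
  have rs: "r * (1 + \<delta>) \<le> s"
  proof -
    have "r * \<delta> \<le> \<delta>" using r \<delta> by (intro mult_left_le_one_le) auto
    then show ?thesis by (simp add: distrib_left) (simp add: \<delta>_def s_def field_simps)
  qed
  \<comment> \<open>Two bounds on squares are multiplied below, so a fourth root has to be
    taken.\<close>
  define \<rho> where "\<rho> = root 4 s"
  have \<rho>: "0 < \<rho>" "\<rho> < 1" "\<rho> ^ 4 = s" using s by (auto simp: \<rho>_def)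
  let ?b = "\<lambda>n. analysis (residual g n)"
  note R = residual_props[OF g]
  have "\<exists>C\<ge>0. \<forall>n. \<forall>l\<in>\<Lambda>. wt l ^ K * cmod (?b n l) \<le> C * \<rho> ^ n" for K
  proof -
    \<comment> \<open>The weight is taken to the power 2 K because pairing it with an unweighted
      bound halves the exponent.\<close>
    obtain e where e: "0 < e" "e \<le> 1" and step: "\<And>c. rapid c \<Longrightarrow>
      l2 (\<lambda>l. of_real ((1 + e * norm l) ^ (2 * K)) * step c l)
        \<le> (1 + \<delta>) * l2 (\<lambda>l. of_real ((1 + e * norm l) ^ (2 * K)) * c l)"
      using weighted_step[OF \<delta>, of "2 * K"] by auto
    define w where "w l = (1 + e * norm l) ^ (2 * K)" for l :: "(real^'n) \<times> (real^'n)"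
    have w0: "0 \<le> w l" for l using e by (simp add: w_def)
    have wle: "w l \<le> wt l ^ (2 * K)" for l
      unfolding w_def wt_def using e by (intro power_mono) (auto simp: mult_left_le_one_le)
    have rw: "rapid (\<lambda>l. of_real (w l) * c l)" if "rapid c" for c
      using that by (rule rapid_mono[where D = 1 and k = "2 * K"])
        (use wle w0 in \<open>auto simp: norm_mult intro!: mult_right_mono\<close>)
    define P where "P n = l2 (\<lambda>l. of_real (w l) * ?b n l)" for n
    have P: "P n \<le> (1 + \<delta>) ^ n * P 0" for n
    proof (induction n)
      case (Suc n)
      have "P (Suc n) \<le> (1 + \<delta>) * P n"
        unfolding P_def R(3) w_def by (rule step[OF R(2)])
      also have "\<dots> \<le> (1 + \<delta>) * ((1 + \<delta>) ^ n * P 0)"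
        using \<delta> by (intro mult_left_mono Suc.IH) auto
      finally show ?case by simp
    qed simp
    have le_l2: "(cmod (c l))\<^sup>2 \<le> l2 c" if "rapid c" "l \<in> \<Lambda>" for c l
      using finite_sum_le_has_sum[OF l2_has_sum[OF that(1)], of "{l}"] that(2) by simp
    define M where "M = B * sq_norm g * P 0"
    have M0: "0 \<le> M" unfolding M_def P_def using B_pos by (intro mult_nonneg_nonneg sq_norm_nonneg l2_nonneg) auto
    have main: "(e * wt l) ^ K * cmod (?b n l) \<le> (1 + M) * \<rho> ^ n" if l: "l \<in> \<Lambda>" for n l
    proof (rule power_le_imp_le_base)
      let ?x = "cmod (?b n l)"
      have x2: "?x\<^sup>2 \<le> B * (r ^ n * sq_norm g)"
      proof -
        have "?x\<^sup>2 \<le> l2 (?b n)" by (rule le_l2[OF R(2) l])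
        also have "\<dots> \<le> B * sq_norm (residual g n)" by (rule l2_analysis_bounds[OF R(1)])
        also have "\<dots> \<le> B * (r ^ n * sq_norm g)"
          using B_pos R(4)[of n] by (intro mult_left_mono) (auto simp: r_def)
        finally show ?thesis .
      qed
      have wx2: "(w l * ?x)\<^sup>2 \<le> (1 + \<delta>) ^ n * P 0"
      proof -
        have "(w l * ?x)\<^sup>2 \<le> P n"
          using le_l2[OF rw[OF R(2)] l, of n] w0[of l] by (simp add: P_def norm_mult)
        then show ?thesis using P order_trans by blast
      qed
      \<comment> \<open>The fourth power splits into a weighted square, which grows at most like (1
        + \<delta>)^n, and a plain square, which decays like r^n.\<close>
      have "((e * wt l) ^ K * ?x) ^ Suc 3 = ((e * wt l) ^ (2 * K) * ?x)\<^sup>2 * ?x\<^sup>2"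
        by (simp add: power_mult_distrib eval_nat_numeral power_add mult_ac flip: power_mult)
      also have "\<dots> \<le> (w l * ?x)\<^sup>2 * ?x\<^sup>2"
      proof (intro mult_right_mono power_mono)
        \<comment> \<open>Here e (1 + |l|) is at most 1 + e |l| because e \<le> 1, which returns
          from the slow weight to \<open>wt\<close>.\<close>
        show "(e * wt l) ^ (2 * K) \<le> w l"
          unfolding w_def using e by (intro power_mono) (auto simp: wt_def distrib_left)
      qed (use e in auto)
      also have "\<dots> \<le> ((1 + \<delta>) ^ n * P 0) * (B * (r ^ n * sq_norm g))"
        using \<delta> by (intro mult_mono x2 wx2 mult_nonneg_nonneg) (auto simp: P_def l2_nonneg)
      also have "\<dots> = M * (r * (1 + \<delta>)) ^ n"
        by (simp add: M_def power_mult_distrib mult_ac)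
      \<comment> \<open>Enlarging M to (1 + M)^4 makes the right side a fourth power, so that roots
        can be compared directly.\<close>
      also have "\<dots> \<le> (1 + M) ^ Suc 3 * s ^ n"
      proof (intro mult_mono power_mono rs)
        show "M \<le> (1 + M) ^ Suc 3"
          using self_le_power[of "1 + M" "Suc 3"] M0 by simp
      qed (use M0 r \<delta> in auto)
      also have "\<dots> = ((1 + M) * \<rho> ^ n) ^ Suc 3"
        unfolding \<rho>(3)[symmetric] by (simp add: power_mult_distrib mult.commute flip: power_mult)
      finally show "((e * wt l) ^ K * ?x) ^ Suc 3 \<le> ((1 + M) * \<rho> ^ n) ^ Suc 3" .
    qed (use M0 \<rho> in auto)
    have "wt l ^ K * cmod (?b n l) \<le> (1 + M) / e ^ K * \<rho> ^ n" if "l \<in> \<Lambda>" for n l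
      using main[OF that, of n] e by (simp add: power_mult_distrib field_simps)
    then show ?thesis using M0 e by (intro exI[of _ "(1 + M) / e ^ K"]) auto
  qed
  then show ?thesis using \<rho> by blast
qed

section \<open>Summing the iteration to a Gabor expansion\<close>

lemma synthesis_has_sum:
  "rapid c \<Longrightarrow> ((\<lambda>l. c l * tf_shift l \<phi> y) has_sum synthesis c y) \<Lambda>"
  unfolding synthesis_def using synthesis_summable[of c y] by (simp add: abs_summable_summable)

lemma synthesis_cmult: "synthesis (\<lambda>l. a * c l) y = a * synthesis c y"
  unfolding synthesis_def by (simp add: mult.assoc infsum_cmult_right')

lemma synthesis_add: "rapid c \<Longrightarrow> rapid d \<Longrightarrow> synthesis (\<lambda>l. c l + d l) y = synthesis c y + synthesis d y"
  using has_sum_add[OF synthesis_has_sum synthesis_has_sum, of c d y y]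
  unfolding synthesis_def[of "\<lambda>l. c l + d l"] distrib_right by (auto intro: infsumI)

lemma synthesis_diff: "rapid c \<Longrightarrow> rapid d \<Longrightarrow> synthesis (\<lambda>l. c l - d l) y = synthesis c y - synthesis d y"
  using synthesis_add[of c "\<lambda>l. (-1) * d l" y] rapid_cmult[of d "-1"] synthesis_cmult[of "-1" d y] by simp

text \<open>The coefficients are 1 / B times the sum of the coefficients of all residuals, the
  Neumann series for the inverse frame operator. That they synthesize g is checked in L^2, and
  continuity makes the identity pointwise.\<close>

theorem schwartz_expansion:
  assumes g: "g \<in> schwartz_space"
  shows "\<exists>c. rapid c \<and> synthesis c = g"
proof -
  let ?b = "\<lambda>n. analysis (residual g n)"
  note R = residual_props[OF g]
  obtain \<rho> where \<rho>: "0 < \<rho>" "\<rho> < 1"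
    and dec: "\<And>K. \<exists>C\<ge>0. \<forall>n. \<forall>l\<in>\<Lambda>. wt l ^ K * cmod (?b n l) \<le> C * \<rho> ^ n"
    using residual_decay[OF g] by blast
  define part where "part n l = of_real (1 / B) * (\<Sum>j<n. ?b j l)" for n l
  define c where "c l = of_real (1 / B) * (\<Sum>j. ?b j l)" for l
  \<comment> \<open>The iteration telescopes: each step subtracts exactly the synthesis of the
    coefficients that \<open>part\<close> gains.\<close>
  have part: "rapid (part n) \<and> (\<forall>y. synthesis (part n) y = g y - residual g n y)" for n
  proof (induction n)
    case 0
    then show ?case by (simp add: part_def rapid_zero synthesis_def)
  next
    case (Suc n)
    have eq: "part (Suc n) = (\<lambda>l. part n l + of_real (1 / B) * ?b n l)"
      by (rule ext) (simp add: part_def algebra_simps)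
    have r: "rapid (\<lambda>l. of_real (1 / B) * ?b n l)" by (intro rapid_cmult R)
    then have "rapid (part (Suc n))" unfolding eq using Suc.IH by (intro rapid_add) auto
    moreover have "synthesis (part (Suc n)) y = g y - residual g (Suc n) y" for y
      unfolding eq using Suc.IH by (simp only: synthesis_add[OF _ r] synthesis_cmult residual.simps) simp
    ultimately show ?case by blast
  qed
  \<comment> \<open>The remainder is 1 / B times the coefficient sum from n on, a geometric series
    for every weight. The case n = 0 gives rapid decay of c itself.\<close>
  have tail: "\<exists>D\<ge>0. \<forall>n. \<forall>l\<in>\<Lambda>. wt l ^ K * cmod (c l - part n l) \<le> D * \<rho> ^ n" for K
  proof -
    obtain C where C: "C \<ge> 0" "\<And>n l. l \<in> \<Lambda> \<Longrightarrow> wt l ^ K * cmod (?b n l) \<le> C * \<rho> ^ n"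
      using dec[of K] by blast
    define D where "D = C / (1 - \<rho>) / B"
    have "wt l ^ K * cmod (c l - part n l) \<le> D * \<rho> ^ n" if l: "l \<in> \<Lambda>" for n l
    proof -
      let ?M = "\<lambda>j. C / wt l ^ K * \<rho> ^ j"
      have M: "summable ?M" using \<rho> by (intro summable_mult summable_geometric) auto
      have b: "cmod (?b j l) \<le> ?M j" for j
        using C(2)[OF l, of j] by (simp add: pos_le_divide_eq mult.commute)
      have "c l - part n l = of_real (1 / B) * ((\<Sum>j. ?b j l) - (\<Sum>j<n. ?b j l))"
        by (simp only: c_def part_def right_diff_distrib)
      then have "cmod (c l - part n l) = 1 / B * cmod ((\<Sum>j. ?b j l) - (\<Sum>j<n. ?b j l))"
        using B_pos by (simp only: norm_mult norm_of_real) simp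
      also have "\<dots> \<le> 1 / B * (\<Sum>j. ?M (j + n))"
        using B_pos by (intro mult_left_mono norm_suminf_minus_le(2)[OF M b]) auto
      also have "(\<Sum>j. ?M (j + n)) = C / wt l ^ K * \<rho> ^ n * (1 / (1 - \<rho>))"
      proof -
        have "(\<lambda>j. C / wt l ^ K * \<rho> ^ n * \<rho> ^ j) sums (C / wt l ^ K * \<rho> ^ n * (1 / (1 - \<rho>)))"
          using \<rho> by (intro sums_mult geometric_sums) auto
        then show ?thesis by (simp add: power_add mult_ac sums_iff)
      qed
      finally have "cmod (c l - part n l) \<le> D * \<rho> ^ n / wt l ^ K"
        by (simp add: D_def mult_ac)
      then show ?thesis by (simp add: pos_le_divide_eq mult.commute)
    qed
    moreover have "0 \<le> D" using C(1) \<rho> B_pos by (simp add: D_def)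
    ultimately show ?thesis by blast
  qed
  have c: "rapid c"
    unfolding rapid_def
  proof
    fix K
    obtain D where "D \<ge> 0" "\<And>n l. l \<in> \<Lambda> \<Longrightarrow> wt l ^ K * cmod (c l - part n l) \<le> D * \<rho> ^ n"
      using tail[of K] by blast
    from this(1) this(2)[of _ 0] show "\<exists>C\<ge>0. \<forall>l\<in>\<Lambda>. wt l ^ K * cmod (c l) \<le> C"
      by (auto simp: part_def)
  qed
  define f where "f y = g y - synthesis c y" for y
  have f: "tame f" unfolding f_def by (intro tame_diff schwartz_tame g synthesis_props c)
  \<comment> \<open>The weight exponent \<open>K\<^sub>0\<close> makes this pointwise bound square
    summable over the lattice, so that c - \<open>part n\<close> tends to zero in l^2.\<close>
  obtain D where D: "D \<ge> 0" "\<And>n l. l \<in> \<Lambda> \<Longrightarrow> wt l ^ K\<^sub>0 * cmod (c l - part n l) \<le> D * \<rho> ^ n"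
    using tail[of "K\<^sub>0"] by blast
  define r where "r = 1 - A / B"
  have r: "0 \<le> r" "r < 1" using AB by (auto simp: r_def field_simps)
  have bound: "sq_norm f \<le> 2 * (r ^ n * sq_norm g) + 2 * (B * (D\<^sup>2 * wt_sum * (\<rho>\<^sup>2) ^ n))" for n
  proof -
    define t where "t l = part n l - c l" for l
    have t: "rapid t" unfolding t_def using part c by (intro rapid_diff) auto
    \<comment> \<open>The error of the limit is split into the n-th residual and the synthesis of
      the missing coefficients; both have L^2 norms that decay geometrically.\<close>
    have "f = (\<lambda>y. residual g n y + synthesis t y)"
      using part[of n] unfolding f_def t_def by (auto simp: synthesis_diff[OF _ c])
    then have "sq_norm f \<le> 2 * sq_norm (residual g n) + 2 * sq_norm (synthesis t)"
      by (simp add: sq_norm_add_le R(1) synthesis_props t)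
    also have "\<dots> \<le> 2 * (r ^ n * sq_norm g) + 2 * (B * l2 t)"
      using R(4)[of n] by (intro add_mono mult_left_mono sq_norm_synthesis_le t) (auto simp: r_def)
    also have "l2 t \<le> D\<^sup>2 * wt_sum * (\<rho>\<^sup>2) ^ n"
    proof -
      have "((\<lambda>l. D\<^sup>2 * (\<rho>\<^sup>2) ^ n * (1 / wt l ^ K\<^sub>0)) has_sum (D\<^sup>2 * (\<rho>\<^sup>2) ^ n * wt_sum)) \<Lambda>"
        unfolding wt_sum_def using summable_wt by (intro has_sum_cmult_right) simp
      moreover have "(cmod (t l))\<^sup>2 \<le> D\<^sup>2 * (\<rho>\<^sup>2) ^ n * (1 / wt l ^ K\<^sub>0)" if l: "l \<in> \<Lambda>" for l
      proof -
        have "cmod (t l) \<le> D * \<rho> ^ n * (1 / wt l ^ K\<^sub>0)"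
          using D(2)[OF l, of n] by (simp add: t_def norm_minus_commute pos_le_divide_eq mult.commute)
        then have "(cmod (t l))\<^sup>2 \<le> (D * \<rho> ^ n * (1 / wt l ^ K\<^sub>0))\<^sup>2"
          by (rule power_mono) simp
        also have "\<dots> = D\<^sup>2 * (\<rho>\<^sup>2) ^ n * (1 / wt l ^ K\<^sub>0)\<^sup>2"
          unfolding power_mult_distrib by (simp add: mult.commute flip: power_mult)
        also have "\<dots> \<le> D\<^sup>2 * (\<rho>\<^sup>2) ^ n * (1 / wt l ^ K\<^sub>0)"
          by (intro mult_left_mono) (auto simp: power2_eq_square divide_le_eq mult_le_cancel_left1)
        finally show ?thesis .
      qed
      ultimately have "l2 t \<le> D\<^sup>2 * (\<rho>\<^sup>2) ^ n * wt_sum"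
        by (rule has_sum_mono[OF l2_has_sum[OF t]])
      then show ?thesis by (simp add: mult_ac)
    qed
    finally show ?thesis using B_pos by simp
  qed
  have "\<rho>\<^sup>2 < 1" using \<rho> by (simp add: power_less_one_iff)
  then have "(\<lambda>n. 2 * (r ^ n * sq_norm g) + 2 * (B * (D\<^sup>2 * wt_sum * (\<rho>\<^sup>2) ^ n)))
      \<longlonglongrightarrow> 2 * (0 * sq_norm g) + 2 * (B * (D\<^sup>2 * wt_sum * 0))"
    using r by (intro tendsto_intros LIMSEQ_realpow_zero) auto
  then have "sq_norm f \<le> 2 * (0 * sq_norm g) + 2 * (B * (D\<^sup>2 * wt_sum * 0))"
    by (rule LIMSEQ_le_const) (use bound in auto)
  then have "sq_norm f = 0" using sq_norm_nonneg[of f] by simp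
  then have "f y = 0" for y by (rule sq_norm_eq_0_imp[OF f])
  then have "synthesis c = g" by (auto simp: f_def)
  then show ?thesis using c by blast
qed

end

section \<open>Lattices and wave front sets\<close>

lemma tf_lattice_iff:
  "a \<in> tf_lattice \<alpha> \<beta> \<longleftrightarrow> (\<exists>j k. \<forall>i. fst a $ i = \<alpha> * of_int (j i) \<and> snd a $ i = \<beta> * of_int (k i))"
  by (cases a) (auto simp: tf_lattice_def vec_eq_iff)

lemma tf_lattice_closed:
  assumes "a \<in> tf_lattice \<alpha> \<beta>" "b \<in> tf_lattice \<alpha> \<beta>"
  shows "a - b \<in> tf_lattice \<alpha> \<beta>" "a + b \<in> tf_lattice \<alpha> \<beta>"
proof -
  obtain j k j' k' where a: "\<And>i. fst a $ i = \<alpha> * of_int (j i)" "\<And>i. snd a $ i = \<beta> * of_int (k i)"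
    and b: "\<And>i. fst b $ i = \<alpha> * of_int (j' i)" "\<And>i. snd b $ i = \<beta> * of_int (k' i)"
    using assms unfolding tf_lattice_iff by meson
  show "a - b \<in> tf_lattice \<alpha> \<beta>"
    unfolding tf_lattice_iff
    by (rule exI[of _ "\<lambda>i. j i - j' i"], rule exI[of _ "\<lambda>i. k i - k' i"]) (simp add: a b right_diff_distrib)
  show "a + b \<in> tf_lattice \<alpha> \<beta>"
    unfolding tf_lattice_iff
    by (rule exI[of _ "\<lambda>i. j i + j' i"], rule exI[of _ "\<lambda>i. k i + k' i"]) (simp add: a b distrib_left)
qed

lemma infinite_tf_lattice:
  assumes "\<alpha> > 0" shows "infinite (tf_lattice \<alpha> \<beta> :: ((real^'n::finite) \<times> (real^'n)) set)"
proof -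
  let ?f = "\<lambda>m::nat. ((\<chi> i. \<alpha> * real m) :: real^'n, 0 :: real^'n)"
  have "inj ?f" using assms by (auto simp: inj_def vec_eq_iff)
  then have "infinite (range ?f)" by (rule range_inj_infinite)
  moreover have "range ?f \<subseteq> tf_lattice \<alpha> \<beta>"
  proof
    fix a assume "a \<in> range ?f"
    then obtain m where "a = ?f m" by blast
    then show "a \<in> tf_lattice \<alpha> \<beta>"
      unfolding tf_lattice_iff
      by (intro exI[of _ "\<lambda>_. int m"] exI[of _ "\<lambda>_. 0"]) simp
  qed
  ultimately show ?thesis using finite_subset by blast
qed

lemma tf_lattice_separated:
  fixes a b :: "(real^'n::finite) \<times> (real^'n)"
  assumes \<alpha>: "\<alpha> > 0" and \<beta>: "\<beta> > 0" and a: "a \<in> tf_lattice \<alpha> \<beta>" and b: "b \<in> tf_lattice \<alpha> \<beta>" and "a \<noteq> b"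
  shows "min \<alpha> \<beta> \<le> dist a b"
proof -
  obtain j k where jk: "\<And>i. fst (a - b) $ i = \<alpha> * of_int (j i)" "\<And>i. snd (a - b) $ i = \<beta> * of_int (k i)"
    using tf_lattice_closed(1)[OF a b] unfolding tf_lattice_iff by meson
  have int1: "t \<le> \<bar>t * real_of_int m\<bar>" if "t > 0" "t * real_of_int m \<noteq> 0" for t m
  proof -
    have "1 \<le> \<bar>m\<bar>" using that(2) by (cases "m = 0") auto
    then have "1 \<le> \<bar>real_of_int m\<bar>" by linarith
    then show ?thesis using that(1) by (simp add: abs_mult)
  qed
  have "a - b \<noteq> 0" using \<open>a \<noteq> b\<close> by simp
  then consider i where "fst (a - b) $ i \<noteq> 0" | i where "snd (a - b) $ i \<noteq> 0"
    by (metis prod.collapse vec_eq_iff zero_index zero_prod_def)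
  then show ?thesis
  proof cases
    case 1
    then have "\<alpha> \<le> \<bar>fst (a - b) $ i\<bar>" using int1[OF \<alpha>] unfolding jk by blast
    also have "\<dots> \<le> norm (fst (a - b))" by (rule component_le_norm_cart)
    also have "\<dots> \<le> norm (a - b)" using norm_fst_le[of "fst (a - b)" "snd (a - b)"] by (simp only: prod.collapse)
    finally show ?thesis by (simp add: dist_norm)
  next
    case 2
    then have "\<beta> \<le> \<bar>snd (a - b) $ i\<bar>" using int1[OF \<beta>] unfolding jk by blast
    also have "\<dots> \<le> norm (snd (a - b))" by (rule component_le_norm_cart)
    also have "\<dots> \<le> norm (a - b)" using norm_snd_le[of "snd (a - b)" "fst (a - b)"] by (simp only: prod.collapse)
    finally show ?thesis by (simp add: dist_norm)
  qed
qed

lemma gabor_system_tf_lattice: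
  fixes \<phi> :: "real^'n::finite \<Rightarrow> complex"
  assumes \<phi>: "\<phi> \<in> schwartz_space" and \<alpha>: "\<alpha> > 0" and \<beta>: "\<beta> > 0"
    and frame: "gabor_frame \<phi> (tf_lattice \<alpha> \<beta>)"
  shows "\<exists>A B. gabor_system \<phi> (tf_lattice \<alpha> \<beta>) (DIM((real^'n) \<times> (real^'n)) + 2) A B"
proof -
  obtain A B where A: "A > 0" and B: "B > 0" and AB: "\<And>f. square_integrable f \<Longrightarrow>
     (\<lambda>l. (cmod (L2_inner f (tf_shift l \<phi>)))\<^sup>2) summable_on tf_lattice \<alpha> \<beta> \<and>
     A * (LINT y|lborel. (cmod (f y))\<^sup>2) \<le> (\<Sum>\<^sub>\<infinity>l\<in>tf_lattice \<alpha> \<beta>. (cmod (L2_inner f (tf_shift l \<phi>)))\<^sup>2) \<and>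
     (\<Sum>\<^sub>\<infinity>l\<in>tf_lattice \<alpha> \<beta>. (cmod (L2_inner f (tf_shift l \<phi>)))\<^sup>2) \<le> B * (LINT y|lborel. (cmod (f y))\<^sup>2)"
    using frame unfolding gabor_frame_def by blast
  have sq: "square_integrable f" if "tame f" for f :: "real^'n \<Rightarrow> complex"
    unfolding square_integrable_def using tameD(4)[OF that] tame_sq_integrable[OF that] by simp
  \<comment> \<open>The frame definition does not order its two constants; enlarging the upper one
    to the maximum supplies A \<le> B.\<close>
  have "gabor_system \<phi> (tf_lattice \<alpha> \<beta>) (DIM((real^'n) \<times> (real^'n)) + 2) A (max A B)"
  proof
    fix f :: "real^'n \<Rightarrow> complex" assume f: "tame f"
    show "(\<lambda>l. (cmod (L2_inner f (tf_shift l \<phi>)))\<^sup>2) summable_on tf_lattice \<alpha> \<beta>"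
      and "A * sq_norm f \<le> (\<Sum>\<^sub>\<infinity>l\<in>tf_lattice \<alpha> \<beta>. (cmod (L2_inner f (tf_shift l \<phi>)))\<^sup>2)"
      using AB[OF sq[OF f]] by (auto simp: sq_norm_def)
    have "(\<Sum>\<^sub>\<infinity>l\<in>tf_lattice \<alpha> \<beta>. (cmod (L2_inner f (tf_shift l \<phi>)))\<^sup>2) \<le> B * sq_norm f"
      using AB[OF sq[OF f]] by (auto simp: sq_norm_def)
    also have "\<dots> \<le> max A B * sq_norm f"
      by (intro mult_right_mono sq_norm_nonneg) simp
    finally show "(\<Sum>\<^sub>\<infinity>l\<in>tf_lattice \<alpha> \<beta>. (cmod (L2_inner f (tf_shift l \<phi>)))\<^sup>2) \<le> max A B * sq_norm f" .
  next
    show "(\<lambda>l :: (real^'n) \<times> (real^'n). 1 / wt l ^ (DIM((real^'n) \<times> (real^'n)) + 2)) summable_on tf_lattice \<alpha> \<beta>"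
      by (rule summable_on_wt[where d = "min \<alpha> \<beta>"])
        (use \<alpha> \<beta> tf_lattice_separated[OF \<alpha> \<beta>] in auto)
  qed (use \<phi> \<alpha> A infinite_tf_lattice tf_lattice_closed in auto)
  then show ?thesis by blast
qed

text \<open>Applied to \<Pi>(l)g2, the expansion bounds the transform at l by values at l + v with
  coefficients rapidly decreasing in v. If v is small relative to l, the point l + v stays in the
  larger cone; otherwise powers of l are bounded by powers of v, which the coefficients
  absorb.\<close>

lemma gabor_WF_subset:
  fixes g1 g2 :: "real^'n::finite \<Rightarrow> complex"
  assumes u: "u \<in> tempered_distributions" and g1: "g1 \<in> schwartz_space" and g2: "g2 \<in> schwartz_space"
    and add: "\<And>a b. a \<in> \<Lambda> \<Longrightarrow> b \<in> \<Lambda> \<Longrightarrow> a + b \<in> \<Lambda>"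
    and p: "\<And>j. p j \<in> \<Lambda>"
    and c: "\<And>k. summable (\<lambda>j. cmod (c j) * wt (p j) ^ k)"
    and sums: "\<And>y. (\<lambda>j. c j * tf_shift (p j) g1 y) sums g2 y"
  shows "gabor_WF g2 \<Lambda> u \<subseteq> gabor_WF g1 \<Lambda> u"
proof
  fix z0 assume z0: "z0 \<in> gabor_WF g2 \<Lambda> u"
  then have z0n: "z0 \<noteq> 0" by (simp add: gabor_WF_def)
  show "z0 \<in> gabor_WF g1 \<Lambda> u"
  proof (rule ccontr)
    assume "z0 \<notin> gabor_WF g1 \<Lambda> u"
    then obtain \<Gamma> where \<Gamma>: "open \<Gamma>" "pos_conic \<Gamma>" "z0 \<in> \<Gamma>"
      and bdd: "\<And>N::nat. bdd_above ((\<lambda>l. japanese_bracket l ^ N * cmod (stft g1 u l)) ` (\<Lambda> \<inter> \<Gamma>))"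
      using z0n by (auto simp: gabor_WF_def)
    \<comment> \<open>Radial projection to the unit sphere: preimages of balls under it are conic,
      and open away from the origin where it is continuous.\<close>
    define \<nu> where "\<nu> w = (1 / norm w) *\<^sub>R w" for w :: "(real^'n) \<times> (real^'n)"
    have "\<nu> z0 \<in> \<Gamma>"
      using \<Gamma>(2,3) z0n by (simp add: pos_conic_def \<nu>_def)
    then obtain \<eta> where \<eta>: "\<eta> > 0" "ball (\<nu> z0) \<eta> \<subseteq> \<Gamma>"
      using \<Gamma>(1) open_contains_ball by blast
    \<comment> \<open>Half of the ball is used for the direction of l, the other half for the
      perturbation v / |l|.\<close>
    define e where "e = \<eta> / 2"
    have e: "e > 0" using \<eta> by (simp add: e_def)
    define \<Gamma>' where "\<Gamma>' = (- {0}) \<inter> \<nu> -` ball (\<nu> z0) e"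
    have "open \<Gamma>'"
      unfolding \<Gamma>'_def \<nu>_def by (intro continuous_open_preimage continuous_intros) auto
    moreover have "pos_conic \<Gamma>'"
      by (auto simp: pos_conic_def \<Gamma>'_def \<nu>_def)
    moreover have "\<Gamma>' \<subseteq> - {0}" "z0 \<in> \<Gamma>'" using e z0n by (auto simp: \<Gamma>'_def)
    moreover have "bdd_above ((\<lambda>l. japanese_bracket l ^ N * cmod (stft g2 u l)) ` (\<Lambda> \<inter> \<Gamma>'))" for N :: nat
    proof -
      have cone: "w + v \<in> \<Gamma>" if w: "w \<in> \<Gamma>'" and v: "norm v \<le> e * norm w" for v w
      proof -
        have wn: "norm w > 0" using w by (simp add: \<Gamma>'_def)
        define x where "x = (1 / norm w) *\<^sub>R v"
        have "norm x \<le> e"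
          using v wn by (simp add: x_def field_simps)
        moreover have "dist (\<nu> z0) (\<nu> w) < e" using w by (simp add: \<Gamma>'_def)
        moreover have "dist (\<nu> z0) (\<nu> w + x) \<le> dist (\<nu> z0) (\<nu> w) + norm x"
          using dist_triangle[of "\<nu> z0" "\<nu> w + x" "\<nu> w"] by (simp add: dist_norm)
        ultimately have "dist (\<nu> z0) (\<nu> w + x) < \<eta>" by (simp add: e_def)
        then have "\<nu> w + (1 / norm w) *\<^sub>R v \<in> \<Gamma>" using \<eta>(2) by (auto simp: x_def)
        then have "norm w *\<^sub>R (\<nu> w + (1 / norm w) *\<^sub>R v) \<in> \<Gamma>"
          using \<Gamma>(2) wn by (auto simp: pos_conic_def)
        then show ?thesis using wn by (simp add: \<nu>_def scaleR_add_right)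
      qed
      obtain C1 where C1: "\<And>l. l \<in> \<Lambda> \<Longrightarrow> l \<in> \<Gamma> \<Longrightarrow> japanese_bracket l ^ N * cmod (stft g1 u l) \<le> C1"
        using bdd[of N] unfolding bdd_above_def by blast
      obtain C2 M where C2: "C2 \<ge> 0" "\<And>l. cmod (stft g1 u l) \<le> C2 * wt l ^ M"
        using stft_polynomial_growth[OF u g1] by blast
      \<comment> \<open>The weight of l and the growth of the transform give N + M powers of
        \<open>wt l\<close>, each traded for \<open>wt v\<close> in the second case; another M comes
        from splitting \<open>wt (l + v)\<close>.\<close>
      define L where "L = N + M + M"
      define D1 where "D1 = 2 ^ N * \<bar>C1\<bar>"
      define D2 where "D2 = C2 * (1 + 1 / e) ^ (N + M)"
      have D: "0 \<le> D1" "0 \<le> D2" using C2(1) e by (auto simp: D1_def D2_def)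
      have term_le: "japanese_bracket l ^ N * cmod (stft g1 u (l + v)) \<le> (D1 + D2) * wt v ^ L"
        if l: "l \<in> \<Lambda>" "l \<in> \<Gamma>'" and v: "v \<in> \<Lambda>" for l v
      proof -
        have jw: "japanese_bracket l ^ N \<le> wt l ^ N"
          by (intro power_mono japanese_bracket_le_wt) simp
        show ?thesis
        proof (cases "norm v \<le> e * norm l")
          case True
          have in\<Gamma>: "l + v \<in> \<Lambda>" "l + v \<in> \<Gamma>" using add l v cone True by auto
          have "wt l ^ N \<le> wt (l + v) ^ N * wt v ^ N"
            using wt_add_power_le[of "l + v" "- v" N] by simp
          also have "\<dots> \<le> (2 ^ N * japanese_bracket (l + v) ^ N) * wt v ^ N"
            unfolding power_mult_distrib[symmetric]
            by (intro power_mono mult_right_mono wt_le_japanese_bracket) auto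
          finally have "japanese_bracket l ^ N * cmod (stft g1 u (l + v))
              \<le> ((2 ^ N * japanese_bracket (l + v) ^ N) * wt v ^ N) * cmod (stft g1 u (l + v))"
            using jw by (intro mult_right_mono) auto
          also have "\<dots> = 2 ^ N * (japanese_bracket (l + v) ^ N * cmod (stft g1 u (l + v))) * wt v ^ N"
            by (simp add: mult_ac)
          also have "\<dots> \<le> 2 ^ N * \<bar>C1\<bar> * wt v ^ N"
            using C1[OF in\<Gamma>] by (intro mult_right_mono mult_left_mono) auto
          also have "\<dots> \<le> (D1 + D2) * wt v ^ L"
            using D by (intro mult_mono power_increasing) (auto simp: D1_def L_def)
          finally show ?thesis .
        next
          case False
          \<comment> \<open>Now |v| exceeds e |l|, so only polynomial growth is used, and every
            power of \<open>wt l\<close> is converted into one of \<open>wt v\<close>.\<close>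
          have lv: "wt l \<le> (1 + 1 / e) * wt v"
          proof -
            have "norm l \<le> 1 / e * norm v" using False e by (simp add: field_simps)
            then have "wt l \<le> 1 + 1 / e * norm v" by (simp add: wt_def)
            also have "\<dots> \<le> (1 + 1 / e) * wt v" using e by (simp add: wt_def algebra_simps)
            finally show ?thesis .
          qed
          have "japanese_bracket l ^ N * cmod (stft g1 u (l + v)) \<le> wt l ^ N * (C2 * (wt l ^ M * wt v ^ M))"
            using C2 by (intro mult_mono jw order_trans[OF C2(2)] mult_left_mono wt_add_power_le) auto
          also have "\<dots> = C2 * wt v ^ M * wt l ^ (N + M)" by (simp add: power_add mult_ac)
          also have "\<dots> \<le> C2 * wt v ^ M * ((1 + 1 / e) * wt v) ^ (N + M)"
            using C2(1) by (intro mult_left_mono power_mono lv) auto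
          also have "\<dots> = D2 * wt v ^ L"
            by (simp add: D2_def L_def power_mult_distrib power_add mult_ac)
          also have "\<dots> \<le> (D1 + D2) * wt v ^ L"
            using D by (intro mult_right_mono) auto
          finally show ?thesis .
        qed
      qed
      have "japanese_bracket l ^ N * cmod (stft g2 u l) \<le> (\<Sum>j. (D1 + D2) * (cmod (c j) * wt (p j) ^ L))"
        if l: "l \<in> \<Lambda>" "l \<in> \<Gamma>'" for l
      proof -
        \<comment> \<open>Composing \<Pi>(l) with \<Pi>(p j) gives \<Pi>(l + p j) times this phase;
          the moduli of the coefficients, and with them all bounds, do not depend on l.\<close>
        define c' where "c' j = c j * exp (- (\<i> * (fst l \<bullet> snd (p j))))" for j
        have cc: "cmod (c' j) = cmod (c j)" for j by (simp add: c'_def norm_mult)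
        have s: "(\<lambda>j. cnj (c' j) * stft g1 u (l + p j)) sums u (tf_shift l g2)"
        proof (rule distribution_series[OF u g1 schwartz_tf_shift[OF g2]])
          fix k
          show "summable (\<lambda>j. cmod (c' j) * wt (l + p j) ^ k)"
          proof (rule summable_comparison_test')
            show "summable (\<lambda>j. wt l ^ k * (cmod (c j) * wt (p j) ^ k))"
              by (intro summable_mult c)
            show "norm (cmod (c' j) * wt (l + p j) ^ k) \<le> wt l ^ k * (cmod (c j) * wt (p j) ^ k)" for j
              using mult_left_mono[OF wt_add_power_le[of l "p j" k], of "cmod (c j)"]
              by (simp add: cc mult_ac)
          qed
        next
          fix y
          have "(\<lambda>j. exp (\<i> * (y \<bullet> snd l)) * (c j * tf_shift (p j) g1 (y - fst l))) sums
              (exp (\<i> * (y \<bullet> snd l)) * g2 (y - fst l))"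
            by (intro sums_mult sums)
          moreover have "exp (\<i> * (y \<bullet> snd l)) * (c j * tf_shift (p j) g1 (y - fst l))
              = c' j * tf_shift (l + p j) g1 y" for j
          proof -
            have "exp (\<i> * (y \<bullet> snd l)) * tf_shift (p j) g1 (y - fst l) = tf_shift l (tf_shift (p j) g1) y"
              by (simp add: tf_shift_def[of l] modulation_def translation_def)
            then show ?thesis by (simp add: tf_shift_tf_shift c'_def mult_ac)
          qed
          ultimately show "(\<lambda>j. c' j * tf_shift (l + p j) g1 y) sums tf_shift l g2 y"
            by (simp add: tf_shift_def[of l] modulation_def translation_def)
        qed
        have "(\<lambda>j. of_real (japanese_bracket l ^ N) * (cnj (c' j) * stft g1 u (l + p j))) sums
            (of_real (japanese_bracket l ^ N) * stft g2 u l)"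
          unfolding stft_def[of g2] by (intro sums_mult s)
        moreover have "cmod (of_real (japanese_bracket l ^ N) * (cnj (c' j) * stft g1 u (l + p j)))
            \<le> (D1 + D2) * (cmod (c j) * wt (p j) ^ L)" for j
          using mult_left_mono[OF term_le[OF l p[of j]], of "cmod (c j)"]
          by (simp add: norm_mult norm_power cc mult_ac)
        ultimately have "cmod (of_real (japanese_bracket l ^ N) * stft g2 u l) \<le> (\<Sum>j. (D1 + D2) * (cmod (c j) * wt (p j) ^ L))"
          using norm_suminf_le[of "\<lambda>j. of_real (japanese_bracket l ^ N) * (cnj (c' j) * stft g1 u (l + p j))"
              "\<lambda>j. (D1 + D2) * (cmod (c j) * wt (p j) ^ L)"] summable_mult[OF c]
          by (simp add: sums_iff)
        then show ?thesis by (simp add: norm_mult norm_power)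
      qed
      then show ?thesis by (intro bdd_aboveI2) auto
    qed
    ultimately show False using z0 unfolding gabor_WF_def by blast
  qed
qed

section \<open>Moving the shift by z from the distribution to the window\<close>

lemma tf_shift_commute:
  "tf_shift z (tf_shift w f) = (\<lambda>y. exp (\<i> * (fst w \<bullet> snd z - fst z \<bullet> snd w)) * tf_shift w (tf_shift z f) y)"
  unfolding tf_shift_tf_shift by (rule ext) (simp add: add.commute algebra_simps flip: exp_add)

lemma (in gabor_system) schwartz_expansion_sums:
  assumes g: "g \<in> schwartz_space"
  obtains c where "\<And>k. summable (\<lambda>j. cmod (c j) * wt (enum j) ^ k)"
    and "\<And>y. (\<lambda>j. c j * tf_shift (enum j) \<phi> y) sums g y"
proof -
  obtain c where c: "rapid c" "synthesis c = g" using schwartz_expansion[OF g] by blast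
  show ?thesis
  proof (rule that[of "\<lambda>j. c (enum j)"])
    show "summable (\<lambda>j. cmod (c (enum j)) * wt (enum j) ^ k)" for k
      using infsum_enum(1)[of "\<lambda>l. wt l ^ k * cmod (c l)"] rapid_summable[OF c(1), of k]
      by (simp add: norm_mult norm_power mult.commute)
    show "(\<lambda>j. c (enum j) * tf_shift (enum j) \<phi> y) sums g y" for y
      using infsum_enum(2)[OF synthesis_summable[OF c(1)]] c(2) by (simp add: synthesis_def[symmetric])
  qed
qed

theorem corollary5p2:
  fixes \<phi> :: "real^'n::finite \<Rightarrow> complex"
    and \<alpha> \<beta> :: real
    and u :: "(real^'n \<Rightarrow> complex) \<Rightarrow> complex"
    and z :: "(real^'n) \<times> (real^'n)"
  assumes "\<phi> \<in> schwartz_space" and "\<phi> \<noteq> (\<lambda>_. 0)"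
    and "\<alpha> > 0" and "\<beta> > 0"
    and "gabor_frame \<phi> (tf_lattice \<alpha> \<beta>)"
    and "u \<in> tempered_distributions"
  shows "gabor_WF \<phi> (tf_lattice \<alpha> \<beta>) (tf_shift_dist z u) = gabor_WF \<phi> (tf_lattice \<alpha> \<beta>) u"
proof -
  note \<phi> = assms(1) and u = assms(6)
  let ?\<Lambda> = "tf_lattice \<alpha> \<beta> :: ((real^'n) \<times> (real^'n)) set"
  obtain A B where "gabor_system \<phi> ?\<Lambda> (DIM((real^'n) \<times> (real^'n)) + 2) A B"
    using gabor_system_tf_lattice[OF assms(1,3-5)] by blast
  then interpret gabor_system \<phi> ?\<Lambda> "DIM((real^'n) \<times> (real^'n)) + 2" A B .
  define \<psi> where "\<psi> = tf_shift (- z) \<phi>"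
  have \<psi>: "\<psi> \<in> schwartz_space" unfolding \<psi>_def by (intro schwartz_tf_shift \<phi>)
  note sub = gabor_WF_subset[OF u _ _ tf_lattice_closed(2) enum_in]
  \<comment> \<open>The adjoint of \<Pi>(z) is a phase times \<Pi>(-z), and moving \<Pi>(-z) past
    \<Pi>(l) costs another phase. The wave front set sees only moduli.\<close>
  have "cmod (stft \<phi> (tf_shift_dist z u) l) = cmod (stft \<psi> u l)" for l
  proof -
    have "translation (- fst z) (modulation (- snd z) (tf_shift l \<phi>))
        = (\<lambda>y. (exp (- (\<i> * (fst z \<bullet> snd z))) * exp (\<i> * (fst l \<bullet> snd (- z) - fst (- z) \<bullet> snd l))) * tf_shift l \<psi> y)"
      unfolding adjoint_tf_shift tf_shift_commute[of "- z" l] \<psi>_def by (simp only: mult.assoc)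
    then show ?thesis
      unfolding stft_def tf_shift_dist_def
      by (simp only: distribution_cmult[OF u schwartz_tf_shift[OF \<psi>]]) (simp add: norm_mult)
  qed
  then have "gabor_WF \<phi> ?\<Lambda> (tf_shift_dist z u) = gabor_WF \<psi> ?\<Lambda> u"
    by (simp add: gabor_WF_def)
  also have "\<dots> = gabor_WF \<phi> ?\<Lambda> u"
  proof
    obtain c where "\<And>k. summable (\<lambda>j. cmod (c j) * wt (enum j) ^ k)"
      and "\<And>y. (\<lambda>j. c j * tf_shift (enum j) \<phi> y) sums \<psi> y"
      using schwartz_expansion_sums[OF \<psi>] by blast
    then show "gabor_WF \<psi> ?\<Lambda> u \<subseteq> gabor_WF \<phi> ?\<Lambda> u"
      by (intro sub[OF \<phi> \<psi>])
  next
    \<comment> \<open>For this inclusion \<phi> must be expanded in shifts of \<psi>. Expanding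
      \<Pi>(z)\<phi> in shifts of \<phi> and applying \<Pi>(-z) achieves it: the left side becomes
      \<phi> and each \<Pi>(l)\<phi> becomes \<Pi>(l)\<psi>, up to phases.\<close>
    obtain c where c: "\<And>k. summable (\<lambda>j. cmod (c j) * wt (enum j) ^ k)"
      and sums: "\<And>y. (\<lambda>j. c j * tf_shift (enum j) \<phi> y) sums tf_shift z \<phi> y"
      using schwartz_expansion_sums[OF schwartz_tf_shift[OF \<phi>, of z]] by blast
    \<comment> \<open>Cancels the phase that arises when \<Pi>(-z) is composed with \<Pi>(z);
      \<open>r\<close> below is the phase from interchanging \<Pi>(-z) with a lattice shift.\<close>
    define s where "s = exp (- (\<i> * (fst z \<bullet> snd z)))"
    define r where "r l = exp (\<i> * (fst l \<bullet> snd (- z) - fst (- z) \<bullet> snd l))" for l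
    define c' where "c' j = s * r (enum j) * c j" for j
    have cc: "cmod (c' j) = cmod (c j)" for j by (simp add: c'_def s_def r_def norm_mult)
    have s: "s * tf_shift (- z) (tf_shift z \<phi>) y = \<phi> y" for y
      by (simp add: tf_shift_tf_shift s_def flip: exp_add)
    have shift: "tf_shift (- z) f y = exp (\<i> * (y \<bullet> snd (- z))) * f (y - fst (- z))" for f :: "real^'n \<Rightarrow> complex" and y
      by (simp add: tf_shift_def modulation_def translation_def)
    have "(\<lambda>j. c' j * tf_shift (enum j) \<psi> y) sums \<phi> y" for y
    proof -
      have "(\<lambda>j. s * (exp (\<i> * (y \<bullet> snd (- z))) * (c j * tf_shift (enum j) \<phi> (y - fst (- z)))))
          sums (s * (exp (\<i> * (y \<bullet> snd (- z))) * tf_shift z \<phi> (y - fst (- z))))"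
        by (intro sums_mult sums)
      moreover have "s * (exp (\<i> * (y \<bullet> snd (- z))) * (c j * tf_shift (enum j) \<phi> (y - fst (- z))))
          = c' j * tf_shift (enum j) \<psi> y" for j
      proof -
        have "exp (\<i> * (y \<bullet> snd (- z))) * tf_shift (enum j) \<phi> (y - fst (- z)) = r (enum j) * tf_shift (enum j) \<psi> y"
          unfolding shift[symmetric] tf_shift_commute[of "- z" "enum j"] \<psi>_def r_def ..
        then show ?thesis by (simp add: c'_def mult_ac)
      qed
      ultimately show ?thesis using s[of y] by (simp only: shift)
    qed
    then show "gabor_WF \<phi> ?\<Lambda> u \<subseteq> gabor_WF \<psi> ?\<Lambda> u"
      by (intro sub[OF \<psi> \<phi>, where c = c']) (use c cc in auto)
  qed
  finally show ?thesis .
qed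

end
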